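(* Let $f(x)=\frac12x^TQx+r^Tx$ with $Q\in\mathbb{R}^{n\times n}$ symmetric (not necessarily positive semidefinite) and $r\in\mathbb{R}^n$, and consider the problem of minimizing $f(x)$ subject to $Ax=b$, $x\in P$, where $A\in\mathbb{R}^{m\times n}$, $b\in\mathbb{R}^m$, and $P=\{x\in\mathbb{R}^n:\ell_i\le x_i\le u_i,\ i=1,\dots,n\}$ is a bounded box with $\ell_i<u_i$ for all $i$. Suppose that the origin is in the relative interior of $\{Ax-b:x\in P\}$ and that the strict complementarity condition holds. Let $L>0$ be a Lipschitz constant of $\nabla f$ on $P$, let $\gamma\in\mathbb{R}$ satisfy $\langle\nabla f(x)-\nabla f(x'),x-x'\rangle\ge\gamma\|x-x'\|^2$ for all $x,x'\in P$, let $\Gamma>0$, $p>0$ with $p>-\gamma$, $L_K=L+p+\Gamma\sigma^2$ ($\sigma$ the spectral norm of $A$) and $0<c<1/L_K$. Let $\{(x^t,y^t,z^t)\}$ be generated by the proximal inexact augmented Lagrangian multiplier method with these parameters and sufficiently small stepsizes $\alpha,\beta$ (that is, $\alpha\in(0,\alpha_0)$ for a suitable $\alpha_0>0$, and then $\beta\in(0,\beta_0)$ for a suitable $\beta_0>0$ that may depend on $\alpha$ and $y^0$). Then there exist constants $\kappa>0$ and $t_{\max}>0$ such that $$\Phi^t(z^t)-\Phi^{t+1}(z^{t+1})\ge\kappa\,\Phi^{t+1}(z^{t+1})\qquad\text{for all } t\ge t_{\max}.$$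
   Context: $\|\cdot\|$ is the Euclidean norm and $[\cdot]_+$ the Euclidean projection onto $P$. KKT system: $(x,y,\mu,\nu)$ satisfies $\nabla f(x)+A^Ty-\mu+\nu=0$, $Ax=b$, $\ell_i\le x_i\le u_i$, $\mu_i\ge0$, $\nu_i\ge0$, $\mu_i(\ell_i-x_i)=0$, $\nu_i(x_i-u_i)=0$ for all $i$. $X^*$ is the set of $x$ occurring in a solution of the KKT system. Strict complementarity condition: for every solution of the KKT system and every $i$, exactly one of $\mu_i$ and $\ell_i-x_i$ is zero, and exactly one of $\nu_i$ and $x_i-u_i$ is zero. Let $K(x,z;y)=f(x)+y^T(Ax-b)+\frac{\Gamma}{2}\|Ax-b\|^2+\frac p2\|x-z\|^2$, $d(y,z)=\min_{x\in P}K(x,z;y)$ and $M(z)=\min_{x\in P,\,Ax=b}\left(f(x)+\frac p2\|x-z\|^2\right)$. Proximal inexact augmented Lagrangian multiplier method (parameters $\Gamma>0$, $p>0$, $\alpha>0$, $0<\beta\le1$, $0<c<1/L_K$): start from $x^0\in P$, $z^0\in P$, $y^0\in\mathbb{R}^m$; for $t=0,1,2,\dots$ set $y^{t+1}=y^t+\alpha(Ax^t-b)$, $x^{t+1}=[x^t-c\nabla_xK(x^t,z^t;y^{t+1})]_+$, $z^{t+1}=z^t+\beta(x^{t+1}-z^t)$. Definition of $f^*$: for quadratic $f$, $X^*$ is a finite union of polyhedral sets, $f$ is constant on each connected component of $X^*$, and (for the stepsizes considered) there is a single connected component of $X^*$ to which the distances of both $x^t$ and $z^t$ tend to $0$; $f^*$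 is the value of $f$ on that component. $\Phi^t(z)=\big(K(x^t,z;y^t)-d(y^t,z)\big)+\big(M(z)-d(y^t,z)\big)+\big(M(z)-f^*\big)$. *)

theory Defs
  imports "HOL-Analysis.Analysis"
begin

definition grad :: "(real^'n \<Rightarrow> real) \<Rightarrow> real^'n \<Rightarrow> real^'n" where
  "grad f x = (THE g. GDERIV f x :> g)"

lemma grad_eqI:
  assumes "GDERIV f x :> g"
  shows "grad f x = g"
proof -
  have "g' = g" if "GDERIV f x :> g'" for g'
  proof -
    have "(\<lambda>h. inner h g') = (\<lambda>h. inner h g)"
      using that assms has_derivative_unique unfolding gderiv_def by blast
    then have "inner (g' - g) g' = inner (g' - g) g"
      by meson
    then have "inner (g' - g) (g' - g) = 0"
      by (simp add: inner_diff_right)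
    then show ?thesis by simp
  qed
  then show ?thesis
    unfolding grad_def using assms by blast
qed

text \<open>
  The problem is to minimize \<open>f x\<close> subject to \<open>A *v x = b\<close> and \<open>x \<in> cbox l u\<close>; the library's
  \<open>cbox l u\<close> is the box of all \<open>x\<close> with \<open>l $ i \<le> x $ i \<le> u $ i\<close> for every \<open>i\<close>
  (\<open>mem_box_cart\<close>).
\<close>

definition KKT ::
  "(real^'n \<Rightarrow> real) \<Rightarrow> real^'n^'m \<Rightarrow> real^'m \<Rightarrow> real^'n \<Rightarrow> real^'n
   \<Rightarrow> real^'n \<Rightarrow> real^'m \<Rightarrow> real^'n \<Rightarrow> real^'n \<Rightarrow> bool" where
  "KKT f A b l u x y \<mu> \<nu> \<longleftrightarrow>
     grad f x + transpose A *v y - \<mu> + \<nu> = 0 \<and>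
     A *v x = b \<and>
     (\<forall>i. l $ i \<le> x $ i \<and> x $ i \<le> u $ i \<and> \<mu> $ i \<ge> 0 \<and> \<nu> $ i \<ge> 0 \<and>
          \<mu> $ i * (l $ i - x $ i) = 0 \<and> \<nu> $ i * (x $ i - u $ i) = 0)"

definition Xstar ::
  "(real^'n \<Rightarrow> real) \<Rightarrow> real^'n^'m \<Rightarrow> real^'m \<Rightarrow> real^'n \<Rightarrow> real^'n \<Rightarrow> (real^'n) set" where
  "Xstar f A b l u = {x. \<exists>y \<mu> \<nu>. KKT f A b l u x y \<mu> \<nu>}"

text \<open>Disequality of truth values expresses ``exactly one of the two''.\<close>

definition strict_complementarity ::
  "(real^'n \<Rightarrow> real) \<Rightarrow> real^'n^'m \<Rightarrow> real^'m \<Rightarrow> real^'n \<Rightarrow> real^'n \<Rightarrow> bool" where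
  "strict_complementarity f A b l u \<longleftrightarrow>
     (\<forall>x y \<mu> \<nu>. KKT f A b l u x y \<mu> \<nu> \<longrightarrow>
        (\<forall>i. (\<mu> $ i = 0) \<noteq> (l $ i - x $ i = 0) \<and> (\<nu> $ i = 0) \<noteq> (x $ i - u $ i = 0)))"

definition aug_lagr ::
  "(real^'n \<Rightarrow> real) \<Rightarrow> real^'n^'m \<Rightarrow> real^'m \<Rightarrow> real \<Rightarrow> real
   \<Rightarrow> real^'n \<Rightarrow> real^'n \<Rightarrow> real^'m \<Rightarrow> real" where
  "aug_lagr f A b \<Gamma> p x z y =
     f x + y \<bullet> (A *v x - b) + \<Gamma> / 2 * (norm (A *v x - b))\<^sup>2 + p / 2 * (norm (x - z))\<^sup>2"

text \<open>
  The infima in \<open>dual_val\<close> and \<open>prox_val\<close> are minima whenever \<open>f\<close> is continuous and the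
  (compact) set over which they are taken is nonempty.
\<close>

definition dual_val ::
  "(real^'n \<Rightarrow> real) \<Rightarrow> real^'n^'m \<Rightarrow> real^'m \<Rightarrow> real^'n \<Rightarrow> real^'n \<Rightarrow> real \<Rightarrow> real
   \<Rightarrow> real^'m \<Rightarrow> real^'n \<Rightarrow> real" where
  "dual_val f A b l u \<Gamma> p y z = (INF x\<in>cbox l u. aug_lagr f A b \<Gamma> p x z y)"

definition prox_val ::
  "(real^'n \<Rightarrow> real) \<Rightarrow> real^'n^'m \<Rightarrow> real^'m \<Rightarrow> real^'n \<Rightarrow> real^'n \<Rightarrow> real
   \<Rightarrow> real^'n \<Rightarrow> real" where
  "prox_val f A b l u p z =
     (INF x\<in>{x \<in> cbox l u. A *v x = b}. f x + p / 2 * (norm (x - z))\<^sup>2)"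

text \<open>
  The sequences \<open>x\<close>, \<open>y\<close>, \<open>z\<close> are generated by the proximal inexact augmented Lagrangian
  multiplier method.
\<close>

definition prox_ialm ::
  "(real^'n \<Rightarrow> real) \<Rightarrow> real^'n^'m \<Rightarrow> real^'m \<Rightarrow> real^'n \<Rightarrow> real^'n
   \<Rightarrow> real \<Rightarrow> real \<Rightarrow> real \<Rightarrow> real \<Rightarrow> real
   \<Rightarrow> (nat \<Rightarrow> real^'n) \<Rightarrow> (nat \<Rightarrow> real^'m) \<Rightarrow> (nat \<Rightarrow> real^'n) \<Rightarrow> bool" where
  "prox_ialm f A b l u \<Gamma> p c \<alpha> \<beta> x y z \<longleftrightarrow>
     x 0 \<in> cbox l u \<and> z 0 \<in> cbox l u \<and>
     (\<forall>t. y (Suc t) = y t + \<alpha> *\<^sub>R (A *v x t - b) \<and>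
          x (Suc t) = closest_point (cbox l u)
            (x t - c *\<^sub>R grad (\<lambda>w. aug_lagr f A b \<Gamma> p w (z t) (y (Suc t))) (x t)) \<and>
          z (Suc t) = z t + \<beta> *\<^sub>R (x (Suc t) - z t))"

text \<open>
  The value of \<open>f\<close> on the connected component of \<open>Xstar\<close> to which the distances of both
  \<open>x t\<close> and \<open>z t\<close> tend to \<open>0\<close>. Components are nonempty, so \<open>infdist\<close> is the usual distance.
\<close>

definition fstar ::
  "(real^'n \<Rightarrow> real) \<Rightarrow> real^'n^'m \<Rightarrow> real^'m \<Rightarrow> real^'n \<Rightarrow> real^'n
   \<Rightarrow> (nat \<Rightarrow> real^'n) \<Rightarrow> (nat \<Rightarrow> real^'n) \<Rightarrow> real" where
  "fstar f A b l u x z =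
     (THE v. \<exists>C \<in> components (Xstar f A b l u).
        (\<lambda>t. infdist (x t) C) \<longlonglongrightarrow> 0 \<and> (\<lambda>t. infdist (z t) C) \<longlonglongrightarrow> 0 \<and> (\<forall>w\<in>C. f w = v))"

definition potential ::
  "(real^'n \<Rightarrow> real) \<Rightarrow> real^'n^'m \<Rightarrow> real^'m \<Rightarrow> real^'n \<Rightarrow> real^'n \<Rightarrow> real \<Rightarrow> real
   \<Rightarrow> (nat \<Rightarrow> real^'n) \<Rightarrow> (nat \<Rightarrow> real^'m) \<Rightarrow> (nat \<Rightarrow> real^'n)
   \<Rightarrow> nat \<Rightarrow> real^'n \<Rightarrow> real" where
  "potential f A b l u \<Gamma> p x y z t w =
     (aug_lagr f A b \<Gamma> p (x t) w (y t) - dual_val f A b l u \<Gamma> p (y t) w) +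
     (prox_val f A b l u p w - dual_val f A b l u \<Gamma> p (y t) w) +
     (prox_val f A b l u p w - fstar f A b l u x z)"

end

theory Submission
  imports Defs
begin

text \<open>
  Write \<open>x(y,z)\<close> for the minimizer defining \<open>d(y,z)\<close> and \<open>x*(z)\<close> for the one defining \<open>M(z)\<close>. The box
  constrained problems are parametric convex quadratic programs, so
  \<open>\<parallel>x*(z) - x(y,z)\<parallel> \<le> \<sigma> \<parallel>A x(y,z) - b\<parallel>\<close> holds globally, by a Hoffman type bound on the difference of
  the multipliers. With it, \<open>\<phi> = K - 2 d + 2 M\<close> decreases in each step by a multiple of
  \<open>\<parallel>x\<^sup>t - x\<^sup>t\<^sup>+\<^sup>1\<parallel>\<^sup>2 + \<parallel>z\<^sup>t - z\<^sup>t\<^sup>+\<^sup>1\<parallel>\<^sup>2 + \<parallel>A x(y\<^sup>t\<^sup>+\<^sup>1,z\<^sup>t) - b\<parallel>\<^sup>2\<close>, which therefore tends to \<open>0\<close>. Hence the cluster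
  points are KKT points; they form a connected set, which singles out the component defining \<open>f*\<close>.
  Finally each of the three parts of the potential is bounded by the same sum of squares. For \<open>K - d\<close>
  this is strong convexity. For \<open>M - d\<close> and \<open>M - f*\<close> it holds eventually, because the Slater condition
  bounds the multipliers and strict complementarity then forces the active sets of both minimizers to
  coincide with that of a limiting KKT point; on a fixed active set the bounds are linear algebra.
\<close>

section \<open>Linear inequalities, symmetric forms and cluster points\<close>

text \<open>\<open>f\<close> is nonconvex, so the displacement from an iterate to a limiting KKT
  point is not controlled where the form of \<open>Q\<close> degenerates on the critical subspace.
  The bound on \<open>M - f*\<close> is therefore a bound on values: the trapezoid rule, exact for
  quadratics, expresses the difference of values by gradients at both ends, and the degenerate
  directions drop out by symmetry of \<open>Q\<close>. Multipliers \<open>y\<close> enter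
  stationarity only through the row space of \<open>A\<close>; what is bounded and passed to limits
  is the box normal \<open>n\<close>. The expansion of \<open>M - d\<close> has exactly one term of
  first order, the pairing of the box normal at x(y,z) with x*(z) - x(y,z). Strict complementarity
  matters for the rate because it makes this term vanish eventually. The potential is \<phi> - f*,
  so \<kappa> is the reciprocal of the product of two constants: the one bounding the squared step
  lengths by the descent of \<phi>, and the one bounding the next potential by those squares. The
  constant of the dual error bound is uniform in \<Gamma>, y and z, which allows the stepsize
  thresholds to be fixed before the run.\<close>

lemma norm_le_sum_inner_on_span:
  fixes a :: "'i \<Rightarrow> 'a::euclidean_space"
  assumes "finite J"
  shows "\<exists>C\<ge>0. \<forall>y\<in>span (a ` J). norm y \<le> C * (\<Sum>j\<in>J. \<bar>a j \<bullet> y\<bar>)"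
proof -
  \<comment> \<open>\<open>T\<close> is the frame operator of the family \<open>a\<close>. It is
    injective on the span because \<open>y \<bullet> T y\<close> is a sum of squares, hence bounded
    below there.\<close>
  define T where "T y = (\<Sum>j\<in>J. (a j \<bullet> y) *\<^sub>R a j)" for y
  have "bounded_linear T"
    unfolding T_def
    by (intro bounded_linear_sum bounded_linear_scaleR_const bounded_linear_inner_right)
  moreover have "y = 0" if y: "y \<in> span (a ` J)" and "T y = 0" for y
  proof -
    have "0 = y \<bullet> T y" using that by simp
    also have "\<dots> = (\<Sum>j\<in>J. (a j \<bullet> y)\<^sup>2)"
      unfolding T_def inner_sum_right
      by (intro sum.cong) (auto simp: inner_commute power2_eq_square)
    finally have "(\<Sum>j\<in>J. (a j \<bullet> y)\<^sup>2) = 0" by simp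
    then have "\<forall>j\<in>J. a j \<bullet> y = 0"
      using assms by (subst (asm) sum_nonneg_eq_0_iff) auto
    then have "orthogonal y y"
      by (intro orthogonal_to_span[OF y]) (auto simp: orthogonal_def inner_commute)
    then show ?thesis by (simp add: orthogonal_def)
  qed
  ultimately obtain e where e: "e > 0" "\<And>y. y \<in> span (a ` J) \<Longrightarrow> e * norm y \<le> norm (T y)"
    using injective_imp_isometric[of "span (a ` J)" T] closed_subspace subspace_span by blast
  define M where "M = (\<Sum>j\<in>J. norm (a j))"
  have "M \<ge> 0" unfolding M_def by (simp add: sum_nonneg)
  have "norm y \<le> M / e * (\<Sum>j\<in>J. \<bar>a j \<bullet> y\<bar>)" if "y \<in> span (a ` J)" for y
  proof -
    have "norm (a j) \<le> M" if "j \<in> J" for j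
      unfolding M_def using assms that by (intro member_le_sum) auto
    then have "norm (T y) \<le> (\<Sum>j\<in>J. \<bar>a j \<bullet> y\<bar> * M)"
      unfolding T_def by (intro sum_norm_le) (simp add: mult_left_mono)
    then have "e * norm y \<le> M * (\<Sum>j\<in>J. \<bar>a j \<bullet> y\<bar>)"
      using e(2)[OF that] by (simp add: sum_distrib_left mult.commute)
    then show ?thesis using e(1) by (simp add: field_simps)
  qed
  then show ?thesis using \<open>M \<ge> 0\<close> e(1) by (intro exI[of _ "M / e"]) auto
qed

text \<open>Moving a solution with the largest number of tight constraints along the component orthogonal
  to the tight normals cannot produce a new tight constraint, so that component can be removed.\<close>

lemma solution_in_span_of_tight:
  fixes a :: "'i \<Rightarrow> 'a::euclidean_space"
  assumes "finite J" and "\<forall>i\<in>J. a i \<bullet> y \<le> \<beta> i"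
  obtains J' v where "J' \<subseteq> J" "v \<in> span (a ` J')" "\<forall>j\<in>J'. a j \<bullet> v = \<beta> j" "\<forall>i\<in>J. a i \<bullet> v \<le> \<beta> i"
proof -
  let ?F = "\<lambda>y. \<forall>i\<in>J. a i \<bullet> y \<le> \<beta> i"
  let ?t = "\<lambda>y. {i\<in>J. a i \<bullet> y = \<beta> i}"
  have "\<forall>y. ?F y \<longrightarrow> card (?t y) < Suc (card J)"
    using assms(1) by (auto intro!: le_imp_less_Suc card_mono)
  then obtain y1 where y1: "?F y1" and max: "\<And>y. ?F y \<Longrightarrow> card (?t y) \<le> card (?t y1)"
    using ex_has_greatest_nat[of ?F y "\<lambda>y. card (?t y)" "Suc (card J)"] assms(2) by blast
  obtain v w where v: "v \<in> span (a ` ?t y1)" and w: "\<And>x. x \<in> span (a ` ?t y1) \<Longrightarrow> orthogonal w x"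
    and yvw: "y1 = v + w"
    using orthogonal_subspace_decomp_exists[of "a ` ?t y1" y1] by blast
  have w0: "a j \<bullet> w = 0" if "j \<in> ?t y1" for j
    using w[of "a j"] that by (auto simp: orthogonal_def inner_commute intro: span_base)
  have tight: "a j \<bullet> v = \<beta> j" if "j \<in> ?t y1" for j
    using w0[OF that] that by (simp add: yvw inner_add_right)
  have "?F v"
  proof (rule ccontr)
    define V where "V = {i\<in>J. a i \<bullet> v > \<beta> i}"
    assume "\<not> ?F v"
    then have "V \<noteq> {}" "finite V" using assms(1) by (auto simp: V_def not_le)
    \<comment> \<open>\<open>s j\<close> is the step along \<open>- w\<close> at which constraint
      \<open>j\<close>, satisfied at \<open>y1\<close> and violated at \<open>v = y1 - w\<close>,
      becomes tight. The smallest one, \<open>s k\<close>, keeps all of \<open>V\<close> feasible;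
      constraints outside \<open>V\<close> hold at both ends of the segment.\<close>
    define s where "s j = (\<beta> j - a j \<bullet> y1) / (- (a j \<bullet> w))" for j
    have neg: "a j \<bullet> w < 0 \<and> a j \<bullet> y1 < \<beta> j" if "j \<in> V" for j
    proof -
      have "a j \<bullet> w < 0" using y1 that by (force simp: V_def yvw inner_add_right)
      then show ?thesis using w0[of j] y1 that by (fastforce simp: V_def)
    qed
    obtain k where k: "k \<in> V" "\<And>j. j \<in> V \<Longrightarrow> s k \<le> s j"
      using \<open>V \<noteq> {}\<close> \<open>finite V\<close> by (metis arg_min_if_finite(1) arg_min_least)
    have sk: "s k > 0" "s k \<le> 1"
      using neg[OF k(1)] k(1) unfolding s_def V_def
      by (auto simp: divide_simps yvw inner_add_right)
    let ?y = "y1 - s k *\<^sub>R w"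
    have F: "?F ?y"
    proof
      fix i assume i: "i \<in> J"
      show "a i \<bullet> ?y \<le> \<beta> i"
      proof (cases "i \<in> V")
        case True
        have "s k * (- (a i \<bullet> w)) \<le> s i * (- (a i \<bullet> w))"
          using k(2)[OF True] neg[OF True] by (intro mult_right_mono) auto
        also have "\<dots> = \<beta> i - a i \<bullet> y1" using neg[OF True] by (simp add: s_def)
        finally show ?thesis by (simp add: inner_diff_right)
      next
        case False
        then have "s k * (a i \<bullet> v) \<le> s k * \<beta> i" "(1 - s k) * (a i \<bullet> y1) \<le> (1 - s k) * \<beta> i"
          using i sk y1 by (auto simp: V_def not_less intro: mult_left_mono)
        moreover have "a i \<bullet> ?y = s k * (a i \<bullet> v) + (1 - s k) * (a i \<bullet> y1)"
          by (simp add: yvw inner_diff_right inner_add_right algebra_simps)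
        ultimately show ?thesis by (simp add: algebra_simps)
      qed
    qed
    have "a k \<bullet> ?y = \<beta> k" using neg[OF k(1)] by (simp add: s_def inner_diff_right inner_add_right)
    then have "insert k (?t y1) \<subseteq> ?t ?y"
      using w0 k(1) by (auto simp: V_def inner_diff_right)
    moreover have "k \<notin> ?t y1" using neg[OF k(1)] by auto
    ultimately have "card (?t y1) < card (?t ?y)"
      using assms(1) by (intro psubset_card_mono) auto
    then show False using max[OF F] by simp
  qed
  then show thesis using that[of "?t y1" v] v tight by auto
qed

text \<open>A solution in the span of its own tight normals is determined by the tight right-hand
  sides, so the bound on spans applies to it. Only finitely many index sets occur, hence one
  \<open>C\<close> serves every subsystem and every right-hand side; summing the constants is merely
  a way to dominate each of them.\<close>

proposition bounded_solution_of_inequalities: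
  fixes a :: "'i \<Rightarrow> 'a::euclidean_space"
  assumes "finite I"
  shows "\<exists>C\<ge>0. \<forall>J \<beta> y. J \<subseteq> I \<longrightarrow> (\<forall>i\<in>J. a i \<bullet> y \<le> \<beta> i) \<longrightarrow>
           (\<exists>y'. (\<forall>i\<in>J. a i \<bullet> y' \<le> \<beta> i) \<and> norm y' \<le> C * (\<Sum>i\<in>J. \<bar>\<beta> i\<bar>))"
proof -
  have "\<forall>J\<in>Pow I. \<exists>C\<ge>0. \<forall>y\<in>span (a ` J). norm y \<le> C * (\<Sum>j\<in>J. \<bar>a j \<bullet> y\<bar>)"
    using norm_le_sum_inner_on_span finite_subset[OF _ assms] by blast
  then obtain c where c0: "\<And>J. J \<subseteq> I \<Longrightarrow> c J \<ge> 0"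
    and c: "\<And>J y. J \<subseteq> I \<Longrightarrow> y \<in> span (a ` J) \<Longrightarrow> norm y \<le> c J * (\<Sum>j\<in>J. \<bar>a j \<bullet> y\<bar>)"
    by (metis Pow_iff)
  define C where "C = sum c (Pow I)"
  have C: "c J \<le> C" if "J \<subseteq> I" for J
    unfolding C_def using that assms c0 by (intro member_le_sum) auto
  have "\<exists>y'. (\<forall>i\<in>J. a i \<bullet> y' \<le> \<beta> i) \<and> norm y' \<le> C * (\<Sum>i\<in>J. \<bar>\<beta> i\<bar>)"
    if J: "J \<subseteq> I" and y: "\<forall>i\<in>J. a i \<bullet> y \<le> \<beta> i" for J \<beta> y
  proof -
    have "finite J" using J assms finite_subset by blast
    then obtain J' v where v: "J' \<subseteq> J" "v \<in> span (a ` J')" "\<forall>j\<in>J'. a j \<bullet> v = \<beta> j"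
      "\<forall>i\<in>J. a i \<bullet> v \<le> \<beta> i"
      using solution_in_span_of_tight y by blast
    have J': "J' \<subseteq> I" using v(1) J by auto
    have "norm v \<le> c J' * (\<Sum>j\<in>J'. \<bar>\<beta> j\<bar>)" using c[OF J' v(2)] v(3) by simp
    also have "\<dots> \<le> C * (\<Sum>j\<in>J. \<bar>\<beta> j\<bar>)"
      using C[OF J'] c0[OF J'] v(1) \<open>finite J\<close>
      by (intro mult_mono sum_mono2 sum_nonneg) auto
    finally show ?thesis using v(4) by blast
  qed
  moreover have "C \<ge> 0" unfolding C_def using c0 by (intro sum_nonneg) auto
  ultimately show ?thesis by blast
qed

text \<open>The equation determines \<open>D\<close> only up to the kernel of the form on
  \<open>S\<close>, so \<open>D\<close> itself may be large. By symmetry the kernel part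
  \<open>D0\<close> contributes nothing to \<open>e \<bullet> D\<close>, and the complementary part
  \<open>D1\<close> is bounded by a multiple of \<open>norm e\<close>.\<close>

lemma symmetric_form_bound_on_subspace:
  fixes T :: "'a::euclidean_space \<Rightarrow> 'a"
  assumes T: "linear T" and sym: "\<And>v w. T v \<bullet> w = v \<bullet> T w" and S: "subspace S"
  shows "\<exists>C\<ge>0. \<forall>D\<in>S. \<forall>e. (\<forall>v\<in>S. T D \<bullet> v = e \<bullet> v) \<longrightarrow> e \<bullet> D \<le> C * (norm e)\<^sup>2"
proof -
  obtain B where B: "B \<subseteq> S" "pairwise orthogonal B" "\<And>x. x \<in> B \<Longrightarrow> norm x = 1" "independent B"
    "span B = S"
    using orthonormal_basis_subspace[OF S] by metis
  have finB: "finite B" using B(4) by (simp add: independent_imp_finite)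
  define R where "R w = (\<Sum>v\<in>B. (w \<bullet> v) *\<^sub>R v)" for w
  have R: "linear R" unfolding R_def
    by (intro linear_compose_sum ballI bounded_linear.linear bounded_linear_scaleR_const bounded_linear_inner_left)
  have Rv: "R w \<bullet> v = w \<bullet> v" if "v \<in> S" for v w
  proof -
    have "orthogonal (R w - w) v"
    proof (rule orthogonal_to_span)
      show "v \<in> span B" using that B by simp
      fix b assume b: "b \<in> B"
      have "R w \<bullet> b = (\<Sum>v\<in>B. if v = b then w \<bullet> b else 0)"
        unfolding R_def inner_sum_left using B(2,3) b
        by (intro sum.cong) (auto simp: pairwise_def orthogonal_def norm_eq_1)
      then show "orthogonal (R w - w) b" using finB b by (simp add: orthogonal_def inner_diff_left)
    qed
    then show ?thesis by (simp add: orthogonal_def inner_diff_left)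
  qed
  have RS: "R w \<in> S" for w
    unfolding R_def using B(1) S by (intro subspace_sum subspace_scale) auto
  have Rn: "norm (R w) \<le> norm w" for w
  proof -
    have "norm (R w) * norm (R w) = w \<bullet> R w"
      using Rv[OF RS] by (simp add: power2_norm_eq_inner flip: power2_eq_square)
    also have "\<dots> \<le> norm w * norm (R w)" by (rule norm_cauchy_schwarz)
    finally show ?thesis
      using mult_right_le_imp_le[of "norm (R w)" "norm (R w)" "norm w"] by (cases "R w = 0") auto
  qed
  \<comment> \<open>With \<open>R\<close> the orthogonal projection onto \<open>S\<close>,
    \<open>Kn\<close> is the kernel of the compression of \<open>T\<close> to \<open>S\<close> and
    \<open>W\<close> its orthogonal complement within \<open>S\<close>. The compression is injective
    on \<open>W\<close>, which yields the lower bound \<open>m\<close>.\<close>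
  define Kn where "Kn = {D\<in>S. R (T D) = 0}"
  have Kn: "subspace Kn" unfolding Kn_def
    using S linear_compose[OF T R] subspace_inter[OF S linear_subspace_kernel[of "R \<circ> T"]]
    by (simp add: Int_def)
  define W where "W = {D\<in>S. \<forall>k\<in>Kn. D \<bullet> k = 0}"
  have W: "subspace W" unfolding W_def subspace_def using S
    by (auto simp: subspace_def inner_add_left)
  have "D = 0" if "D \<in> W" "R (T D) = 0" for D
    using that by (auto simp: W_def Kn_def)
  then obtain m where m: "m > 0" "\<And>D. D \<in> W \<Longrightarrow> m * norm D \<le> norm (R (T D))"
    using injective_imp_isometric[OF closed_subspace[OF W] W, of "R \<circ> T"] linear_compose[OF T R]
    by (auto simp: linear_conv_bounded_linear)
  have "e \<bullet> D \<le> 1 / m * (norm e)\<^sup>2" if D: "D \<in> S" and eq: "\<forall>v\<in>S. T D \<bullet> v = e \<bullet> v" for D e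
  proof -
    obtain D0 D1 where D0: "D0 \<in> span Kn" and D1: "\<And>x. x \<in> span Kn \<Longrightarrow> orthogonal D1 x"
      and D01: "D = D0 + D1"
      using orthogonal_subspace_decomp_exists[of Kn D] by blast
    have D0K: "D0 \<in> Kn" using D0 Kn by (metis span_eq_iff)
    have D1S: "D1 \<in> S"
      using D D0K S D01 unfolding Kn_def by (metis (no_types, lifting) add_diff_cancel_left' mem_Collect_eq subspace_diff)
    have D1W: "D1 \<in> W" using D1 D1S by (auto simp: W_def orthogonal_def intro: span_base)
    have TD0: "T D0 \<bullet> v = 0" if "v \<in> S" for v
      using Rv[OF that, of "T D0"] D0K by (simp add: Kn_def)
    have "R (T D) = R (T D1)"
      using D0K by (simp add: D01 linear_add[OF T] linear_add[OF R] Kn_def)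
    moreover have "norm (R (T D)) \<le> norm e"
    proof -
      have "R (T D) = R e"
        unfolding R_def using eq B(1) by (intro sum.cong) auto
      then show ?thesis using Rn by simp
    qed
    ultimately have nD1: "norm D1 \<le> norm e / m" using m(1) m(2)[OF D1W] by (simp add: field_simps)
    have "e \<bullet> D = T D \<bullet> D" using eq D by simp
    also have "\<dots> = T D0 \<bullet> D + D1 \<bullet> T D" by (simp add: D01 linear_add[OF T] inner_add_left sym)
    also have "\<dots> = T D \<bullet> D1" using TD0[OF D] by (simp add: inner_commute)
    also have "\<dots> = e \<bullet> D1" using eq D1S by simp
    also have "\<dots> \<le> norm e * norm D1" by (rule norm_cauchy_schwarz)
    also have "\<dots> \<le> norm e * (norm e / m)" using nD1 by (intro mult_left_mono) auto
    finally show ?thesis by (simp add: power2_eq_square)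
  qed
  then show ?thesis using m(1) by (intro exI[of _ "1 / m"]) auto
qed

section \<open>Cluster points of bounded sequences with vanishing steps\<close>

definition cluster_points :: "(nat \<Rightarrow> 'a::metric_space) \<Rightarrow> 'a set" where
  "cluster_points x = {w. \<forall>e>0. \<exists>\<^sub>F n in sequentially. dist (x n) w < e}"

lemma closed_cluster_points: "closed (cluster_points x)"
proof (unfold closure_subset_eq[symmetric], rule subsetI)
  fix w assume "w \<in> closure (cluster_points x)"
  then have w: "\<forall>e>0. \<exists>v\<in>cluster_points x. dist v w < e" by (simp add: closure_approachable)
  show "w \<in> cluster_points x"
    unfolding cluster_points_def
  proof (intro CollectI allI impI)
    fix e :: real assume "e > 0"
    then obtain v where v: "v \<in> cluster_points x" "dist v w < e / 2" using w half_gt_zero by blast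
    then have "\<exists>\<^sub>F n in sequentially. dist (x n) v < e / 2"
      using \<open>e > 0\<close> half_gt_zero[of e] unfolding cluster_points_def by blast
    then show "\<exists>\<^sub>F n in sequentially. dist (x n) w < e"
      using v(2) by (elim frequently_elim1) metric
  qed
qed

lemma cluster_points_subseqI:
  assumes "strict_mono (s :: nat \<Rightarrow> nat)" "(x \<circ> s) \<longlonglongrightarrow> w"
  shows "w \<in> cluster_points x"
  unfolding cluster_points_def frequently_sequentially
proof (intro CollectI allI impI)
  fix e :: real and N assume "e > 0"
  then obtain M where "\<And>k. k \<ge> M \<Longrightarrow> dist (x (s k)) w < e"
    using assms(2) unfolding lim_sequentially by (auto simp: o_def)
  then show "\<exists>n\<ge>N. dist (x n) w < e"
    using seq_suble[OF assms(1)] by (meson le_trans nat_le_linear)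
qed

lemma cluster_points_subseqE:
  assumes "w \<in> cluster_points x"
  obtains s :: "nat \<Rightarrow> nat" where "strict_mono s" "(x \<circ> s) \<longlonglongrightarrow> w"
proof -
  have ex: "\<exists>n\<ge>N. dist (x n) w < 1 / (real k + 1)" for k N
    using assms unfolding cluster_points_def frequently_sequentially by (simp del: of_nat_Suc)
  have "\<exists>s. \<forall>k. dist (x (s k)) w < 1 / (real k + 1) \<and> s k < s (Suc k)"
  proof (rule dependent_nat_choice)
    show "\<exists>n. dist (x n) w < 1 / (real 0 + 1)" using ex[of 0 0] by blast
    show "\<exists>m. dist (x m) w < 1 / (real (Suc k) + 1) \<and> n < m" for n k
      using ex[of "Suc n" "Suc k"] unfolding Suc_le_eq by blast
  qed
  then obtain s where s: "\<And>k. dist (x (s k)) w < 1 / (real k + 1)" "strict_mono s"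
    by (auto simp: strict_mono_Suc_iff)
  have "(\<lambda>k. dist (x (s k)) w) \<longlonglongrightarrow> 0"
  proof (rule tendsto_sandwich[OF _ _ tendsto_const])
    show "(\<lambda>k. 1 / (real k + 1)) \<longlonglongrightarrow> 0"
      using LIMSEQ_inverse_real_of_nat by (simp add: inverse_eq_divide add.commute)
  qed (use s(1) in \<open>auto intro!: always_eventually less_imp_le\<close>)
  then have "(x \<circ> s) \<longlonglongrightarrow> w" unfolding o_def using tendsto_dist_iff by blast
  then show thesis using that s(2) by blast
qed

text \<open>A subsequence staying at distance \<open>e\<close> would itself accumulate, at a cluster
  point. The nonemptiness claim gives the first one its content, since \<open>infdist\<close> to the
  empty set is 0 by convention.\<close>

lemma infdist_cluster_points_tendsto_0:
  fixes x :: "nat \<Rightarrow> 'a::heine_borel"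
  assumes "bounded (range x)"
  shows "(\<lambda>n. infdist (x n) (cluster_points x)) \<longlonglongrightarrow> 0" and "cluster_points x \<noteq> {}"
proof -
  let ?W = "cluster_points x"
  show "?W \<noteq> {}"
    using bounded_imp_convergent_subsequence[OF assms] cluster_points_subseqI by blast
  show "(\<lambda>n. infdist (x n) ?W) \<longlonglongrightarrow> 0"
  proof (rule ccontr)
    assume "\<not> ?thesis"
    then obtain e where e: "e > 0" and "\<not> (\<forall>\<^sub>F n in sequentially. dist (infdist (x n) ?W) 0 < e)"
      unfolding tendsto_iff by blast
    then have fr: "\<exists>\<^sub>F n in sequentially. infdist (x n) ?W \<ge> e"
      by (simp add: not_eventually infdist_nonneg not_less)
    then have "infinite {n. infdist (x n) ?W \<ge> e}"
      by (simp add: frequently_cofinite flip: cofinite_eq_sequentially)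
    then obtain s :: "nat \<Rightarrow> nat" where s: "strict_mono s" "\<And>k. infdist (x (s k)) ?W \<ge> e"
      using infinite_enumerate by (metis mem_Collect_eq)
    have "bounded (range (x \<circ> s))" using assms by (rule bounded_subset) auto
    then obtain w s' where s': "strict_mono (s' :: nat \<Rightarrow> nat)" "((x \<circ> s) \<circ> s') \<longlonglongrightarrow> w"
      using bounded_imp_convergent_subsequence by blast
    have "w \<in> ?W"
      using cluster_points_subseqI[of "s \<circ> s'" x w] s'(2) strict_mono_o[OF s(1) s'(1)] by (simp add: o_assoc)
    then have "infdist w ?W = 0" by simp
    moreover have "(\<lambda>k. infdist (x (s (s' k))) ?W) \<longlonglongrightarrow> infdist w ?W"
      using tendsto_infdist[OF s'(2)] by (simp add: o_def)
    then have "e \<le> infdist w ?W" using s(2) by (intro LIMSEQ_le_const) auto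
    ultimately show False using e by simp
  qed
qed

text \<open>Two separated pieces would have a positive distance \<delta>. Once the steps and the
  distance to the cluster set are below \<delta>/3, the sequence cannot pass from one piece to the
  other, yet it has to visit both infinitely often.\<close>

lemma connected_cluster_points:
  fixes x :: "nat \<Rightarrow> 'a::heine_borel"
  assumes bdd: "bounded (range x)" and step: "(\<lambda>n. dist (x (Suc n)) (x n)) \<longlonglongrightarrow> 0"
  shows "connected (cluster_points x)"
proof (rule ccontr)
  let ?W = "cluster_points x"
  assume "\<not> connected ?W"
  then obtain A B where AB: "closed A" "closed B" "?W \<subseteq> A \<union> B" "A \<inter> B \<inter> ?W = {}"
    "A \<inter> ?W \<noteq> {}" "B \<inter> ?W \<noteq> {}"
    unfolding connected_closed by blast
  have "?W \<subseteq> closure (range x)"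
  proof
    fix w assume "w \<in> ?W"
    then show "w \<in> closure (range x)"
      unfolding closure_approachable cluster_points_def
      by (auto dest!: frequently_ex)
  qed
  then have "bounded ?W" using bounded_closure[OF bdd] bounded_subset by blast
  then have "compact (A \<inter> ?W)" "closed (B \<inter> ?W)"
    using AB closed_cluster_points[of x]
    by (auto simp: compact_eq_bounded_closed intro: bounded_subset)
  then obtain \<delta> where \<delta>: "\<delta> > 0" "\<And>v w. v \<in> A \<inter> ?W \<Longrightarrow> w \<in> B \<inter> ?W \<Longrightarrow> \<delta> \<le> dist v w"
    using separate_compact_closed[of "A \<inter> ?W" "B \<inter> ?W"] AB(4) by blast
  define near where "near S n \<longleftrightarrow> (\<exists>w\<in>S \<inter> ?W. dist (x n) w < \<delta> / 3)" for S n
  have "\<forall>\<^sub>F n in sequentially. infdist (x n) ?W < \<delta> / 3 \<and> dist (x (Suc n)) (x n) < \<delta> / 3"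
    using order_tendstoD(2)[OF infdist_cluster_points_tendsto_0(1)[OF bdd], of "\<delta> / 3"]
      order_tendstoD(2)[OF step, of "\<delta> / 3"] \<delta>(1) by (auto intro: eventually_conj)
  then obtain N where N: "\<And>n. n \<ge> N \<Longrightarrow> infdist (x n) ?W < \<delta> / 3"
    "\<And>n. n \<ge> N \<Longrightarrow> dist (x (Suc n)) (x n) < \<delta> / 3"
    unfolding eventually_sequentially by blast
  have some: "near A n \<or> near B n" if n: "n \<ge> N" for n
  proof -
    have "infdist (x n) ?W = (INF w\<in>?W. dist (x n) w)"
      using infdist_cluster_points_tendsto_0(2)[OF bdd] by (simp add: infdist_def)
    then obtain w where "w \<in> ?W" "dist (x n) w < \<delta> / 3"
      using N(1)[OF n] infdist_cluster_points_tendsto_0(2)[OF bdd]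
      by (metis bdd_below_image_dist cINF_less_iff)
    then show ?thesis using AB(3) unfolding near_def by blast
  qed
  have not_both: "dist (x n) v \<ge> \<delta> * 2 / 3 \<or> dist (x n) w \<ge> \<delta> / 3"
    if "v \<in> A \<inter> ?W" "w \<in> B \<inter> ?W" for n v w
    using \<delta>(2)[OF that] by metric
  have not_both': "dist (x n) w \<ge> \<delta> * 2 / 3 \<or> dist (x n) v \<ge> \<delta> / 3"
    if "v \<in> A \<inter> ?W" "w \<in> B \<inter> ?W" for n v w
    using \<delta>(2)[OF that] by metric
  have keepA: "near A (Suc n)" if "n \<ge> N" and nr: "near A n" for n
  proof (rule ccontr)
    assume "\<not> ?thesis"
    then have "near B (Suc n)" using some[of "Suc n"] that by auto
    then obtain v w where vw: "v \<in> A \<inter> ?W" "w \<in> B \<inter> ?W" "dist (x n) v < \<delta> / 3" "dist (x (Suc n)) w < \<delta> / 3"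
      using nr unfolding near_def by blast
    then show False using not_both[OF vw(1,2), of "Suc n"] N(2)[OF that(1)] by metric
  qed
  have keepB: "near B (Suc n)" if "n \<ge> N" and nr: "near B n" for n
  proof (rule ccontr)
    assume "\<not> ?thesis"
    then have "near A (Suc n)" using some[of "Suc n"] that by auto
    then obtain v w where vw: "v \<in> A \<inter> ?W" "w \<in> B \<inter> ?W" "dist (x n) w < \<delta> / 3" "dist (x (Suc n)) v < \<delta> / 3"
      using nr unfolding near_def by blast
    then show False using not_both'[OF vw(1,2), of "Suc n"] N(2)[OF that(1)] by metric
  qed
  have visit: "\<exists>n\<ge>N. near S n" if ne: "S \<inter> ?W \<noteq> {}" for S
  proof -
    obtain w where w: "w \<in> S \<inter> ?W" using ne by blast
    moreover have "\<delta> / 3 > 0" using \<delta>(1) by simp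
    ultimately have "\<exists>n\<ge>N. dist (x n) w < \<delta> / 3"
      unfolding cluster_points_def frequently_sequentially by blast
    then show ?thesis using w unfolding near_def by blast
  qed
  obtain nA where nA: "nA \<ge> N" "near A nA" using visit AB(5) by blast
  obtain nB where nB: "nB \<ge> N" "near B nB" using visit AB(6) by blast
  have "near A (nA + k)" for k using nA keepA by (induction k) auto
  then have "near A (max nA nB)" by (metis le_add_diff_inverse max.cobounded1)
  moreover have "near B (nB + k)" for k using nB keepB by (induction k) auto
  then have "near B (max nA nB)" by (metis le_add_diff_inverse max.cobounded2)
  ultimately obtain v w where "v \<in> A \<inter> ?W" "w \<in> B \<inter> ?W"
    "dist (x (max nA nB)) v < \<delta> / 3" "dist (x (max nA nB)) w < \<delta> / 3"
    unfolding near_def by blast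
  then show False using not_both[of v w "max nA nB"] \<delta>(1) by auto
qed

section \<open>Normals of a box and strongly convex quadratics\<close>

text \<open>\<open>box_normal l u x n\<close> says that \<open>n\<close> is in the normal cone of the box at \<open>x\<close>; in the KKT
  system \<open>n = \<nu> - \<mu>\<close>.\<close>

definition box_normal :: "real^'n \<Rightarrow> real^'n \<Rightarrow> real^'n \<Rightarrow> real^'n \<Rightarrow> bool" where
  "box_normal l u x n \<longleftrightarrow> (\<forall>i. (0 < n $ i \<longrightarrow> x $ i = u $ i) \<and> (n $ i < 0 \<longrightarrow> x $ i = l $ i))"

lemma box_normal_inner_le_0:
  assumes "box_normal l u x n" "x' \<in> cbox l u"
  shows "n \<bullet> (x' - x) \<le> 0"
  unfolding inner_vec_def
proof (rule sum_nonpos)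
  fix i
  have "l $ i \<le> x' $ i" "x' $ i \<le> u $ i" using assms(2) by (auto simp: mem_box_cart)
  moreover have "0 < n $ i \<longrightarrow> x $ i = u $ i" "n $ i < 0 \<longrightarrow> x $ i = l $ i"
    using assms(1) by (auto simp: box_normal_def)
  ultimately show "n $ i \<bullet> (x' - x) $ i \<le> 0"
    by (cases "n $ i" "0::real" rule: linorder_cases) (auto simp: mult_le_0_iff)
qed

lemma box_normalI:
  assumes x: "x \<in> cbox l u" and vi: "\<And>x'. x' \<in> cbox l u \<Longrightarrow> n \<bullet> (x' - x) \<le> 0"
  shows "box_normal l u x n"
  unfolding box_normal_def
proof
  fix i
  have lu: "l $ j \<le> x $ j" "x $ j \<le> u $ j" for j using x by (auto simp: mem_box_cart)
  have key: "n $ i * (t - x $ i) \<le> 0" if "l $ i \<le> t" "t \<le> u $ i" for t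
  proof -
    define x' where "x' = x + axis i (t - x $ i)"
    have "x' \<in> cbox l u" using lu that by (auto simp: x'_def mem_box_cart axis_def)
    from vi[OF this] show ?thesis by (simp add: x'_def inner_axis)
  qed
  show "(0 < n $ i \<longrightarrow> x $ i = u $ i) \<and> (n $ i < 0 \<longrightarrow> x $ i = l $ i)"
    using key[of "u $ i"] key[of "l $ i"] lu[of i] by (auto simp: mult_le_0_iff)
qed

text \<open>Monotonicity of the normal cone holds in every coordinate separately because the box is
  a product. \<open>dual_error_bound\<close> depends on this form, as it reads off one linear
  inequality per coordinate.\<close>

lemma box_normal_mono:
  assumes "box_normal l u x n" "box_normal l u x' n'" "x \<in> cbox l u" "x' \<in> cbox l u"
  shows "0 \<le> (n $ i - n' $ i) * (x $ i - x' $ i)"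
proof -
  have le: "x' $ i \<le> x $ i"
    if "box_normal l u x n" "box_normal l u x' n'" "x \<in> cbox l u" "x' \<in> cbox l u" "n' $ i < n $ i"
    for x x' n n'
  proof (cases "0 < n $ i")
    case True
    then have "x $ i = u $ i" using that(1) by (simp add: box_normal_def)
    then show ?thesis using that(4) by (simp add: mem_box_cart)
  next
    case False
    then have "n' $ i < 0" using that(5) by simp
    then have "x' $ i = l $ i" using that(2) by (simp add: box_normal_def)
    then show ?thesis using that(3) by (simp add: mem_box_cart)
  qed
  show ?thesis
    using le[OF assms] le[OF assms(2,1,4,3)] unfolding zero_le_mult_iff by linarith
qed

text \<open>A nonzero sign of \<open>v $ i\<close> is eventually shared by \<open>n k $ i\<close>,
  which pins \<open>x k $ i\<close> to the corresponding bound.\<close>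

lemma box_normal_limit:
  assumes "\<And>k. box_normal l u (x k) (n k)" "x \<longlonglongrightarrow> a" "n \<longlonglongrightarrow> v"
  shows "box_normal l u a v"
  unfolding box_normal_def
proof (intro allI conjI impI)
  fix i
  have x: "(\<lambda>k. x k $ i) \<longlonglongrightarrow> a $ i" and n: "(\<lambda>k. n k $ i) \<longlonglongrightarrow> v $ i"
    using assms(2,3) by (auto intro: tendsto_vec_nth)
  show "a $ i = u $ i" if "0 < v $ i"
  proof -
    have "\<forall>\<^sub>F k in sequentially. x k $ i = u $ i"
      using order_tendstoD(1)[OF n that] assms(1) by (auto simp: box_normal_def elim: eventually_mono)
    then show ?thesis using LIMSEQ_unique[OF x tendsto_eventually] by blast
  qed
  show "a $ i = l $ i" if "v $ i < 0"
  proof -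
    have "\<forall>\<^sub>F k in sequentially. x k $ i = l $ i"
      using order_tendstoD(2)[OF n that] assms(1) by (auto simp: box_normal_def elim: eventually_mono)
    then show ?thesis using LIMSEQ_unique[OF x tendsto_eventually] by blast
  qed
qed

text \<open>Relative interiors of convex sets commute with linear images, and since
  \<open>l $ i < u $ i\<close> the relative interior of the box is its interior. The constraint
  qualification thus becomes a Slater point with a ball around it.\<close>

lemma interior_feasible_point:
  fixes A :: "real^'n^'m"
  assumes lu: "\<And>i. l $ i < u $ i" and "0 \<in> rel_interior ((\<lambda>x. A *v x - b) ` cbox l u)"
  shows "\<exists>x0 \<delta>. \<delta> > 0 \<and> cball x0 \<delta> \<subseteq> cbox l u \<and> A *v x0 = b"
proof -
  have ne: "interior (cbox l u) \<noteq> {}"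
    using lu by (simp add: interior_cbox interval_ne_empty_cart)
  have "rel_interior ((\<lambda>x. A *v x - b) ` cbox l u) = rel_interior ((+) (- b) ` ((*v) A) ` cbox l u)"
    by (simp add: image_image)
  also have "\<dots> = (+) (- b) ` ((*v) A) ` interior (cbox l u)"
    using rel_interior_convex_linear_image[OF matrix_vector_mul_linear[of A] convex_box(1)[of l u]]
      rel_interior_nonempty_interior[OF ne] by (simp only: rel_interior_translation)
  finally obtain x0 where x0: "x0 \<in> interior (cbox l u)" "A *v x0 = b"
    using assms(2) by auto
  then show ?thesis unfolding mem_interior_cball by blast
qed

section \<open>Multipliers seen through the row space of \<open>A\<close>\<close>

lemma vector_matrix_mult_minus: "(- y) v* A = - (y v* A)" for y :: "real^'m"
  by (simp add: vector_matrix_mult_def vec_eq_iff sum_negf)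

text \<open>Stationarity is recorded as membership in this range, so it passes to limits without
  convergence of the multipliers \<open>y\<close>.\<close>

lemma range_vector_matrix_mult_closed:
  fixes A :: "real^'n^'m"
  shows "closed (range (\<lambda>y. y v* A))"
  using closed_subspace[OF linear_subspace_image[OF matrix_vector_mul_linear[of "transpose A"] subspace_UNIV]]
  by simp

text \<open>A multiplier can have an arbitrarily large part in the kernel of the transpose; a linear
  right inverse selects a representative controlled by its image.\<close>

lemma vector_matrix_mult_bounded_preimage:
  fixes A :: "real^'n^'m"
  shows "\<exists>C\<ge>0. \<forall>y. \<exists>y'. y' v* A = y v* A \<and> norm y' \<le> C * norm (y v* A)"
proof -
  have "linear (\<lambda>y. y v* A)" using matrix_vector_mul_linear[of "transpose A"] by simp
  then obtain h where h: "linear h" "\<And>y. h (y v* A) v* A = y v* A"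
    using linear_exists_right_inverse_on[OF _ subspace_UNIV, of "\<lambda>y. y v* A"] by blast
  have "norm (h v) \<le> onorm h * norm v" for v
    using h(1) by (simp add: linear_conv_bounded_linear onorm)
  moreover have "onorm h \<ge> 0" using h(1) by (simp add: linear_conv_bounded_linear onorm_pos_le)
  ultimately show ?thesis using h(2) by blast
qed

text \<open>Testing a normal vector against the Slater point \<open>x0\<close> bounds it by the gradient.\<close>

lemma slater_normal_bound:
  fixes A :: "real^'n^'m"
  assumes "\<delta> > 0" and ball: "cball x0 \<delta> \<subseteq> cbox l u" and x0: "A *v x0 = b"
  shows "\<exists>\<epsilon>>0. \<exists>C\<ge>0. \<forall>x n g. x \<in> cbox l u \<longrightarrow> box_normal l u x n \<longrightarrow> g + n \<in> range (\<lambda>y. y v* A) \<longrightarrow>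
           norm (A *v x - b) \<le> \<epsilon> \<longrightarrow> norm n \<le> C * norm g"
proof -
  obtain C where C: "C \<ge> 0" "\<And>y. \<exists>y'. y' v* A = y v* A \<and> norm y' \<le> C * norm (y v* A)"
    using vector_matrix_mult_bounded_preimage[of A] by blast
  define D where "D = diameter (cbox l u)"
  \<comment> \<open>Chosen so that \<open>C * \<epsilon> \<le> \<delta> / 2\<close>: the
    infeasibility of \<open>x\<close> then uses up at most half of the gain
    \<open>\<delta> * norm n\<close> at the Slater point.\<close>
  define \<epsilon> where "\<epsilon> = \<delta> / (2 * (C + 1))"
  have \<epsilon>: "\<epsilon> > 0" "C * \<epsilon> \<le> \<delta> / 2"
    using \<open>\<delta> > 0\<close> C(1) by (auto simp: \<epsilon>_def field_simps)
  have x0in: "x0 \<in> cbox l u" using ball \<open>\<delta> > 0\<close> by (auto simp: subset_iff)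
  have "norm n \<le> (1 + 2 * D / \<delta>) * norm g"
    if x: "x \<in> cbox l u" and n: "box_normal l u x n" and g: "g + n \<in> range (\<lambda>y. y v* A)"
      and r: "norm (A *v x - b) \<le> \<epsilon>" for x n g
  proof -
    obtain y where y: "y v* A = g + n" "norm y \<le> C * norm (g + n)"
    proof -
      obtain y0 where "g + n = y0 v* A" using g by blast
      then show thesis using C(2)[of y0] that by metis
    qed
    have "norm (x - x0) \<le> D"
      using diameter_bounded_bound[OF bounded_cbox x x0in] by (simp add: D_def dist_norm)
    \<comment> \<open>The point of the ball that is extreme in direction \<open>n\<close>. For
      \<open>n = 0\<close> it equals \<open>x0\<close>, and the identity below remains true.\<close>
    define x' where "x' = x0 + (\<delta> / norm n) *\<^sub>R n"
    have "x' \<in> cbox l u" using ball \<open>\<delta> > 0\<close> by (auto simp: x'_def subset_iff dist_norm)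
    then have "n \<bullet> (x' - x) \<le> 0" using n by (rule box_normal_inner_le_0[rotated])
    moreover have "n \<bullet> (x' - x) = \<delta> * norm n - n \<bullet> (x - x0)"
      by (simp add: x'_def inner_diff_right inner_add_right dot_square_norm power2_eq_square)
    ultimately have "\<delta> * norm n \<le> n \<bullet> (x - x0)" by simp
    moreover have "n \<bullet> (x - x0) = (y v* A) \<bullet> (x - x0) - g \<bullet> (x - x0)" by (simp add: y inner_add_left)
    moreover have "(y v* A) \<bullet> (x - x0) = y \<bullet> (A *v x - b)"
      by (simp add: dot_lmul_matrix matrix_vector_mult_diff_distrib x0)
    moreover have "y \<bullet> (A *v x - b) \<le> (norm g + norm n) * (\<delta> / 2)"
    proof -
      have "norm y \<le> C * (norm g + norm n)"
        using y(2) mult_left_mono[OF norm_triangle_ineq[of g n] C(1)] by simp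
      then have "y \<bullet> (A *v x - b) \<le> (C * (norm g + norm n)) * \<epsilon>"
        using r C(1) by (intro order_trans[OF norm_cauchy_schwarz] mult_mono) auto
      also have "\<dots> \<le> (norm g + norm n) * (\<delta> / 2)"
        using mult_right_mono[OF \<epsilon>(2), of "norm g + norm n"] by (simp add: algebra_simps)
      finally show ?thesis .
    qed
    moreover have "- (g \<bullet> (x - x0)) \<le> norm g * D"
      using norm_cauchy_schwarz[of "- g" "x - x0"] mult_left_mono[OF \<open>norm (x - x0) \<le> D\<close>, of "norm g"] by simp
    ultimately have "\<delta> * norm n \<le> (norm g + norm n) * (\<delta> / 2) + norm g * D" by linarith
    then have "\<delta> * norm n \<le> norm g * \<delta> + 2 * norm g * D" by (simp add: field_simps)
    then show ?thesis using \<open>\<delta> > 0\<close> by (simp add: field_simps)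
  qed
  moreover have "D \<ge> 0" unfolding D_def by (simp add: diameter_ge_0)
  ultimately show ?thesis
    using \<epsilon>(1) \<open>\<delta> > 0\<close> by (intro exI[of _ \<epsilon>] conjI exI[of _ "1 + 2 * D / \<delta>"]) auto
qed

lemma convergent_subsequence_of_normals:
  fixes A :: "real^'n^'m" and x n g :: "nat \<Rightarrow> real^'n"
  assumes "\<delta> > 0" "cball x0 \<delta> \<subseteq> cbox l u" "A *v x0 = b"
    and x: "\<And>k. x k \<in> cbox l u" and n: "\<And>k. box_normal l u (x k) (n k)"
    and g: "\<And>k. g k + n k \<in> range (\<lambda>y. y v* A)" "bounded (range g)"
    and r: "(\<lambda>k. A *v x k - b) \<longlonglongrightarrow> 0"
  obtains s :: "nat \<Rightarrow> nat" and xb nb where "strict_mono s" "(x \<circ> s) \<longlonglongrightarrow> xb" "(n \<circ> s) \<longlonglongrightarrow> nb"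
    "xb \<in> cbox l u" "A *v xb = b" "box_normal l u xb nb"
proof -
  obtain \<epsilon> C where \<epsilon>: "\<epsilon> > 0" and C: "C \<ge> 0"
    "\<And>x n g. x \<in> cbox l u \<Longrightarrow> box_normal l u x n \<Longrightarrow> g + n \<in> range (\<lambda>y. y v* A) \<Longrightarrow>
           norm (A *v x - b) \<le> \<epsilon> \<Longrightarrow> norm n \<le> C * norm g"
    using slater_normal_bound[OF assms(1-3)] by blast
  obtain G where G: "\<And>k. norm (g k) \<le> G" using g(2) by (auto simp: bounded_iff)
  have "\<forall>\<^sub>F k in sequentially. norm (A *v x k - b) < \<epsilon>"
    using order_tendstoD(2)[OF tendsto_norm_zero[OF r] \<epsilon>] .
  then have "\<forall>\<^sub>F k in sequentially. norm (n k) \<le> C * G"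
  proof eventually_elim
    case (elim k)
    then have "norm (n k) \<le> C * norm (g k)" using C(2)[OF x n g(1)] by simp
    also have "\<dots> \<le> C * G" using G C(1) by (intro mult_left_mono)
    finally show ?case .
  qed
  then have "bounded (range n)" using BfunI Bseq_eq_bounded by blast
  moreover have "bounded (range x)" using x by (intro bounded_subset[OF bounded_cbox[of l u]]) auto
  ultimately have "bounded (range (\<lambda>k. (x k, n k)))"
    by (intro bounded_subset[OF bounded_Times[of "range x" "range n"]]) auto
  then obtain p s where s: "strict_mono (s :: nat \<Rightarrow> nat)" "((\<lambda>k. (x k, n k)) \<circ> s) \<longlonglongrightarrow> p"
    using bounded_imp_convergent_subsequence by blast
  have xs: "(x \<circ> s) \<longlonglongrightarrow> fst p" using tendsto_fst[OF s(2)] by (simp add: o_def)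
  have ns: "(n \<circ> s) \<longlonglongrightarrow> snd p" using tendsto_snd[OF s(2)] by (simp add: o_def)
  have "fst p \<in> cbox l u"
    using closed_sequentially[OF closed_cbox _ xs] x by simp
  moreover have "A *v fst p - b = 0"
  proof (rule LIMSEQ_unique)
    show "(\<lambda>k. A *v (x \<circ> s) k - b) \<longlonglongrightarrow> A *v fst p - b"
      by (intro tendsto_diff tendsto_const bounded_linear.tendsto[OF matrix_vector_mul_bounded_linear] xs)
    show "(\<lambda>k. A *v (x \<circ> s) k - b) \<longlonglongrightarrow> 0"
      using LIMSEQ_subseq_LIMSEQ[OF r s(1)] by (simp add: o_def)
  qed
  moreover have "box_normal l u (fst p) (snd p)"
    using box_normal_limit[OF _ xs ns] n by simp
  ultimately show thesis using that s(1) xs ns by simp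
qed

text \<open>The gradient is split into a linear part \<open>T\<close> and a convergent perturbation
  \<open>e\<close>. With \<open>T = hessK 0\<close> this covers the penalty problems behind
  \<open>xF_multiplier\<close>; with \<open>T = Q\<close> and the proximal term moved into
  \<open>e\<close> it gives KKT points of the original problem.\<close>

lemma perturbed_kkt_limit:
  fixes A :: "real^'n^'m" and x n e :: "nat \<Rightarrow> real^'n"
  assumes slater: "\<delta> > 0" "cball x0 \<delta> \<subseteq> cbox l u" "A *v x0 = b"
    and T: "bounded_linear T"
    and x: "\<And>k. x k \<in> cbox l u" and n: "\<And>k. box_normal l u (x k) (n k)"
    and st: "\<And>k. T (x k) + e k + n k \<in> range (\<lambda>y. y v* A)" and e: "e \<longlonglongrightarrow> e'"
    and r: "(\<lambda>k. A *v x k - b) \<longlonglongrightarrow> 0"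
  obtains s :: "nat \<Rightarrow> nat" and xb nb where "strict_mono s" "(x \<circ> s) \<longlonglongrightarrow> xb" "(n \<circ> s) \<longlonglongrightarrow> nb"
    "xb \<in> cbox l u" "A *v xb = b" "box_normal l u xb nb" "T xb + e' + nb \<in> range (\<lambda>y. y v* A)"
proof -
  have "bounded (range (\<lambda>k. T (x k)))"
    using x by (intro bounded_subset[OF bounded_linear_image[OF bounded_cbox T, of l u]]) auto
  moreover have "bounded (range e)" using e convergent_imp_bounded by blast
  ultimately have "bounded (range (\<lambda>k. T (x k) + e k))" by (rule bounded_plus_comp)
  then obtain s xb nb where s: "strict_mono s" "(x \<circ> s) \<longlonglongrightarrow> xb" "(n \<circ> s) \<longlonglongrightarrow> nb"
    "xb \<in> cbox l u" "A *v xb = b" "box_normal l u xb nb"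
    using convergent_subsequence_of_normals[OF slater x n st _ r] by blast
  have "(\<lambda>k. T ((x \<circ> s) k) + (e \<circ> s) k + (n \<circ> s) k) \<longlonglongrightarrow> T xb + e' + nb"
    by (intro tendsto_add bounded_linear.tendsto[OF T] s LIMSEQ_subseq_LIMSEQ[OF e])
  then have "T xb + e' + nb \<in> range (\<lambda>y. y v* A)"
    by (rule closed_sequentially[OF range_vector_matrix_mult_closed, rotated]) (simp add: st)
  then show thesis using that s by blast
qed

text \<open>\<open>g\<close> is the gradient and \<open>H\<close> the Hessian, given by the exact
  second-order expansion instead of derivatives. The instances are the proximal objective
  \<open>Fz z\<close> and the augmented function \<open>K\<close> in its first argument.\<close>

locale strongly_convex_quadratic =
  fixes F :: "'a::euclidean_space \<Rightarrow> real" and g H :: "'a \<Rightarrow> 'a" and m :: real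
  assumes lin: "linear H"
    and expand: "F x' = F x + g x \<bullet> (x' - x) + 1 / 2 * (H (x' - x) \<bullet> (x' - x))"
    and g_diff: "g x' = g x + H (x' - x)"
    and strong: "m * (norm v)\<^sup>2 \<le> H v \<bullet> v"
    and m_pos: "m > 0"
begin

lemma H_nonneg: "0 \<le> H v \<bullet> v"
  using strong[of v] m_pos by (smt (verit) mult_nonneg_nonneg zero_le_power2)

lemma minimizer_vi:
  assumes "convex S" "x \<in> S" "\<And>x'. x' \<in> S \<Longrightarrow> F x \<le> F x'" "x' \<in> S"
  shows "0 \<le> g x \<bullet> (x' - x)"
proof (rule ccontr)
  define a q where "a = g x \<bullet> (x' - x)" and "q = H (x' - x) \<bullet> (x' - x)"
  assume "\<not> ?thesis"
  then have a: "a < 0" by (simp add: a_def)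
  have q: "q \<ge> 0" unfolding q_def by (rule H_nonneg)
  \<comment> \<open>Along the segment \<open>F\<close> changes by
    \<open>s * (a + s * q / 2)\<close>. This \<open>s\<close> gives \<open>s * q < - a\<close>, so
    the value would drop; \<open>q + 1\<close> avoids division by zero.\<close>
  define s where "s = min 1 (- a / (q + 1))"
  have s: "0 < s" "s \<le> 1" "s \<le> - a / (q + 1)" using a q divide_neg_pos[of a "q + 1"] by (auto simp: s_def)
  have "(1 - s) *\<^sub>R x + s *\<^sub>R x' \<in> S" using assms s by (intro convexD) auto
  then have "F x \<le> F (x + s *\<^sub>R (x' - x))" using assms(3) by (simp add: algebra_simps)
  also have "\<dots> = F x + s * a + 1 / 2 * (s * s * q)"
    by (subst expand[of _ x]) (simp add: linear_scale[OF lin] a_def q_def)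
  finally have "0 \<le> s * (a + s * q / 2)" by (simp add: algebra_simps)
  then have "0 \<le> a + s * q / 2" using s(1) by (simp add: zero_le_mult_iff)
  moreover have "s * q + s \<le> - a" using s(3) q pos_le_divide_eq[of "q + 1" s "- a"] by (simp add: algebra_simps)
  moreover have "0 \<le> s * q" using s q by simp
  ultimately show False using a s(1) by simp
qed

text \<open>\<open>e\<close> measures by how much \<open>x\<close> fails to be stationary. Adding
  the two variational inequalities and using strong monotonicity gives the distance; convexity then
  gives the gap in value, quadratic in \<open>e\<close>. The case \<open>e = 0\<close> is
  uniqueness.\<close>

lemma residual_bound:
  assumes "x \<in> S" "w \<in> S"
    and vi: "\<And>x'. x' \<in> S \<Longrightarrow> 0 \<le> (g x - e) \<bullet> (x' - x)" and vw: "\<And>x'. x' \<in> S \<Longrightarrow> 0 \<le> g w \<bullet> (x' - w)"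
  shows "m * norm (x - w) \<le> norm e" and "F x - F w \<le> (norm e)\<^sup>2 / m"
proof -
  have "0 \<le> g w \<bullet> (x - w)" using vw assms by blast
  moreover have 1: "0 \<le> (g x - e) \<bullet> (w - x)" using vi assms by blast
  moreover have "g x = g w + H (x - w)" by (rule g_diff)
  ultimately have "H (x - w) \<bullet> (x - w) \<le> e \<bullet> (x - w)"
    by (simp add: inner_diff_left inner_diff_right inner_add_left)
  then have "m * norm (x - w) * norm (x - w) \<le> norm e * norm (x - w)"
    using strong[of "x - w"] norm_cauchy_schwarz[of e "x - w"] by (simp add: power2_eq_square)
  then show 2: "m * norm (x - w) \<le> norm e"
    by (cases "x = w") (auto dest: mult_right_le_imp_le)
  have "F w \<ge> F x + g x \<bullet> (w - x)" using expand[of w x] H_nonneg[of "w - x"] by simp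
  then have "F x - F w \<le> e \<bullet> (x - w)" using 1 by (simp add: inner_diff_left inner_diff_right)
  also have "\<dots> \<le> norm e * norm (x - w)" by (rule norm_cauchy_schwarz)
  also have "\<dots> \<le> norm e * (norm e / m)" using 2 m_pos by (intro mult_left_mono) (auto simp: field_simps)
  finally show "F x - F w \<le> (norm e)\<^sup>2 / m" by (simp add: power2_eq_square)
qed

lemma continuous: "continuous_on UNIV F"
proof -
  have F: "F = (\<lambda>x'. F 0 + g 0 \<bullet> (x' - 0) + 1 / 2 * (H (x' - 0) \<bullet> (x' - 0)))"
    using expand[of _ 0] by blast
  have "continuous_on UNIV (\<lambda>x'. F 0 + g 0 \<bullet> (x' - 0) + 1 / 2 * (H (x' - 0) \<bullet> (x' - 0)))"
    using linear_continuous_on[of H UNIV] lin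
    by (auto intro!: continuous_intros simp: linear_conv_bounded_linear)
  then show ?thesis by (subst F)
qed

lemma minimizer_exists:
  assumes "compact S" "S \<noteq> {}"
  obtains w where "w \<in> S" "\<And>x. x \<in> S \<Longrightarrow> F w \<le> F x"
  using continuous_attains_inf[OF assms continuous_on_subset[OF continuous subset_UNIV]] by blast

end

section \<open>The proximal problems and the dual error bound\<close>

lemma symmetric_matrix_inner:
  fixes Q :: "real^'n^'n"
  assumes "transpose Q = Q"
  shows "(Q *v v) \<bullet> w = v \<bullet> (Q *v w)"
  using dot_lmul_matrix[of v Q w] transpose_matrix_vector[of Q v] by (simp add: assms)

lemma grad_quadratic:
  fixes Q :: "real^'n^'n"
  assumes "transpose Q = Q"
  shows "grad (\<lambda>x. 1 / 2 * (x \<bullet> (Q *v x)) + r \<bullet> x) x = Q *v x + r"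
proof (rule grad_eqI)
  have "((*v) Q has_derivative (*v) Q) (at x)"
    by (rule bounded_linear_imp_has_derivative[OF matrix_vector_mul_bounded_linear])
  moreover have "x \<bullet> (Q *v v) = v \<bullet> (Q *v x)" "r \<bullet> v = v \<bullet> r" for v
    by (metis symmetric_matrix_inner[OF assms] inner_commute) (rule inner_commute)
  ultimately show "GDERIV (\<lambda>x. 1 / 2 * (x \<bullet> (Q *v x)) + r \<bullet> x) x :> Q *v x + r"
    unfolding gderiv_def
    by - ((rule derivative_eq_intros refl | assumption)+, simp add: fun_eq_iff inner_add_right)
qed

text \<open>The Lipschitz and curvature bounds are demanded of \<open>Q\<close> for all vectors.
  They follow from the bounds on the box, which contains a ball around \<open>x0\<close>.\<close>

locale box_qp =
  fixes Q :: "real^'n^'n" and r l u x0 :: "real^'n" and A :: "real^'n^'m" and b :: "real^'m"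
    and L \<gamma> p \<delta> :: real
  assumes Q_sym: "transpose Q = Q"
    and \<delta>_pos: "\<delta> > 0" and ball: "cball x0 \<delta> \<subseteq> cbox l u" and x0: "A *v x0 = b"
    and L_pos: "L > 0" and Q_norm: "norm (Q *v v) \<le> L * norm v"
    and Q_strong: "\<gamma> * (norm v)\<^sup>2 \<le> (Q *v v) \<bullet> v"
    and p_pos: "p > 0" and m_pos: "\<gamma> + p > 0"
begin

definition f :: "real^'n \<Rightarrow> real" where
  "f x = 1 / 2 * (x \<bullet> (Q *v x)) + r \<bullet> x"

abbreviation K :: "real \<Rightarrow> real^'n \<Rightarrow> real^'n \<Rightarrow> real^'m \<Rightarrow> real" where
  "K \<Gamma> x z y \<equiv> aug_lagr f A b \<Gamma> p x z y"

definition gradK :: "real \<Rightarrow> real^'n \<Rightarrow> real^'n \<Rightarrow> real^'m \<Rightarrow> real^'n" where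
  "gradK \<Gamma> x z y = Q *v x + r + y v* A + \<Gamma> *\<^sub>R ((A *v x - b) v* A) + p *\<^sub>R (x - z)"

text \<open>The Hessian of \<open>K\<close> in \<open>x\<close>; \<open>hessK 0\<close> is at the
  same time the Hessian of \<open>Fz\<close>.\<close>

definition hessK :: "real \<Rightarrow> real^'n \<Rightarrow> real^'n" where
  "hessK \<Gamma> v = Q *v v + \<Gamma> *\<^sub>R ((A *v v) v* A) + p *\<^sub>R v"

definition Fz :: "real^'n \<Rightarrow> real^'n \<Rightarrow> real" where
  "Fz z x = f x + p / 2 * (norm (x - z))\<^sup>2"

definition gradF :: "real^'n \<Rightarrow> real^'n \<Rightarrow> real^'n" where
  "gradF z x = Q *v x + r + p *\<^sub>R (x - z)"

definition feasible :: "(real^'n) set" where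
  "feasible = {x \<in> cbox l u. A *v x = b}"

lemma Q_inner: "(Q *v v) \<bullet> w = v \<bullet> (Q *v w)"
  by (rule symmetric_matrix_inner[OF Q_sym])

lemma f_expand: "f x' = f x + (Q *v x + r) \<bullet> (x' - x) + 1 / 2 * ((Q *v (x' - x)) \<bullet> (x' - x))"
proof -
  have "f (x + v) = f x + (Q *v x + r) \<bullet> v + 1 / 2 * ((Q *v v) \<bullet> v)" for v
    by (simp add: f_def matrix_vector_right_distrib inner_add_left inner_add_right Q_inner
        inner_commute[of v "Q *v x"] inner_commute[of "Q *v v" v] field_simps)
  from this[of "x' - x"] show ?thesis by simp
qed

text \<open>The trapezoid rule is exact for quadratics. It compares values through the gradients at
  both ends, whatever the signature of \<open>Q\<close>.\<close>

lemma f_trapezoid: "f x' - f x = 1 / 2 * (((Q *v x + r) + (Q *v x' + r)) \<bullet> (x' - x))"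
proof -
  have "(Q *v (x' - x)) \<bullet> (x' - x) = (Q *v x') \<bullet> (x' - x) - (Q *v x) \<bullet> (x' - x)"
    by (simp only: matrix_vector_mult_diff_distrib inner_diff_left)
  then show ?thesis using f_expand[of x' x] by (simp only: inner_add_left) (simp add: field_simps)
qed

lemma norm_sq_expand:
  fixes v w :: "'a::real_inner"
  shows "(norm w)\<^sup>2 = (norm v)\<^sup>2 + 2 * (v \<bullet> (w - v)) + (norm (w - v))\<^sup>2"
  by (simp add: power2_norm_eq_inner inner_diff_left inner_diff_right inner_commute)

lemma Fz_quadratic: "strongly_convex_quadratic (Fz z) (gradF z) (hessK 0) (\<gamma> + p)"
proof (rule strongly_convex_quadratic.intro)
  show "linear (hessK 0)"
    unfolding hessK_def by (intro linearI) (simp_all add: algebra_simps matrix_vector_mult_scaleR)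
  show "Fz z x' = Fz z x + gradF z x \<bullet> (x' - x) + 1 / 2 * (hessK 0 (x' - x) \<bullet> (x' - x))" for x x'
  proof -
    have "(norm (x' - z))\<^sup>2 = (norm (x - z))\<^sup>2 + 2 * ((x - z) \<bullet> (x' - x)) + (norm (x' - x))\<^sup>2"
      using norm_sq_expand[of "x' - z" "x - z"] by simp
    moreover have "hessK 0 (x' - x) \<bullet> (x' - x) = (Q *v (x' - x)) \<bullet> (x' - x) + p * (norm (x' - x))\<^sup>2"
      by (simp add: hessK_def inner_add_left dot_square_norm)
    moreover have "gradF z x \<bullet> (x' - x) = (Q *v x + r) \<bullet> (x' - x) + p * ((x - z) \<bullet> (x' - x))"
      by (simp only: gradF_def inner_add_left inner_scaleR_left)
    ultimately show ?thesis
      unfolding Fz_def f_expand[of x' x] by (simp only:) (simp add: field_simps)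
  qed
  show "gradF z x' = gradF z x + hessK 0 (x' - x)" for x x'
    unfolding gradF_def hessK_def by (simp add: algebra_simps)
  show "(\<gamma> + p) * (norm v)\<^sup>2 \<le> hessK 0 v \<bullet> v" for v
    using Q_strong[of v] by (simp add: hessK_def inner_add_left power2_norm_eq_inner algebra_simps)
qed (rule m_pos)

lemma K_eq_Fz: "K \<Gamma> x z y = Fz z x + y \<bullet> (A *v x - b) + \<Gamma> / 2 * (norm (A *v x - b))\<^sup>2"
  by (simp add: aug_lagr_def Fz_def)

lemma gradK_eq_gradF: "gradK \<Gamma> x z y = gradF z x + (y + \<Gamma> *\<^sub>R (A *v x - b)) v* A"
  by (simp add: gradK_def gradF_def vector_matrix_left_distrib scaleR_vector_matrix_assoc)

text \<open>\<Gamma> is arbitrary here because \<open>xF_multiplier\<close> lets the penalty weight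
  tend to infinity.\<close>

lemma K_quadratic:
  assumes "\<Gamma> \<ge> 0"
  shows "strongly_convex_quadratic (\<lambda>x. K \<Gamma> x z y) (\<lambda>x. gradK \<Gamma> x z y) (hessK \<Gamma>) (\<gamma> + p)"
proof (rule strongly_convex_quadratic.intro)
  interpret F: strongly_convex_quadratic "Fz z" "gradF z" "hessK 0" "\<gamma> + p" by (rule Fz_quadratic)
  have hess: "hessK \<Gamma> v = hessK 0 v + \<Gamma> *\<^sub>R ((A *v v) v* A)" for v by (simp add: hessK_def)
  show "linear (hessK \<Gamma>)"
    unfolding hessK_def by (intro linearI)
      (simp_all add: algebra_simps matrix_vector_mult_scaleR flip: scaleR_vector_matrix_assoc)
  show "K \<Gamma> x' z y = K \<Gamma> x z y + gradK \<Gamma> x z y \<bullet> (x' - x) + 1 / 2 * (hessK \<Gamma> (x' - x) \<bullet> (x' - x))" for x x'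
  proof -
    have A: "A *v x' - b = (A *v x - b) + A *v (x' - x)" by (simp add: matrix_vector_mult_diff_distrib)
    then have "(norm (A *v x' - b))\<^sup>2 = (norm (A *v x - b))\<^sup>2
        + 2 * ((A *v x - b) \<bullet> (A *v (x' - x))) + (norm (A *v (x' - x)))\<^sup>2"
      using norm_sq_expand[of "A *v x' - b" "A *v x - b"] by simp
    moreover have "y \<bullet> (A *v x' - b) = y \<bullet> (A *v x - b) + y \<bullet> (A *v (x' - x))"
      by (simp only: A inner_add_right)
    moreover have "hessK \<Gamma> (x' - x) \<bullet> (x' - x) = hessK 0 (x' - x) \<bullet> (x' - x) + \<Gamma> * (norm (A *v (x' - x)))\<^sup>2"
      by (simp only: hess inner_add_left inner_scaleR_left dot_lmul_matrix dot_square_norm)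
    moreover have "gradK \<Gamma> x z y \<bullet> (x' - x)
        = gradF z x \<bullet> (x' - x) + y \<bullet> (A *v (x' - x)) + \<Gamma> * ((A *v x - b) \<bullet> (A *v (x' - x)))"
      by (simp only: gradK_eq_gradF inner_add_left inner_scaleR_left dot_lmul_matrix add.assoc)
    ultimately show ?thesis
      unfolding K_eq_Fz F.expand[of x' x] by (simp only:) (simp add: field_simps)
  qed
  show "gradK \<Gamma> x' z y = gradK \<Gamma> x z y + hessK \<Gamma> (x' - x)" for x x'
    unfolding gradK_def hessK_def by (simp add: algebra_simps)
  show "(\<gamma> + p) * (norm v)\<^sup>2 \<le> hessK \<Gamma> v \<bullet> v" for v
    using F.strong[of v] assms by (simp add: hess inner_add_left dot_lmul_matrix add_increasing2)
qed (rule m_pos)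

lemma f_eq: "f = (\<lambda>x. 1 / 2 * (x \<bullet> (Q *v x)) + r \<bullet> x)"
  by (simp add: fun_eq_iff f_def)

lemma grad_f: "grad f x = Q *v x + r"
  unfolding f_eq by (rule grad_quadratic[OF Q_sym])

lemma grad_K: "grad (\<lambda>w. K \<Gamma> w z y) x = gradK \<Gamma> x z y"
proof (rule grad_eqI)
  have Q: "((*v) Q has_derivative (*v) Q) (at x)"
    by (rule bounded_linear_imp_has_derivative[OF matrix_vector_mul_bounded_linear])
  have A: "((*v) A has_derivative (*v) A) (at x)"
    by (rule bounded_linear_imp_has_derivative[OF matrix_vector_mul_bounded_linear])
  have c: "x \<bullet> (Q *v v) = v \<bullet> (Q *v x)" "r \<bullet> v = v \<bullet> r" "(x - z) \<bullet> v = v \<bullet> (x - z)"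
      "(A *v v) \<bullet> (A *v x - b) = (A *v x - b) \<bullet> (A *v v)" "v \<bullet> (w v* A) = w \<bullet> (A *v v)" for v w
    by (metis Q_inner inner_commute, (rule inner_commute)+, metis inner_commute dot_lmul_matrix)
  show "GDERIV (\<lambda>w. K \<Gamma> w z y) x :> gradK \<Gamma> x z y"
    unfolding gderiv_def aug_lagr_def f_def gradK_def power2_norm_eq_inner using Q A
    by - ((rule derivative_eq_intros refl | assumption)+, simp add: fun_eq_iff inner_add_right c)
qed

lemma compact_feasible: "compact feasible" and convex_feasible: "convex feasible"
  and feasible_nonempty: "feasible \<noteq> {}" and feasible_subset: "feasible \<subseteq> cbox l u"
proof -
  have eq: "feasible = cbox l u \<inter> (*v) A -` {b}" by (auto simp: feasible_def)
  have "closed ((*v) A -` {b})"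
    using continuous_closed_vimage[of "{b}" "(*v) A"] linear_continuous_at[OF matrix_vector_mul_bounded_linear] by auto
  then show "compact feasible" unfolding eq by (intro compact_Int_closed compact_cbox)
  show "convex feasible" unfolding eq
    by (intro convex_Int convex_box convex_linear_vimage convex_singleton matrix_vector_mul_linear)
  have "x0 \<in> cbox l u" using ball \<delta>_pos by (auto simp: subset_iff)
  then show "feasible \<noteq> {}" using x0 by (auto simp: feasible_def)
  show "feasible \<subseteq> cbox l u" by (auto simp: feasible_def)
qed

lemma cbox_nonempty: "cbox l u \<noteq> {}"
  using feasible_nonempty feasible_subset by blast

section \<open>Minimizers of the two proximal problems, their stability and their
  multipliers\<close>

definition xK :: "real \<Rightarrow> real^'m \<Rightarrow> real^'n \<Rightarrow> real^'n" where
  "xK \<Gamma> y z = (SOME w. w \<in> cbox l u \<and> (\<forall>x\<in>cbox l u. K \<Gamma> w z y \<le> K \<Gamma> x z y))"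

definition xF :: "real^'n \<Rightarrow> real^'n" where
  "xF z = (SOME w. w \<in> feasible \<and> (\<forall>x\<in>feasible. Fz z w \<le> Fz z x))"

lemma xK:
  assumes "\<Gamma> \<ge> 0"
  shows xK_in: "xK \<Gamma> y z \<in> cbox l u"
    and xK_min: "x \<in> cbox l u \<Longrightarrow> K \<Gamma> (xK \<Gamma> y z) z y \<le> K \<Gamma> x z y"
    and xK_vi: "x \<in> cbox l u \<Longrightarrow> 0 \<le> gradK \<Gamma> (xK \<Gamma> y z) z y \<bullet> (x - xK \<Gamma> y z)"
    and dual_val_eq: "dual_val f A b l u \<Gamma> p y z = K \<Gamma> (xK \<Gamma> y z) z y"
    and xK_normal: "box_normal l u (xK \<Gamma> y z) (- gradK \<Gamma> (xK \<Gamma> y z) z y)"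
proof -
  interpret S: strongly_convex_quadratic "\<lambda>x. K \<Gamma> x z y" "\<lambda>x. gradK \<Gamma> x z y" "hessK \<Gamma>" "\<gamma> + p"
    using K_quadratic[OF assms] .
  obtain w where "w \<in> cbox l u" "\<And>x. x \<in> cbox l u \<Longrightarrow> K \<Gamma> w z y \<le> K \<Gamma> x z y"
    by (rule S.minimizer_exists[OF compact_cbox cbox_nonempty]) blast
  then have "\<exists>w. w \<in> cbox l u \<and> (\<forall>x\<in>cbox l u. K \<Gamma> w z y \<le> K \<Gamma> x z y)" by blast
  from someI_ex[OF this] have "xK \<Gamma> y z \<in> cbox l u \<and> (\<forall>x\<in>cbox l u. K \<Gamma> (xK \<Gamma> y z) z y \<le> K \<Gamma> x z y)"
    unfolding xK_def[symmetric] .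
  then have *: "xK \<Gamma> y z \<in> cbox l u" "\<And>x. x \<in> cbox l u \<Longrightarrow> K \<Gamma> (xK \<Gamma> y z) z y \<le> K \<Gamma> x z y"
    by auto
  then show "xK \<Gamma> y z \<in> cbox l u" "x \<in> cbox l u \<Longrightarrow> K \<Gamma> (xK \<Gamma> y z) z y \<le> K \<Gamma> x z y" by auto
  have vi: "0 \<le> gradK \<Gamma> (xK \<Gamma> y z) z y \<bullet> (x - xK \<Gamma> y z)" if "x \<in> cbox l u" for x
    using S.minimizer_vi[OF convex_box(1) * that] .
  then show "x \<in> cbox l u \<Longrightarrow> 0 \<le> gradK \<Gamma> (xK \<Gamma> y z) z y \<bullet> (x - xK \<Gamma> y z)" .
  show "dual_val f A b l u \<Gamma> p y z = K \<Gamma> (xK \<Gamma> y z) z y"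
    unfolding dual_val_def using * by (intro cInf_eq_minimum) auto
  show "box_normal l u (xK \<Gamma> y z) (- gradK \<Gamma> (xK \<Gamma> y z) z y)"
    using vi by (intro box_normalI *) simp
qed

lemma xF:
  shows xF_in: "xF z \<in> feasible"
    and xF_min: "x \<in> feasible \<Longrightarrow> Fz z (xF z) \<le> Fz z x"
    and xF_vi: "x \<in> feasible \<Longrightarrow> 0 \<le> gradF z (xF z) \<bullet> (x - xF z)"
    and prox_val_eq: "prox_val f A b l u p z = Fz z (xF z)"
proof -
  interpret S: strongly_convex_quadratic "Fz z" "gradF z" "hessK 0" "\<gamma> + p" by (rule Fz_quadratic)
  obtain w where "w \<in> feasible" "\<And>x. x \<in> feasible \<Longrightarrow> Fz z w \<le> Fz z x"
    by (rule S.minimizer_exists[OF compact_feasible feasible_nonempty]) blast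
  then have "\<exists>w. w \<in> feasible \<and> (\<forall>x\<in>feasible. Fz z w \<le> Fz z x)" by blast
  from someI_ex[OF this] have "xF z \<in> feasible \<and> (\<forall>x\<in>feasible. Fz z (xF z) \<le> Fz z x)"
    unfolding xF_def[symmetric] .
  then have *: "xF z \<in> feasible" "\<And>x. x \<in> feasible \<Longrightarrow> Fz z (xF z) \<le> Fz z x"
    by auto
  then show "xF z \<in> feasible" "x \<in> feasible \<Longrightarrow> Fz z (xF z) \<le> Fz z x" by auto
  show "x \<in> feasible \<Longrightarrow> 0 \<le> gradF z (xF z) \<bullet> (x - xF z)"
    using S.minimizer_vi[OF convex_feasible *] .
  have "(INF x\<in>feasible. Fz z x) = Fz z (xF z)"
    using * by (intro cInf_eq_minimum) auto
  then show "prox_val f A b l u p z = Fz z (xF z)"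
    by (simp add: prox_val_def feasible_def Fz_def)
qed

lemma hess0_norm: "norm (hessK 0 v) \<le> (L + p) * norm v"
  using Q_norm[of v] p_pos norm_triangle_ineq[of "Q *v v" "p *\<^sub>R v"]
  by (simp add: hessK_def algebra_simps)

text \<open>Replacing \<open>z\<close> by \<open>z'\<close> shifts the gradient by the constant
  \<open>p *\<^sub>R (z - z')\<close>, so the minimizer for \<open>z\<close> is approximately
  stationary for \<open>z'\<close>. The resulting constant does not involve
  \<open>y\<close>.\<close>

lemma xK_lipschitz:
  assumes "\<Gamma> \<ge> 0"
  shows "(\<gamma> + p) * norm (xK \<Gamma> y z - xK \<Gamma> y z') \<le> p * norm (z - z')"
proof -
  interpret S: strongly_convex_quadratic "\<lambda>x. K \<Gamma> x z' y" "\<lambda>x. gradK \<Gamma> x z' y" "hessK \<Gamma>" "\<gamma> + p"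
    using K_quadratic[OF assms] .
  have "gradK \<Gamma> x z' y - p *\<^sub>R (z - z') = gradK \<Gamma> x z y" for x
    by (simp add: gradK_def algebra_simps)
  then have "(\<gamma> + p) * norm (xK \<Gamma> y z - xK \<Gamma> y z') \<le> norm (p *\<^sub>R (z - z'))"
    using xK_vi[OF assms] by (intro S.residual_bound(1)[OF xK_in[OF assms] xK_in[OF assms]]) auto
  then show ?thesis using p_pos by simp
qed

text \<open>A multiplier for the proximal problem is the limit of the multipliers of its quadratic penalty
  problems, which stay bounded by the Slater condition.\<close>

lemma xF_multiplier:
  obtains n where "box_normal l u (xF z) n" "gradF z (xF z) + n \<in> range (\<lambda>y. y v* A)"
proof -
  interpret S: strongly_convex_quadratic "Fz z" "gradF z" "hessK 0" "\<gamma> + p" by (rule Fz_quadratic)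
  \<comment> \<open>Penalty minimizers with dual variable 0 and weight \<open>Suc k\<close>.
    Comparison with \<open>x0\<close>, where the penalty vanishes, makes the squared infeasibility
    of order \<open>1 / Suc k\<close>; the limit is identified with \<open>xF z\<close> at the end
    by \<open>residual_bound\<close> with \<open>e = 0\<close>.\<close>
  define x where "x k = xK (real (Suc k)) 0 z" for k
  define n where "n k = - gradK (real (Suc k)) (x k) z 0" for k
  obtain w where w: "w \<in> cbox l u" "\<And>x. x \<in> cbox l u \<Longrightarrow> Fz z w \<le> Fz z x"
    by (rule S.minimizer_exists[OF compact_cbox cbox_nonempty]) blast
  have x: "x k \<in> cbox l u" and n: "box_normal l u (x k) (n k)" for k
    by (simp_all add: x_def n_def xK_in xK_normal)
  have st: "hessK 0 (x k) + (r - p *\<^sub>R z) + n k \<in> range (\<lambda>y. y v* A)" for k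
  proof -
    have "hessK 0 (x k) + (r - p *\<^sub>R z) + n k = (- (real (Suc k) *\<^sub>R (A *v x k - b))) v* A"
      unfolding n_def gradK_eq_gradF gradF_def hessK_def
      by (simp add: algebra_simps)
    then show ?thesis by blast
  qed
  have x0in: "x0 \<in> cbox l u" using ball \<delta>_pos by (auto simp: subset_iff)
  have "(\<lambda>k. norm (A *v x k - b)) \<longlonglongrightarrow> 0"
  proof (rule tendsto_sandwich[OF _ _ tendsto_const])
    define B where "B = 2 * (Fz z x0 - Fz z w)"
    have "(norm (A *v x k - b))\<^sup>2 \<le> B * inverse (real (Suc k))" for k
    proof -
      have "K (real (Suc k)) (x k) z 0 \<le> K (real (Suc k)) x0 z 0"
        unfolding x_def using x0in by (intro xK_min) auto
      then have "Fz z w + real (Suc k) / 2 * (norm (A *v x k - b))\<^sup>2 \<le> Fz z x0"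
        using w(2)[OF x, of k] unfolding K_eq_Fz x0 by simp
      then show ?thesis by (simp add: B_def field_simps)
    qed
    then show "\<forall>\<^sub>F k in sequentially. norm (A *v x k - b) \<le> sqrt (B * inverse (real (Suc k)))"
      by (intro always_eventually allI real_le_rsqrt)
    show "(\<lambda>k. sqrt (B * inverse (real (Suc k)))) \<longlonglongrightarrow> 0"
      using tendsto_real_sqrt[OF tendsto_mult_right_zero[OF LIMSEQ_inverse_real_of_nat]] by simp
  qed auto
  then have r: "(\<lambda>k. A *v x k - b) \<longlonglongrightarrow> 0" by (rule tendsto_norm_zero_cancel)
  have "bounded_linear (hessK 0)" using S.lin by (simp add: linear_conv_bounded_linear)
  from perturbed_kkt_limit[OF \<delta>_pos ball x0 this x n st tendsto_const r]
  obtain xb nb where xb: "xb \<in> cbox l u" "A *v xb = b" "box_normal l u xb nb"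
    and "hessK 0 xb + (r - p *\<^sub>R z) + nb \<in> range (\<lambda>y. y v* A)" by metis
  moreover have "hessK 0 xb + (r - p *\<^sub>R z) = gradF z xb" by (simp add: gradF_def hessK_def algebra_simps)
  ultimately obtain y where y: "gradF z xb + nb = y v* A" by auto
  have "0 \<le> (gradF z xb - 0) \<bullet> (x' - xb)" if "x' \<in> feasible" for x'
  proof -
    have "nb \<bullet> (x' - xb) \<le> 0" using xb(3) that by (intro box_normal_inner_le_0) (auto simp: feasible_def)
    moreover have "(y v* A) \<bullet> (x' - xb) = 0"
      using that xb(2) by (simp add: dot_lmul_matrix feasible_def matrix_vector_mult_diff_distrib)
    then have "gradF z xb \<bullet> (x' - xb) + nb \<bullet> (x' - xb) = 0" by (simp flip: y inner_add_left)
    ultimately show ?thesis by simp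
  qed
  moreover have "xb \<in> feasible" using xb by (simp add: feasible_def)
  ultimately have "(\<gamma> + p) * norm (xb - xF z) \<le> norm (0 :: real^'n)"
    by (intro S.residual_bound(1)[of _ feasible] xF_in xF_vi)
  then have "xb = xF z" using m_pos by (simp add: mult_le_0_iff)
  then show thesis using that xb(3) y by auto
qed

text \<open>The componentwise signs of the difference \<open>d\<close> of the two minimizers determine a system of linear
  inequalities satisfied by the difference of the multipliers. Replacing the latter by a solution that
  is bounded by the data of the system makes the estimate \<open>\<langle>G d, d\<rangle> \<le> \<langle>\<eta>, A d\<rangle>\<close> linear in \<open>d\<close>.\<close>

proposition dual_error_bound:
  "\<exists>\<sigma>\<ge>0. \<forall>\<Gamma> y z. \<Gamma> \<ge> 0 \<longrightarrow> norm (xF z - xK \<Gamma> y z) \<le> \<sigma> * norm (A *v xK \<Gamma> y z - b)"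
proof -
  define a :: "'n \<times> real \<Rightarrow> real^'m" where "a = (\<lambda>(i, s). s *\<^sub>R column i A)"
  define I :: "('n \<times> real) set" where "I = UNIV \<times> {- 1, 1}"
  have finI: "finite I" by (simp add: I_def)
  have a: "a (i, s) \<bullet> y = s * (y v* A) $ i" for i s y
    by (simp add: a_def vector_matrix_mult_def column_def inner_vec_def sum_distrib_left ac_simps)
  obtain C where C: "C \<ge> 0"
    "\<And>J \<beta> y. J \<subseteq> I \<Longrightarrow> (\<forall>i\<in>J. a i \<bullet> y \<le> \<beta> i) \<Longrightarrow>
       \<exists>y'. (\<forall>i\<in>J. a i \<bullet> y' \<le> \<beta> i) \<and> norm y' \<le> C * (\<Sum>i\<in>J. \<bar>\<beta> i\<bar>)"
    using bounded_solution_of_inequalities[OF finI, of a] by blast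
  define C' where "C' = C * real (card I) * (L + p)"
  have "C' \<ge> 0" using C(1) L_pos p_pos by (simp add: C'_def)
  have "norm (xF z - xK \<Gamma> y z) \<le> C' / (\<gamma> + p) * norm (A *v xK \<Gamma> y z - b)" if \<Gamma>: "\<Gamma> \<ge> 0" for \<Gamma> y z
  proof -
    interpret S: strongly_convex_quadratic "Fz z" "gradF z" "hessK 0" "\<gamma> + p" by (rule Fz_quadratic)
    define x2 d where "x2 = xK \<Gamma> y z" and "d = xF z - x2"
    define n2 where "n2 = - gradK \<Gamma> x2 z y"
    define h where "h = hessK 0 d"
    have n2: "box_normal l u x2 n2" unfolding n2_def x2_def by (rule xK_normal[OF \<Gamma>])
    obtain n1 where n1: "box_normal l u (xF z) n1" "gradF z (xF z) + n1 \<in> range (\<lambda>y. y v* A)"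
      using xF_multiplier by blast
    then obtain y1 where y1: "gradF z (xF z) + n1 = y1 v* A" by blast
    \<comment> \<open>Difference of the two multipliers: in the sign convention of
      \<open>y1\<close>, the multiplier belonging to \<open>x2\<close> is
      \<open>- (y + \<Gamma> *\<^sub>R (A *v x2 - b))\<close>.\<close>
    define \<eta> where "\<eta> = y1 + y + \<Gamma> *\<^sub>R (A *v x2 - b)"
    have \<eta>: "\<eta> v* A = h + (n1 - n2)"
    proof -
      have "\<eta> v* A = y1 v* A + (y + \<Gamma> *\<^sub>R (A *v x2 - b)) v* A"
        by (simp add: \<eta>_def add.assoc vector_matrix_left_distrib)
      then show ?thesis
        unfolding n2_def gradK_eq_gradF y1[symmetric] h_def d_def
        using S.g_diff[of "xF z" x2] by simp
    qed
    have mono: "0 \<le> ((\<eta> v* A) $ i - h $ i) * d $ i" for i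
      using box_normal_mono[OF n1(1) n2, of i] xF_in[of z] xK_in[OF \<Gamma>, of y z]
      by (simp add: \<eta> d_def x2_def feasible_def)
    \<comment> \<open>With \<open>s = - sgn (d $ i)\<close>, the coordinatewise monotonicity
      \<open>mono\<close> becomes the inequality
      \<open>a (i, s) \<bullet> \<eta> \<le> \<beta> (i, s)\<close>. Coordinates with
      \<open>d $ i = 0\<close> contribute to none of the inner products with
      \<open>d\<close>.\<close>
    define J where "J = {(i, s). s = - sgn (d $ i) \<and> d $ i \<noteq> 0}"
    define \<beta> where "\<beta> = (\<lambda>(i, s). s * h $ i)"
    have JI: "J \<subseteq> I" by (auto simp: J_def I_def sgn_real_def split: if_splits)
    have "\<forall>i\<in>J. a i \<bullet> \<eta> \<le> \<beta> i"
    proof (clarify, unfold a \<beta>_def prod.case)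
      fix i s assume "(i, s) \<in> J"
      then show "s * (\<eta> v* A) $ i \<le> s * h $ i"
        using mono[of i] by (auto simp: J_def sgn_real_def zero_le_mult_iff split: if_splits)
    qed
    from C(2)[OF JI this] obtain \<eta>' where \<eta>': "\<forall>i\<in>J. a i \<bullet> \<eta>' \<le> \<beta> i"
      and \<eta>'_norm: "norm \<eta>' \<le> C * (\<Sum>i\<in>J. \<bar>\<beta> i\<bar>)" by blast
    have "\<bar>\<beta> j\<bar> \<le> norm h" if "j \<in> I" for j
      using that component_le_norm_cart[of h "fst j"] by (auto simp: \<beta>_def I_def)
    then have "(\<Sum>j\<in>J. \<bar>\<beta> j\<bar>) \<le> real (card J) * norm h"
      using JI by (intro sum_bounded_above) auto
    also have "\<dots> \<le> real (card I) * norm h"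
      using card_mono[OF finI JI] by (intro mult_right_mono) auto
    also have "\<dots> \<le> real (card I) * ((L + p) * norm d)"
      unfolding h_def using hess0_norm by (intro mult_left_mono) auto
    finally have "norm \<eta>' \<le> C * (real (card I) * ((L + p) * norm d))"
      using \<eta>'_norm C(1) by (meson mult_left_mono order_trans)
    then have nn: "norm \<eta>' \<le> C' * norm d" by (simp add: C'_def mult.assoc)
    \<comment> \<open>The sign conditions on \<open>J\<close> are all that is needed to replace
      \<open>h\<close> by \<open>\<eta>' v* A\<close> against \<open>d\<close>. Since
      \<open>A *v d\<close> is minus the residual of \<open>x2\<close> and \<eta>' is linear in
      \<open>norm d\<close>, one factor \<open>norm d\<close> cancels.\<close>
    have "(\<gamma> + p) * (norm d)\<^sup>2 \<le> h \<bullet> d" unfolding h_def by (rule S.strong)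
    also have "\<dots> \<le> (\<eta>' v* A) \<bullet> d"
      unfolding inner_vec_def
    proof (rule sum_mono)
      fix i
      show "h $ i \<bullet> d $ i \<le> (\<eta>' v* A) $ i \<bullet> d $ i"
      proof (cases "d $ i = 0")
        case False
        then have "(i, - sgn (d $ i)) \<in> J" by (simp add: J_def)
        then have "- sgn (d $ i) * (\<eta>' v* A) $ i \<le> - sgn (d $ i) * h $ i"
          using \<eta>' by (auto simp: a \<beta>_def dest!: bspec)
        then show ?thesis using False
          by (cases "d $ i > 0") (auto simp: mult_right_mono mult_right_mono_neg sgn_real_def)
      qed simp
    qed
    also have "\<dots> = \<eta>' \<bullet> (b - A *v x2)"
      using xF_in[of z] by (simp add: dot_lmul_matrix d_def matrix_vector_mult_diff_distrib feasible_def)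
    also have "\<dots> \<le> (C' * norm d) * norm (A *v x2 - b)"
      using nn by (intro order_trans[OF norm_cauchy_schwarz] mult_mono) (auto simp: norm_minus_commute \<open>C' \<ge> 0\<close>)
    finally have "((\<gamma> + p) * norm d) * norm d \<le> (C' * norm (A *v x2 - b)) * norm d"
      by (simp add: power2_eq_square algebra_simps)
    then have "(\<gamma> + p) * norm d \<le> C' * norm (A *v x2 - b)"
      using \<open>C' \<ge> 0\<close> by (cases "d = 0") (auto dest: mult_right_le_imp_le)
    then show ?thesis using m_pos by (simp add: d_def x2_def field_simps)
  qed
  moreover have "C' / (\<gamma> + p) \<ge> 0" using \<open>C' \<ge> 0\<close> m_pos by simp
  ultimately show ?thesis by blast
qed

end

section \<open>Sufficient descent\<close>

lemma norm_vector_matrix_mult_le: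
  fixes A :: "real^'n^'m"
  shows "norm (w v* A) \<le> onorm ((*v) A) * norm w"
proof -
  have "norm (w v* A) * norm (w v* A) = w \<bullet> (A *v (w v* A))"
    by (simp add: dot_lmul_matrix[symmetric] power2_norm_eq_inner flip: power2_eq_square)
  also have "\<dots> \<le> norm w * norm (A *v (w v* A))" by (rule norm_cauchy_schwarz)
  also have "\<dots> \<le> norm w * (onorm ((*v) A) * norm (w v* A))"
    by (intro mult_left_mono onorm matrix_vector_mul_bounded_linear) auto
  finally show ?thesis
    using onorm_pos_le[OF matrix_vector_mul_bounded_linear, of A]
      mult_right_le_imp_le[of "norm (w v* A)" "norm (w v* A)" "onorm ((*v) A) * norm w"]
    by (cases "w v* A = 0") (auto simp: mult_ac)
qed

locale prox_alm = box_qp Q r l u x0 A b L \<gamma> p \<delta>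
  for Q :: "real^'n^'n" and r l u x0 :: "real^'n" and A :: "real^'n^'m" and b :: "real^'m"
    and L \<gamma> p \<delta> :: real +
  fixes \<Gamma> c L_K :: real
  assumes \<Gamma>_pos: "\<Gamma> > 0" and L_K: "L_K = L + p + \<Gamma> * (onorm ((*v) A))\<^sup>2"
    and c_pos: "0 < c" and c_less: "c < 1 / L_K"
begin

abbreviation d :: "real^'m \<Rightarrow> real^'n \<Rightarrow> real" where
  "d y z \<equiv> dual_val f A b l u \<Gamma> p y z"

abbreviation M :: "real^'n \<Rightarrow> real" where
  "M z \<equiv> prox_val f A b l u p z"

abbreviation xd :: "real^'m \<Rightarrow> real^'n \<Rightarrow> real^'n" where
  "xd \<equiv> xK \<Gamma>"

abbreviation m :: real where "m \<equiv> \<gamma> + p"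

abbreviation proj_step :: "real^'n \<Rightarrow> real^'n \<Rightarrow> real^'m \<Rightarrow> real^'n" where
  "proj_step x z y \<equiv> closest_point (cbox l u) (x - c *\<^sub>R gradK \<Gamma> x z y)"

lemma \<Gamma>_nonneg: "0 \<le> \<Gamma>" using \<Gamma>_pos by simp

lemma norm_A: "norm (A *v v) \<le> onorm ((*v) A) * norm v"
  by (intro onorm matrix_vector_mul_bounded_linear)

lemma onorm_A_nonneg: "0 \<le> onorm ((*v) A)"
  by (intro onorm_pos_le matrix_vector_mul_bounded_linear)

lemma L_K_pos: "L_K > 0"
  using L_pos p_pos \<Gamma>_pos by (simp add: L_K add_pos_nonneg)

lemma L_K_le: "L_K \<le> 1 / c"
  using c_less c_pos L_K_pos by (simp add: field_simps)

lemma hessK_norm: "norm (hessK \<Gamma> v) \<le> L_K * norm v"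
proof -
  have "norm ((A *v v) v* A) \<le> onorm ((*v) A) * (onorm ((*v) A) * norm v)"
    using norm_A[of v] onorm_A_nonneg
    by (intro order_trans[OF norm_vector_matrix_mult_le] mult_left_mono)
  then have "\<Gamma> * norm ((A *v v) v* A) \<le> \<Gamma> * ((onorm ((*v) A))\<^sup>2 * norm v)"
    using \<Gamma>_pos by (intro mult_left_mono) (auto simp: power2_eq_square mult_ac)
  moreover have "norm (hessK \<Gamma> v) \<le> norm (Q *v v) + \<Gamma> * norm ((A *v v) v* A) + p * norm v"
    unfolding hessK_def using norm_triangle_ineq \<Gamma>_pos p_pos
    by (intro order_trans[OF norm_triangle_ineq] add_mono) auto
  ultimately show ?thesis using Q_norm[of v] by (simp add: L_K algebra_simps)
qed

lemma gradK_diff: "gradK \<Gamma> x' z' y - gradK \<Gamma> x z y = hessK \<Gamma> (x' - x) - p *\<^sub>R (z' - z)"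
  by (simp add: gradK_def hessK_def algebra_simps)

lemma proj_step_in: "proj_step x z y \<in> cbox l u"
  using cbox_nonempty by (intro closest_point_in_set closed_cbox)

lemma proj_step_vi:
  assumes "w \<in> cbox l u"
  shows "0 \<le> (gradK \<Gamma> x z y - (1 / c) *\<^sub>R (x - proj_step x z y)) \<bullet> (w - proj_step x z y)"
proof -
  define x' where "x' = proj_step x z y"
  have "(x - c *\<^sub>R gradK \<Gamma> x z y - x') \<bullet> (w - x') \<le> 0"
    unfolding x'_def using assms by (intro closest_point_dot convex_box closed_cbox)
  moreover have "x - c *\<^sub>R gradK \<Gamma> x z y - x' = (- c) *\<^sub>R (gradK \<Gamma> x z y - (1 / c) *\<^sub>R (x - x'))"
    using c_pos by (simp add: algebra_simps)
  ultimately show ?thesis using c_pos by (simp add: x'_def[symmetric] zero_le_mult_iff)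
qed

text \<open>The usual descent estimate of projected gradient: the projection inequality gains
  \<open>1 / c\<close> times the squared step, and \<open>L_K \<le> 1 / c\<close> lets the curvature
  take back at most half.\<close>

lemma proj_step_descent:
  assumes "x \<in> cbox l u"
  shows "1 / (2 * c) * (norm (x - proj_step x z y))\<^sup>2 \<le> K \<Gamma> x z y - K \<Gamma> (proj_step x z y) z y"
proof -
  interpret S: strongly_convex_quadratic "\<lambda>x. K \<Gamma> x z y" "\<lambda>x. gradK \<Gamma> x z y" "hessK \<Gamma>" "\<gamma> + p"
    using K_quadratic[OF \<Gamma>_nonneg] .
  define x' where "x' = proj_step x z y"
  have "1 / c * (norm (x - x'))\<^sup>2 \<le> gradK \<Gamma> x z y \<bullet> (x - x')"
    using proj_step_vi[OF assms, of x z y]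
    by (simp add: x'_def[symmetric] inner_diff_left dot_square_norm)
  moreover have "gradK \<Gamma> x z y \<bullet> (x' - x) = - (gradK \<Gamma> x z y \<bullet> (x - x'))"
    by (simp add: inner_diff_right)
  moreover have "hessK \<Gamma> (x' - x) \<bullet> (x' - x) \<le> 1 / c * (norm (x - x'))\<^sup>2"
  proof -
    have "hessK \<Gamma> (x' - x) \<bullet> (x' - x) \<le> norm (hessK \<Gamma> (x' - x)) * norm (x' - x)"
      by (rule norm_cauchy_schwarz)
    also have "\<dots> \<le> L_K * norm (x' - x) * norm (x' - x)"
      using hessK_norm by (intro mult_right_mono) auto
    also have "\<dots> \<le> 1 / c * (norm (x' - x) * norm (x' - x))"
      using mult_right_mono[OF L_K_le, of "norm (x' - x) * norm (x' - x)"] by (simp add: mult.assoc)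
    finally show ?thesis by (simp add: norm_minus_commute power2_eq_square)
  qed
  ultimately show ?thesis
    using S.expand[of x' x] by (simp add: x'_def[symmetric] field_simps)
qed

text \<open>The step is computed with \<open>z\<close>, but the next potential is evaluated at
  \<open>z'\<close>. The residual \<open>e\<close> therefore collects the change of the gradient
  from \<open>(x, z)\<close> to \<open>(x', z')\<close> and the projection term
  \<open>(x - x') / c\<close>.\<close>

lemma proj_step_residual:
  fixes x z y z'
  defines "x' \<equiv> proj_step x z y"
  defines "\<rho> \<equiv> (L_K + 1 / c) * norm (x - x') + p * norm (z' - z)"
  shows "m * norm (x' - xd y z') \<le> \<rho>" and "K \<Gamma> x' z' y - d y z' \<le> \<rho>\<^sup>2 / m"
proof -
  interpret S: strongly_convex_quadratic "\<lambda>x. K \<Gamma> x z' y" "\<lambda>x. gradK \<Gamma> x z' y" "hessK \<Gamma>" "\<gamma> + p"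
    using K_quadratic[OF \<Gamma>_nonneg] .
  define e where "e = hessK \<Gamma> (x' - x) - p *\<^sub>R (z' - z) + (1 / c) *\<^sub>R (x - x')"
  have "gradK \<Gamma> x' z' y - e = gradK \<Gamma> x z y - (1 / c) *\<^sub>R (x - x')"
    unfolding e_def using gradK_diff[of x' z' y x z] by (simp add: algebra_simps)
  then have vi: "0 \<le> (gradK \<Gamma> x' z' y - e) \<bullet> (w - x')" if "w \<in> cbox l u" for w
    using proj_step_vi[OF that] by (simp add: x'_def)
  have x': "x' \<in> cbox l u" unfolding x'_def by (rule proj_step_in)
  have "norm e \<le> norm (hessK \<Gamma> (x' - x)) + norm (p *\<^sub>R (z' - z)) + norm ((1 / c) *\<^sub>R (x - x'))"
    unfolding e_def by (meson add_right_mono norm_triangle_ineq norm_triangle_ineq4 order_trans)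
  also have "\<dots> \<le> L_K * norm (x' - x) + p * norm (z' - z) + 1 / c * norm (x - x')"
    using hessK_norm[of "x' - x"] p_pos c_pos by simp
  also have "\<dots> = \<rho>" by (simp add: \<rho>_def norm_minus_commute[of x'] distrib_right)
  finally have e: "norm e \<le> \<rho>" .
  note res = S.residual_bound[OF x' xK_in[OF \<Gamma>_nonneg] vi xK_vi[OF \<Gamma>_nonneg]]
  show "m * norm (x' - xd y z') \<le> \<rho>" using res(1) e by simp
  have "(norm e)\<^sup>2 / m \<le> \<rho>\<^sup>2 / m" using e m_pos by (intro divide_right_mono power_mono) auto
  then show "K \<Gamma> x' z' y - d y z' \<le> \<rho>\<^sup>2 / m"
    using res(2) by (simp add: dual_val_eq[OF \<Gamma>_nonneg])
qed

definition \<sigma>\<^sub>1 :: real where "\<sigma>\<^sub>1 = (L_K + 1 / c) / m + 1"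

lemma primal_error_bound: "norm (x - xd y z) \<le> \<sigma>\<^sub>1 * norm (x - proj_step x z y)"
proof -
  define x' where "x' = proj_step x z y"
  have "norm (x' - xd y z) \<le> (L_K + 1 / c) / m * norm (x - x')"
    using proj_step_residual(1)[of x z y z] m_pos by (simp add: x'_def[symmetric] field_simps)
  moreover have "norm (x - xd y z) \<le> norm (x - x') + norm (x' - xd y z)"
    using norm_triangle_ineq[of "x - x'" "x' - xd y z"] by simp
  ultimately show ?thesis by (simp add: \<sigma>\<^sub>1_def x'_def[symmetric] algebra_simps)
qed

lemma xd_lipschitz: "norm (xd y z - xd y z') \<le> p / m * norm (z - z')"
  using xK_lipschitz[OF \<Gamma>_nonneg, of y z z'] m_pos by (simp add: field_simps)

text \<open>The potential with \<open>f*\<close> left out, so that descent can be proved before the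
  limiting component is known to exist.\<close>

definition \<phi> :: "real^'n \<Rightarrow> real^'m \<Rightarrow> real^'n \<Rightarrow> real" where
  "\<phi> x y z = K \<Gamma> x z y - 2 * d y z + 2 * M z"

lemma K_y_diff: "K \<Gamma> x z (y + v) = K \<Gamma> x z y + v \<bullet> (A *v x - b)"
  by (simp add: aug_lagr_def inner_add_left)

lemma K_z_diff: "K \<Gamma> x z' y - K \<Gamma> x z y = p / 2 * ((norm (x - z'))\<^sup>2 - (norm (x - z))\<^sup>2)"
  by (simp add: aug_lagr_def algebra_simps)

lemma dual_val_y_ascent: "v \<bullet> (A *v xd (y + v) z - b) \<le> d (y + v) z - d y z"
  using xK_min[OF \<Gamma>_nonneg xK_in[OF \<Gamma>_nonneg], of y z "y + v" z]
  by (simp add: dual_val_eq[OF \<Gamma>_nonneg] K_y_diff)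

lemma dual_val_z_ascent:
  "p / 2 * ((norm (xd y z' - z'))\<^sup>2 - (norm (xd y z' - z))\<^sup>2) \<le> d y z' - d y z"
  using xK_min[OF \<Gamma>_nonneg xK_in[OF \<Gamma>_nonneg], of y z y z'] K_z_diff[of "xd y z'" z' y z]
  by (simp add: dual_val_eq[OF \<Gamma>_nonneg])

lemma prox_val_ascent: "M z' - M z \<le> p / 2 * ((norm (xF z - z'))\<^sup>2 - (norm (xF z - z))\<^sup>2)"
  using xF_min[OF xF_in, of z' z] by (simp add: prox_val_eq Fz_def algebra_simps)

text \<open>Let \<open>a\<close> and \<open>e\<close> be the residuals of \<open>x\<close> and of
  \<open>xd y' z\<close>. The dual step raises \<open>K\<close> by \<alpha> |a|^2 and
  \<open>2 d\<close> by at least 2 \<alpha> a.e, a net decrease of \<phi> of at least \<alpha> |e|^2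
  - \<alpha> |a - e|^2. The primal error bound and \<open>\<alpha>_small\<close> charge |a - e|^2 to
  half of the decrease from the \<open>x\<close> step. The drift of \<open>2 d - 2 M\<close> in
  \<open>z\<close> is charged to half of the decrease from the \<open>z\<close> step, through
  \<open>\<beta>_small\<close>, and to half of \<alpha> |e|^2. The other halves remain.\<close>

lemma sufficient_descent:
  assumes x: "x \<in> cbox l u" and y': "y' = y + \<alpha> *\<^sub>R (A *v x - b)" and x': "x' = proj_step x z y'"
    and z': "z' = z + \<beta> *\<^sub>R (x' - z)" and \<alpha>: "\<alpha> > 0" and \<beta>: "0 < \<beta>" "\<beta> \<le> 1"
    and \<sigma>: "\<sigma> \<ge> 0" "norm (xF z - xd y' z) \<le> \<sigma> * norm (A *v xd y' z - b)"
    and \<alpha>_small: "\<alpha> * (onorm ((*v) A) * \<sigma>\<^sub>1)\<^sup>2 \<le> 1 / (4 * c)"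
    and \<beta>_small: "2 * p * (p / m) + 2 * p\<^sup>2 * \<sigma>\<^sup>2 / \<alpha> \<le> p / (4 * \<beta>)"
  shows "1 / (4 * c) * (norm (x - x'))\<^sup>2 + p / (4 * \<beta>) * (norm (z - z'))\<^sup>2
     + \<alpha> / 2 * (norm (A *v xd y' z - b))\<^sup>2 \<le> \<phi> x y z - \<phi> x' y' z'"
proof -
  define a where "a = A *v x - b"
  define x2 where "x2 = xd y' z"
  define x3 where "x3 = xd y' z'"
  define x1 where "x1 = xF z"
  define e where "e = A *v x2 - b"
  define dz where "dz = norm (z - z')"
  have 1: "K \<Gamma> x z y' = K \<Gamma> x z y + \<alpha> * (a \<bullet> a)"
    by (simp add: y' K_y_diff a_def)
  have 2: "1 / (2 * c) * (norm (x - x'))\<^sup>2 \<le> K \<Gamma> x z y' - K \<Gamma> x' z y'"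
    unfolding x' by (rule proj_step_descent[OF x])
  have 3: "p / (2 * \<beta>) * dz\<^sup>2 \<le> K \<Gamma> x' z y' - K \<Gamma> x' z' y'"
  proof -
    have "z - z' = (- \<beta>) *\<^sub>R (x' - z)" by (simp add: z')
    then have "dz = \<beta> * norm (x' - z)" unfolding dz_def using \<beta> by (simp only: norm_scaleR)
    then have "p / (2 * \<beta>) * dz\<^sup>2 = p / 2 * (\<beta> * (norm (x' - z))\<^sup>2)"
      using \<beta> by (simp add: power2_eq_square)
    also have "\<dots> \<le> p / 2 * (\<beta> * (2 - \<beta>) * (norm (x' - z))\<^sup>2)"
      using p_pos \<beta> by (intro mult_left_mono mult_right_mono) auto
    also have "\<beta> * (2 - \<beta>) * (norm (x' - z))\<^sup>2 = (norm (x' - z))\<^sup>2 - ((1 - \<beta>) * norm (x' - z))\<^sup>2"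
      by (simp add: power2_eq_square algebra_simps)
    also have "(1 - \<beta>) * norm (x' - z) = norm (x' - z')"
    proof -
      have "x' - z' = (1 - \<beta>) *\<^sub>R (x' - z)" by (simp add: z' algebra_simps)
      then show ?thesis using \<beta> by simp
    qed
    finally show ?thesis using K_z_diff[of x' z' y' z] by (simp only: right_diff_distrib)
  qed
  have 4: "\<alpha> * (a \<bullet> e) \<le> d y' z - d y z"
    using dual_val_y_ascent[of "\<alpha> *\<^sub>R a" y z] by (simp add: y' a_def e_def x2_def)
  \<comment> \<open>Both changes are estimated by keeping one minimizer fixed, \<open>x3\<close> for
    \<open>d\<close> and \<open>x1\<close> for \<open>M\<close>. The terms quadratic in
    \<open>z\<close> and \<open>z'\<close> cancel, leaving an inner product of the step with
    \<open>x1 - x3\<close>.\<close>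
  have 5: "2 * p * ((z' - z) \<bullet> (x1 - x3)) \<le> 2 * ((d y' z' - d y' z) - (M z' - M z))"
  proof -
    define I X Y where "I = (z' - z) \<bullet> (x1 - x3)" and "X = (norm (x3 - z'))\<^sup>2 - (norm (x3 - z))\<^sup>2"
      and "Y = (norm (x1 - z'))\<^sup>2 - (norm (x1 - z))\<^sup>2"
    have "2 * I = X - Y"
      by (simp add: I_def X_def Y_def power2_norm_eq_inner inner_diff_left inner_diff_right inner_commute)
    then have "p * (2 * I) = p * (X - Y)" by (simp only:)
    then have "2 * p * I = 2 * (p / 2 * X - p / 2 * Y)" by (simp add: algebra_simps)
    also have "p / 2 * X - p / 2 * Y \<le> (d y' z' - d y' z) - (M z' - M z)"
      unfolding X_def Y_def x1_def x3_def by (intro diff_mono dual_val_z_ascent prox_val_ascent)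
    finally show ?thesis by (simp add: I_def)
  qed
  have 6: "\<alpha> * (norm (a - e))\<^sup>2 \<le> 1 / (4 * c) * (norm (x - x'))\<^sup>2"
  proof -
    have "norm (a - e) = norm (A *v (x - x2))"
      by (simp add: a_def e_def matrix_vector_mult_diff_distrib)
    also have "\<dots> \<le> onorm ((*v) A) * (\<sigma>\<^sub>1 * norm (x - x'))"
      using primal_error_bound[of x y' z] onorm_A_nonneg
      by (intro order_trans[OF norm_A] mult_left_mono) (auto simp: x2_def x')
    finally have "(norm (a - e))\<^sup>2 \<le> (onorm ((*v) A) * \<sigma>\<^sub>1 * norm (x - x'))\<^sup>2"
      by (intro power_mono) (auto simp: mult.assoc)
    then have "\<alpha> * (norm (a - e))\<^sup>2 \<le> \<alpha> * (onorm ((*v) A) * \<sigma>\<^sub>1)\<^sup>2 * (norm (x - x'))\<^sup>2"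
      using \<alpha> by (simp add: power_mult_distrib mult.assoc)
    also have "\<dots> \<le> 1 / (4 * c) * (norm (x - x'))\<^sup>2"
      using \<alpha>_small by (intro mult_right_mono) auto
    finally show ?thesis .
  qed
  have 7: "- (2 * p * ((z' - z) \<bullet> (x1 - x3))) \<le> p / (4 * \<beta>) * dz\<^sup>2 + \<alpha> / 2 * (norm e)\<^sup>2"
  proof -
    have "- ((z' - z) \<bullet> (x1 - x3)) \<le> dz * norm (x1 - x3)"
      using norm_cauchy_schwarz[of "z - z'" "x1 - x3"] by (simp add: dz_def inner_diff_left)
    also have "\<dots> \<le> dz * (\<sigma> * norm e + p / m * dz)"
    proof (rule mult_left_mono)
      have "norm (x1 - x3) \<le> norm (x1 - x2) + norm (x2 - x3)"
        using norm_triangle_ineq[of "x1 - x2" "x2 - x3"] by simp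
      then show "norm (x1 - x3) \<le> \<sigma> * norm e + p / m * dz"
        using \<sigma>(2) xd_lipschitz[of y' z z'] by (simp add: x1_def x2_def x3_def e_def dz_def)
    qed (simp add: dz_def)
    finally have "2 * p * (- ((z' - z) \<bullet> (x1 - x3))) \<le> 2 * p * (dz * (\<sigma> * norm e + p / m * dz))"
      by (rule mult_left_mono) (use p_pos in simp)
    also have "\<dots> = 2 * p * (p / m) * dz\<^sup>2 + 2 * p * \<sigma> * dz * norm e"
      by (simp add: algebra_simps power2_eq_square)
    \<comment> \<open>Young's inequality, weighted so that exactly half of \<alpha> |e|^2 is
      spent.\<close>
    also have "2 * p * \<sigma> * dz * norm e \<le> \<alpha> / 2 * (norm e)\<^sup>2 + 2 * p\<^sup>2 * \<sigma>\<^sup>2 / \<alpha> * dz\<^sup>2"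
    proof -
      have "0 \<le> (\<alpha> * norm e - 2 * p * \<sigma> * dz)\<^sup>2 / (2 * \<alpha>)" using \<alpha> by simp
      also have "\<dots> = \<alpha> / 2 * (norm e)\<^sup>2 + 2 * p\<^sup>2 * \<sigma>\<^sup>2 / \<alpha> * dz\<^sup>2 - 2 * p * \<sigma> * dz * norm e"
        using \<alpha> by (simp add: power2_eq_square field_simps)
      finally show ?thesis by simp
    qed
    also have "2 * p * (p / m) * dz\<^sup>2 + (\<alpha> / 2 * (norm e)\<^sup>2 + 2 * p\<^sup>2 * \<sigma>\<^sup>2 / \<alpha> * dz\<^sup>2)
        = (2 * p * (p / m) + 2 * p\<^sup>2 * \<sigma>\<^sup>2 / \<alpha>) * dz\<^sup>2 + \<alpha> / 2 * (norm e)\<^sup>2"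
      by (simp add: algebra_simps)
    also have "\<dots> \<le> p / (4 * \<beta>) * dz\<^sup>2 + \<alpha> / 2 * (norm e)\<^sup>2"
      using \<beta>_small by (intro add_right_mono mult_right_mono) auto
    finally show ?thesis by (simp only: mult_minus_right)
  qed
  have 8: "\<alpha> * (norm e)\<^sup>2 - \<alpha> * (norm (a - e))\<^sup>2 = 2 * (\<alpha> * (a \<bullet> e)) - \<alpha> * (a \<bullet> a)"
    by (simp add: power2_norm_eq_inner inner_diff_left inner_diff_right inner_commute algebra_simps)
  have 9: "p / (2 * \<beta>) * dz\<^sup>2 = p / (4 * \<beta>) * dz\<^sup>2 + p / (4 * \<beta>) * dz\<^sup>2"
    "1 / (2 * c) * (norm (x - x'))\<^sup>2 = 1 / (4 * c) * (norm (x - x'))\<^sup>2 + 1 / (4 * c) * (norm (x - x'))\<^sup>2"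
    by (simp_all add: field_simps)
  show ?thesis
    unfolding x2_def[symmetric] e_def[symmetric] dz_def[symmetric] \<phi>_def
    using 1 2 3 4 5 6 7 8 9 by argo
qed

lemma dual_val_le_prox_val: "d y z \<le> M z"
proof -
  have "d y z \<le> K \<Gamma> (xF z) z y"
    using xF_in feasible_subset by (auto simp: dual_val_eq[OF \<Gamma>_nonneg] intro!: xK_min[OF \<Gamma>_nonneg])
  then show ?thesis using xF_in[of z] by (simp add: K_eq_Fz prox_val_eq feasible_def)
qed

text \<open>\<phi> is the sum of the nonnegative gaps \<open>K - d\<close> and \<open>M - d\<close>
  and of \<open>M\<close>, which is at least the minimum of \<open>f\<close> on the box.\<close>

lemma \<phi>_lower_bound: "\<exists>B. \<forall>x y z. x \<in> cbox l u \<longrightarrow> B \<le> \<phi> x y z"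
proof -
  have "continuous_on UNIV f"
    unfolding f_def using linear_continuous_on[OF matrix_vector_mul_bounded_linear, of UNIV Q] by (intro continuous_intros) auto
  then obtain w where w: "\<And>x. x \<in> cbox l u \<Longrightarrow> f w \<le> f x"
    using continuous_attains_inf[OF compact_cbox cbox_nonempty] continuous_on_subset[OF _ subset_UNIV] by meson
  have "f w \<le> \<phi> x y z" if x: "x \<in> cbox l u" for x y z
  proof -
    have "d y z \<le> K \<Gamma> x z y" using x by (auto simp: dual_val_eq[OF \<Gamma>_nonneg] intro!: xK_min[OF \<Gamma>_nonneg])
    moreover have "f w \<le> f (xF z)" using w xF_in feasible_subset by blast
    moreover have "f (xF z) \<le> M z" using p_pos by (simp add: prox_val_eq Fz_def)
    ultimately show ?thesis using dual_val_le_prox_val[of y z] unfolding \<phi>_def by linarith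
  qed
  then show ?thesis by blast
qed

end

section \<open>KKT points and active sets\<close>

context box_qp
begin

text \<open>The KKT system with \<open>n = \<nu> - \<mu>\<close> and \<open>y\<close> eliminated;
  the sign of \<open>y\<close> is absorbed by the range.\<close>

definition kkt :: "real^'n \<Rightarrow> real^'n \<Rightarrow> bool" where
  "kkt x n \<longleftrightarrow> x \<in> cbox l u \<and> A *v x = b \<and> box_normal l u x n \<and> Q *v x + r + n \<in> range (\<lambda>y. y v* A)"

lemma kkt_imp_KKT:
  assumes "kkt x n"
  obtains y where "KKT f A b l u x y (\<chi> i. max 0 (- n $ i)) (\<chi> i. max 0 (n $ i))"
proof -
  obtain y where y: "Q *v x + r + n = y v* A" using assms by (auto simp: kkt_def)
  have "- (\<chi> i. max 0 (- n $ i)) + (\<chi> i. max 0 (n $ i)) = n"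
    by (simp add: vec_eq_iff max_def)
  then have "grad f x + transpose A *v (- y) - (\<chi> i. max 0 (- n $ i)) + (\<chi> i. max 0 (n $ i)) = 0"
    using y by (simp add: grad_f vector_matrix_mult_minus algebra_simps)
  moreover have "l $ i \<le> x $ i" "x $ i \<le> u $ i" for i using assms by (auto simp: kkt_def mem_box_cart)
  moreover have "max 0 (- n $ i) * (l $ i - x $ i) = 0" "max 0 (n $ i) * (x $ i - u $ i) = 0" for i
  proof -
    have "0 < n $ i \<longrightarrow> x $ i = u $ i" "n $ i < 0 \<longrightarrow> x $ i = l $ i"
      using assms by (auto simp: kkt_def box_normal_def)
    then show "max 0 (- n $ i) * (l $ i - x $ i) = 0" "max 0 (n $ i) * (x $ i - u $ i) = 0"
      by (auto simp: max_def)
  qed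
  ultimately have "KKT f A b l u x (- y) (\<chi> i. max 0 (- n $ i)) (\<chi> i. max 0 (n $ i))"
    using assms by (simp add: KKT_def kkt_def)
  then show thesis by (rule that)
qed

lemma Xstar_iff_kkt: "x \<in> Xstar f A b l u \<longleftrightarrow> (\<exists>n. kkt x n)"
proof
  assume "\<exists>n. kkt x n"
  then show "x \<in> Xstar f A b l u" unfolding Xstar_def by (auto elim!: kkt_imp_KKT)
next
  assume "x \<in> Xstar f A b l u"
  then obtain y \<mu> \<nu> where K: "KKT f A b l u x y \<mu> \<nu>" by (auto simp: Xstar_def)
  have "Q *v x + r + (\<nu> - \<mu>) = (- y) v* A"
    using K by (simp add: KKT_def grad_f) (simp add: vector_matrix_mult_minus algebra_simps eq_neg_iff_add_eq_0)
  moreover have "x \<in> cbox l u" "A *v x = b" using K by (auto simp: KKT_def mem_box_cart)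
  moreover have "box_normal l u x (\<nu> - \<mu>)"
    unfolding box_normal_def
  proof (intro allI conjI impI)
    fix i
    have h: "0 \<le> \<mu> $ i" "0 \<le> \<nu> $ i" "\<mu> $ i * (l $ i - x $ i) = 0" "\<nu> $ i * (x $ i - u $ i) = 0"
      using K by (auto simp: KKT_def)
    show "x $ i = u $ i" if "0 < (\<nu> - \<mu>) $ i" using h that by auto
    show "x $ i = l $ i" if "(\<nu> - \<mu>) $ i < 0" using h that by auto
  qed
  ultimately have "kkt x (\<nu> - \<mu>)" by (auto simp: kkt_def)
  then show "\<exists>n. kkt x n" by blast
qed

lemma Xstar_subset: "Xstar f A b l u \<subseteq> cbox l u"
  by (auto simp: Xstar_iff_kkt kkt_def)

text \<open>If \<open>n $ i = 0\<close>, both multipliers obtained by splitting \<open>n\<close>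
  into positive and negative part vanish at \<open>i\<close>, so strict complementarity rules out
  both bounds.\<close>

lemma strict_kkt:
  assumes "strict_complementarity f A b l u" "kkt x n" "n $ i = 0"
  shows "x $ i \<noteq> l $ i" "x $ i \<noteq> u $ i"
proof -
  obtain y where "KKT f A b l u x y (\<chi> i. max 0 (- n $ i)) (\<chi> i. max 0 (n $ i))"
    using kkt_imp_KKT[OF assms(2)] .
  then have "((\<chi> i. max 0 (- n $ i)) $ i = 0) \<noteq> (l $ i - x $ i = 0)"
    "((\<chi> i. max 0 (n $ i)) $ i = 0) \<noteq> (x $ i - u $ i = 0)"
    using assms(1) unfolding strict_complementarity_def by blast+
  then show "x $ i \<noteq> l $ i" "x $ i \<noteq> u $ i" using assms(3) by auto
qed

text \<open>The directions \<open>w\<close> form the critical subspace: the row-space part of the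
  gradient is killed by \<open>A *v w = 0\<close>, the normal part by the support condition.\<close>

lemma kkt_inner_eq_0:
  assumes "kkt x n" "A *v w = 0" "\<And>i. n $ i \<noteq> 0 \<Longrightarrow> w $ i = 0"
  shows "(Q *v x + r) \<bullet> w = 0"
proof -
  obtain y where y: "Q *v x + r + n = y v* A" using assms by (auto simp: kkt_def)
  have "n \<bullet> w = 0" unfolding inner_vec_def using assms(3) by (intro sum.neutral) auto
  moreover have "(Q *v x + r + n) \<bullet> w = 0" unfolding y by (simp add: dot_lmul_matrix assms(2))
  ultimately show ?thesis by (simp add: inner_add_left)
qed

text \<open>The gradients at two KKT points with the same active set are orthogonal to their difference, so \<open>f\<close>
  takes the same value at both.\<close>

lemma finite_f_image_Xstar: "finite (f ` Xstar f A b l u)"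
proof -
  define N where "N x = (SOME n. kkt x n)" for x
  have N: "kkt x (N x)" if "x \<in> Xstar f A b l u" for x
    using that unfolding Xstar_iff_kkt N_def by (rule someI_ex)
  \<comment> \<open>The pattern is the sign pattern of one chosen normal. On its support two points
    with equal pattern sit at the same bound, so their difference is a critical direction for
    both.\<close>
  define pat where "pat x = ({i. N x $ i > 0}, {i. N x $ i < 0})" for x
  have eq: "f x = f x'" if x: "x \<in> Xstar f A b l u" "x' \<in> Xstar f A b l u" and pat: "pat x = pat x'" for x x'
  proof -
    have sgn: "(N x $ i > 0) = (N x' $ i > 0)" "(N x $ i < 0) = (N x' $ i < 0)" for i
      using pat by (auto simp: pat_def set_eq_iff)
    have Ad: "A *v (x' - x) = 0"
      using N[OF x(1)] N[OF x(2)] by (simp add: kkt_def matrix_vector_mult_diff_distrib)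
    have d: "(x' - x) $ i = 0" if "N x $ i \<noteq> 0" for i
      using that sgn[of i] N[OF x(1)] N[OF x(2)] by (auto simp: kkt_def box_normal_def neq_iff)
    have "(Q *v x + r) \<bullet> (x' - x) = 0" "(Q *v x' + r) \<bullet> (x' - x) = 0"
      using d sgn by (auto intro!: kkt_inner_eq_0[OF N[OF x(1)] Ad] kkt_inner_eq_0[OF N[OF x(2)] Ad] simp: neq_iff)
    then show ?thesis using f_trapezoid[of x' x] by (simp only: inner_add_left[of "Q *v x + r"]) simp
  qed
  define h where "h q = f (SOME x. x \<in> Xstar f A b l u \<and> pat x = q)" for q
  have "f x = h (pat x)" if "x \<in> Xstar f A b l u" for x
  proof -
    have "\<exists>x'. x' \<in> Xstar f A b l u \<and> pat x' = pat x" using that by blast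
    from someI_ex[OF this] show ?thesis unfolding h_def by (intro eq that) auto
  qed
  then have "f ` Xstar f A b l u \<subseteq> range h" by auto
  then show ?thesis by (rule finite_subset) simp
qed

lemma continuous_f: "continuous_on S f"
  unfolding f_def
  using linear_continuous_on[OF matrix_vector_mul_bounded_linear, of S Q] by (intro continuous_intros) auto

text \<open>Where \<open>nb $ i = 0\<close>, strict complementarity keeps \<open>xb $ i\<close> off
  both bounds, so nearby points have zero normal there. Where \<open>nb $ i\<close> is nonzero, its
  sign persists and pins the coordinate to the bound at which \<open>xb\<close> already is.\<close>

lemma eventually_kkt_pattern:
  assumes sc: "strict_complementarity f A b l u" and kkt: "kkt xb nb"
    and n: "\<And>k. box_normal l u (xs k) (ns k)" and xs: "xs \<longlonglongrightarrow> xb" and ns: "ns \<longlonglongrightarrow> nb"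
  shows "\<forall>\<^sub>F k in sequentially. \<forall>i. if nb $ i = 0 then ns k $ i = 0 else ns k $ i \<noteq> 0 \<and> xs k $ i = xb $ i"
proof (rule eventually_all_finite)
  fix i
  have xi: "(\<lambda>k. xs k $ i) \<longlonglongrightarrow> xb $ i" and ni: "(\<lambda>k. ns k $ i) \<longlonglongrightarrow> nb $ i"
    using xs ns by (auto intro: tendsto_vec_nth)
  consider "nb $ i = 0" | "nb $ i > 0" | "nb $ i < 0" by linarith
  then show "\<forall>\<^sub>F k in sequentially. if nb $ i = 0 then ns k $ i = 0 else ns k $ i \<noteq> 0 \<and> xs k $ i = xb $ i"
  proof cases
    case 1
    have "\<forall>\<^sub>F k in sequentially. xs k $ i \<noteq> l $ i \<and> xs k $ i \<noteq> u $ i"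
      using tendsto_imp_eventually_ne[OF xi] strict_kkt[OF sc kkt 1] by (auto intro: eventually_conj)
    then show ?thesis
    proof eventually_elim
      case (elim k)
      then have "\<not> 0 < ns k $ i" "\<not> ns k $ i < 0" using n[of k] by (auto simp: box_normal_def)
      then show ?case using 1 by simp
    qed
  next
    case 2
    then have "xb $ i = u $ i" using kkt by (auto simp: kkt_def box_normal_def)
    then show ?thesis
      using order_tendstoD(1)[OF ni 2] n 2 by (auto simp: box_normal_def elim!: eventually_mono)
  next
    case 3
    then have "xb $ i = l $ i" using kkt by (auto simp: kkt_def box_normal_def)
    then show ?thesis
      using order_tendstoD(2)[OF ni 3] n 3 by (auto simp: box_normal_def elim!: eventually_mono)
  qed
qed

text \<open>The perturbed stationary point \<open>x\<close> and the KKT point \<open>xb\<close> differ by a direction \<open>D\<close> in the critical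
  subspace of their common active set, and \<open>f x - f xb = \<langle>e, D\<rangle> / 2\<close>.\<close>

lemma value_error_bound:
  "\<exists>C\<ge>0. \<forall>x n e xb nb. A *v x = b \<longrightarrow> Q *v x + r - e + n \<in> range (\<lambda>y. y v* A) \<longrightarrow> kkt xb nb \<longrightarrow>
     (\<forall>i. if nb $ i = 0 then n $ i = 0 else n $ i \<noteq> 0 \<and> x $ i = xb $ i) \<longrightarrow> f x - f xb \<le> C * (norm e)\<^sup>2"
proof -
  \<comment> \<open>Critical subspaces indexed by the support \<open>N\<close> of the normal. There
    are finitely many, so their constants can be merged into one.\<close>
  define S where "S N = {D. A *v D = 0 \<and> (\<forall>i\<in>N. D $ i = 0)}" for N
  have S: "subspace (S N)" for N
    by (auto simp: S_def subspace_def matrix_vector_right_distrib matrix_vector_mult_scaleR)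
  have "\<forall>N. \<exists>C\<ge>0. \<forall>D\<in>S N. \<forall>e. (\<forall>v\<in>S N. (Q *v D) \<bullet> v = e \<bullet> v) \<longrightarrow> e \<bullet> D \<le> C * (norm e)\<^sup>2"
    using symmetric_form_bound_on_subspace[OF matrix_vector_mul_linear Q_inner S] by blast
  then obtain cN where c0: "\<And>N. cN N \<ge> 0" and
    cN: "\<And>N D e. D \<in> S N \<Longrightarrow> (\<And>v. v \<in> S N \<Longrightarrow> (Q *v D) \<bullet> v = e \<bullet> v) \<Longrightarrow> e \<bullet> D \<le> cN N * (norm e)\<^sup>2"
    by metis
  define C where "C = (\<Sum>N\<in>UNIV. cN N)"
  have C: "cN N \<le> C" for N unfolding C_def using c0 by (intro member_le_sum) auto
  have "f x - f xb \<le> C * (norm e)\<^sup>2"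
    if x: "A *v x = b" and st: "Q *v x + r - e + n \<in> range (\<lambda>y. y v* A)" and xb: "kkt xb nb"
      and pat: "\<forall>i. if nb $ i = 0 then n $ i = 0 else n $ i \<noteq> 0 \<and> x $ i = xb $ i" for x n e xb nb
  proof -
    define N where "N = {i. nb $ i \<noteq> 0}"
    define D where "D = x - xb"
    have D: "D \<in> S N"
      using x xb pat by (auto simp: S_def N_def D_def kkt_def matrix_vector_mult_diff_distrib)
    have gb: "(Q *v xb + r) \<bullet> v = 0" if "v \<in> S N" for v
      using that by (intro kkt_inner_eq_0[OF xb]) (auto simp: S_def N_def)
    have g: "(Q *v x + r) \<bullet> v = e \<bullet> v" if "v \<in> S N" for v
    proof -
      obtain y where y: "Q *v x + r - e + n = y v* A" using st by blast
      have "n $ i * v $ i = 0" for i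
        using pat[rule_format, of i] that by (cases "nb $ i = 0") (auto simp: S_def N_def)
      then have "n \<bullet> v = 0" unfolding inner_vec_def by (intro sum.neutral) auto
      moreover have "(Q *v x + r - e + n) \<bullet> v = 0" unfolding y using that by (simp add: dot_lmul_matrix S_def)
      ultimately show ?thesis by (simp add: inner_add_left inner_diff_left)
    qed
    have "(Q *v D) \<bullet> v = e \<bullet> v" if "v \<in> S N" for v
      using g[OF that] gb[OF that] by (simp add: D_def matrix_vector_mult_diff_distrib inner_diff_left inner_add_left)
    then have "e \<bullet> D \<le> cN N * (norm e)\<^sup>2" by (intro cN D)
    also have "\<dots> \<le> C * (norm e)\<^sup>2" using C by (intro mult_right_mono) auto
    finally have le: "e \<bullet> D \<le> C * (norm e)\<^sup>2" .
    have "f x - f xb = 1 / 2 * ((Q *v xb + r) \<bullet> D + (Q *v x + r) \<bullet> D)"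
      unfolding f_trapezoid[of x xb] D_def by (simp only: inner_add_left[of "Q *v xb + r"])
    also have "\<dots> = 1 / 2 * (e \<bullet> D)" using g[OF D] gb[OF D] by simp
    also have "\<dots> \<le> C * (norm e)\<^sup>2"
      using le mult_nonneg_nonneg[OF order_trans[OF c0 C] zero_le_power2[of "norm e"]] by linarith
    finally show ?thesis .
  qed
  moreover have "C \<ge> 0" using order_trans[OF c0 C] .
  ultimately show ?thesis by blast
qed

lemma tendsto_f_of_infdist:
  assumes C: "C \<subseteq> cbox l u" "C \<noteq> {}" "\<And>w. w \<in> C \<Longrightarrow> f w = v"
    and x: "\<And>t. x t \<in> cbox l u" "(\<lambda>t. infdist (x t) C) \<longlonglongrightarrow> 0"
  shows "(\<lambda>t. f (x t)) \<longlonglongrightarrow> v"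
proof (rule tendstoI)
  fix e :: real assume "e > 0"
  have "uniformly_continuous_on (cbox l u) f"
    by (intro compact_uniformly_continuous continuous_f compact_cbox)
  then obtain \<delta> where \<delta>: "\<delta> > 0"
    "\<And>w w'. w \<in> cbox l u \<Longrightarrow> w' \<in> cbox l u \<Longrightarrow> dist w' w < \<delta> \<Longrightarrow> dist (f w') (f w) < e"
    unfolding uniformly_continuous_on_def using \<open>e > 0\<close> by meson
  show "\<forall>\<^sub>F t in sequentially. dist (f (x t)) v < e"
    using order_tendstoD(2)[OF x(2) \<delta>(1)]
  proof eventually_elim
    case (elim t)
    then obtain w where "w \<in> C" "dist (x t) w < \<delta>"
      using C(2) by (metis bdd_below_image_dist cINF_less_iff infdist_notempty)
    then show ?case using \<delta>(2)[of w "x t"] C x(1) by auto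
  qed
qed

end

text \<open>Expansion of the proximal objective around \<open>xd y z\<close>, with
  \<open>A *v dd = - e\<close> used to cancel \<open>y\<close>. The term
  \<open>n \<bullet> dd\<close> is the only one of first order in \<open>dd\<close> and
  \<open>e\<close>; identification of the active sets removes it.\<close>

lemma (in prox_alm) duality_gap_eq:
  fixes y z
  defines "dd \<equiv> xF z - xd y z" and "e \<equiv> A *v xd y z - b" and "n \<equiv> - gradK \<Gamma> (xd y z) z y"
  shows "M z - d y z = \<Gamma> / 2 * (norm e)\<^sup>2 + 1 / 2 * (hessK 0 dd \<bullet> dd) - n \<bullet> dd"
proof -
  interpret F: strongly_convex_quadratic "Fz z" "gradF z" "hessK 0" "\<gamma> + p" by (rule Fz_quadratic)
  have "gradF z (xd y z) = - n - (y + \<Gamma> *\<^sub>R e) v* A" by (simp add: n_def e_def gradK_eq_gradF)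
  moreover have "((y + \<Gamma> *\<^sub>R e) v* A) \<bullet> dd = - ((y + \<Gamma> *\<^sub>R e) \<bullet> e)"
    using xF_in[of z]
    by (simp only: dot_lmul_matrix dd_def matrix_vector_mult_diff_distrib e_def feasible_def
        mem_Collect_eq inner_diff_right)
  ultimately have "gradF z (xd y z) \<bullet> dd = - (n \<bullet> dd) + y \<bullet> e + \<Gamma> * (norm e)\<^sup>2"
    by (simp only: inner_diff_left inner_minus_left) (simp add: inner_add_left dot_square_norm)
  then show ?thesis
    using F.expand[of "xF z" "xd y z"]
    by (simp add: prox_val_eq dual_val_eq[OF \<Gamma>_nonneg] K_eq_Fz dd_def[symmetric] e_def[symmetric])
qed

section \<open>Convergence of the iterates\<close>

locale prox_alm_run = prox_alm Q r l u x0 A b L \<gamma> p \<delta> \<Gamma> c L_K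
  for Q :: "real^'n^'n" and r l u x0 :: "real^'n" and A :: "real^'n^'m" and b :: "real^'m"
    and L \<gamma> p \<delta> \<Gamma> c L_K :: real +
  fixes \<alpha> \<beta> \<sigma> :: real and x z :: "nat \<Rightarrow> real^'n" and y :: "nat \<Rightarrow> real^'m"
  assumes \<alpha>_pos: "\<alpha> > 0" and \<beta>: "0 < \<beta>" "\<beta> \<le> 1"
    and \<sigma>_nonneg: "\<sigma> \<ge> 0" and \<sigma>: "norm (xF w - xd v w) \<le> \<sigma> * norm (A *v xd v w - b)"
    and \<alpha>_small: "\<alpha> * (onorm ((*v) A) * \<sigma>\<^sub>1)\<^sup>2 \<le> 1 / (4 * c)"
    and \<beta>_small: "2 * p * (p / m) + 2 * p\<^sup>2 * \<sigma>\<^sup>2 / \<alpha> \<le> p / (4 * \<beta>)"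
    and sc: "strict_complementarity f A b l u"
    and run: "prox_ialm f A b l u \<Gamma> p c \<alpha> \<beta> x y z"
begin

lemma y_Suc: "y (Suc t) = y t + \<alpha> *\<^sub>R (A *v x t - b)"
  and x_Suc: "x (Suc t) = proj_step (x t) (z t) (y (Suc t))"
  and z_Suc: "z (Suc t) = z t + \<beta> *\<^sub>R (x (Suc t) - z t)"
  using run by (auto simp: prox_ialm_def grad_K)

lemma x_in: "x t \<in> cbox l u"
  using run by (cases t) (auto simp: prox_ialm_def grad_K proj_step_in)

section \<open>Step lengths, their decay and the nearby minimizers\<close>

definition \<Delta>x :: "nat \<Rightarrow> real" where "\<Delta>x t = norm (x t - x (Suc t))"
definition \<Delta>z :: "nat \<Rightarrow> real" where "\<Delta>z t = norm (z t - z (Suc t))"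
text \<open>The mixed index is intended: \<open>y\<close> is already updated and \<open>z\<close> is
  not, as in the residual left over by \<open>sufficient_descent\<close>.\<close>

definition res :: "nat \<Rightarrow> real" where "res t = norm (A *v xd (y (Suc t)) (z t) - b)"
definition dec :: "nat \<Rightarrow> real" where
  "dec t = 1 / (4 * c) * (\<Delta>x t)\<^sup>2 + p / (4 * \<beta>) * (\<Delta>z t)\<^sup>2 + \<alpha> / 2 * (res t)\<^sup>2"
definition total :: "nat \<Rightarrow> real" where "total t = \<Delta>x t + \<Delta>z t + res t"

lemma nonneg: "0 \<le> \<Delta>x t" "0 \<le> \<Delta>z t" "0 \<le> res t"
  by (simp_all add: \<Delta>x_def \<Delta>z_def res_def)

lemma descent: "dec t \<le> \<phi> (x t) (y t) (z t) - \<phi> (x (Suc t)) (y (Suc t)) (z (Suc t))"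
  unfolding dec_def \<Delta>x_def \<Delta>z_def res_def
  by (rule sufficient_descent[OF x_in y_Suc x_Suc z_Suc \<alpha>_pos \<beta> \<sigma>_nonneg \<sigma> \<alpha>_small \<beta>_small])

lemma total_le_dec: obtains C where "C > 0" "\<And>t. (total t)\<^sup>2 \<le> C * dec t"
proof -
  \<comment> \<open>The three summands invert the weights in \<open>dec\<close>; the factor 3 is
    that of (a + b + c)^2 \<le> 3 (a^2 + b^2 + c^2).\<close>
  define C where "C = 3 * (4 * c + 4 * \<beta> / p + 2 / \<alpha>)"
  have "C > 0" using c_pos \<beta> p_pos \<alpha>_pos by (simp add: C_def add_pos_pos)
  moreover have "(total t)\<^sup>2 \<le> C * dec t" for t
  proof -
    have dec0: "0 \<le> 1 / (4 * c) * (\<Delta>x t)\<^sup>2" "0 \<le> p / (4 * \<beta>) * (\<Delta>z t)\<^sup>2" "0 \<le> \<alpha> / 2 * (res t)\<^sup>2"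
      using c_pos \<beta> p_pos \<alpha>_pos by auto
    have "(\<Delta>x t)\<^sup>2 \<le> 4 * c * dec t" "(\<Delta>z t)\<^sup>2 \<le> 4 * \<beta> / p * dec t" "(res t)\<^sup>2 \<le> 2 / \<alpha> * dec t"
    proof -
      have "4 * c * (1 / (4 * c) * (\<Delta>x t)\<^sup>2) \<le> 4 * c * dec t"
        using dec0 c_pos by (intro mult_left_mono) (auto simp: dec_def)
      then show "(\<Delta>x t)\<^sup>2 \<le> 4 * c * dec t" using c_pos by simp
      have "4 * \<beta> / p * (p / (4 * \<beta>) * (\<Delta>z t)\<^sup>2) \<le> 4 * \<beta> / p * dec t"
        using dec0 \<beta> p_pos by (intro mult_left_mono) (auto simp: dec_def)
      then show "(\<Delta>z t)\<^sup>2 \<le> 4 * \<beta> / p * dec t" using \<beta> p_pos by simp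
      have "2 / \<alpha> * (\<alpha> / 2 * (res t)\<^sup>2) \<le> 2 / \<alpha> * dec t"
        using dec0 \<alpha>_pos by (intro mult_left_mono) (auto simp: dec_def)
      then show "(res t)\<^sup>2 \<le> 2 / \<alpha> * dec t" using \<alpha>_pos by simp
    qed
    then have "3 * ((\<Delta>x t)\<^sup>2 + (\<Delta>z t)\<^sup>2 + (res t)\<^sup>2)
        \<le> 3 * (4 * c * dec t + 4 * \<beta> / p * dec t + 2 / \<alpha> * dec t)"
      by (intro mult_left_mono add_mono) auto
    moreover have "(total t)\<^sup>2 \<le> 3 * ((\<Delta>x t)\<^sup>2 + (\<Delta>z t)\<^sup>2 + (res t)\<^sup>2)"
    proof -
      have "3 * ((\<Delta>x t)\<^sup>2 + (\<Delta>z t)\<^sup>2 + (res t)\<^sup>2) - (total t)\<^sup>2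
          = (\<Delta>x t - \<Delta>z t)\<^sup>2 + (\<Delta>x t - res t)\<^sup>2 + (\<Delta>z t - res t)\<^sup>2"
        by (simp add: total_def power2_eq_square algebra_simps)
      also have "\<dots> \<ge> 0" by simp
      finally show ?thesis by simp
    qed
    ultimately have "(total t)\<^sup>2 \<le> 3 * (4 * c * dec t + 4 * \<beta> / p * dec t + 2 / \<alpha> * dec t)" by (rule order_trans[rotated])
    then show ?thesis by (simp add: C_def distrib_right)
  qed
  ultimately show thesis by (rule that)
qed

lemma total_tendsto_0: "total \<longlonglongrightarrow> 0"
proof -
  define \<psi> where "\<psi> t = \<phi> (x t) (y t) (z t)" for t
  obtain C where C: "C > 0" "\<And>t. (total t)\<^sup>2 \<le> C * dec t" by (rule total_le_dec) blast
  have dec: "0 \<le> dec t" "dec t \<le> \<psi> t - \<psi> (Suc t)" for t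
    using c_pos \<beta> p_pos \<alpha>_pos descent[of t] by (auto simp: dec_def \<psi>_def intro!: add_nonneg_nonneg)
  have "decseq \<psi>" unfolding decseq_Suc_iff using dec order_trans[of 0 "dec _"] by (metis diff_ge_0_iff_ge)
  moreover obtain B where "\<And>t. B \<le> \<psi> t" using \<phi>_lower_bound x_in unfolding \<psi>_def by metis
  ultimately obtain L where L: "\<psi> \<longlonglongrightarrow> L" using decseq_convergent by blast
  then have "(\<lambda>t. \<psi> t - \<psi> (Suc t)) \<longlonglongrightarrow> L - L" by (intro tendsto_diff) (simp_all add: LIMSEQ_Suc)
  then have "(\<lambda>t. sqrt (C * (\<psi> t - \<psi> (Suc t)))) \<longlonglongrightarrow> 0"
    using tendsto_real_sqrt[OF tendsto_mult_right_zero, of "\<lambda>t. \<psi> t - \<psi> (Suc t)" sequentially C] by simp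
  moreover have "total t \<le> sqrt (C * (\<psi> t - \<psi> (Suc t)))" for t
    using C(2)[of t] mult_left_mono[OF dec(2), of C t] C(1) by (intro real_le_rsqrt) linarith
  moreover have "0 \<le> total t" for t using nonneg[of t] by (simp add: total_def)
  ultimately show ?thesis
    by (intro Lim_null_comparison[OF always_eventually, of total]) auto
qed

text \<open>\<open>xp\<close> and \<open>xa\<close> are the minimizers of the proximal problem and
  of the augmented Lagrangian. Both are formed from the iterates \<open>Suc t\<close> but indexed by
  \<open>t\<close>, to match \<open>total t\<close>.\<close>

definition xp :: "nat \<Rightarrow> real^'n" where "xp t = xF (z (Suc t))"
definition xa :: "nat \<Rightarrow> real^'n" where "xa t = xd (y (Suc t)) (z (Suc t))"
definition na :: "nat \<Rightarrow> real^'n" where "na t = - gradK \<Gamma> (xa t) (z (Suc t)) (y (Suc t))"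

text \<open>The residual in \<open>total t\<close> belongs to \<open>z t\<close>; the Lipschitz
  bound for \<open>xd\<close> carries it over to \<open>z (Suc t)\<close>, and the two error bounds
  do the rest. Distances are of first order in \<open>total\<close>, the gap \<open>K - d\<close> of
  second order.\<close>

lemma distances_le_total:
  obtains C where "C > 0" "\<And>t. norm (A *v xa t - b) \<le> C * total t" "\<And>t. norm (xp t - xa t) \<le> C * total t"
    "\<And>t. norm (xa t - x (Suc t)) \<le> C * total t" "\<And>t. norm (x (Suc t) - z (Suc t)) \<le> C * total t"
    "\<And>t. K \<Gamma> (x (Suc t)) (z (Suc t)) (y (Suc t)) - d (y (Suc t)) (z (Suc t)) \<le> C * (total t)\<^sup>2"
proof -
  define C1 where "C1 = 1 + onorm ((*v) A) * (p / m)"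
  define C2 where "C2 = L_K + 1 / c + p"
  have "C1 > 0" using onorm_A_nonneg p_pos m_pos by (simp add: C1_def add_pos_nonneg)
  moreover have "C2 > 0" using L_K_pos c_pos p_pos by (simp add: C2_def add_pos_pos)
  ultimately have pos: "C1 > 0" "C2 > 0" "C2 / m \<ge> 0" "C2\<^sup>2 / m \<ge> 0" "1 / \<beta> \<ge> 0" "\<sigma> * C1 \<ge> 0"
    using m_pos \<beta> \<sigma>_nonneg by auto
  have tot: "\<Delta>x t \<le> total t" "\<Delta>z t \<le> total t" "res t \<le> total t" "0 \<le> total t" for t
    using nonneg[of t] by (auto simp: total_def)
  have 1: "norm (A *v xa t - b) \<le> C1 * total t" for t
  proof -
    have "A *v xa t - b = (A *v xd (y (Suc t)) (z t) - b) + A *v (xa t - xd (y (Suc t)) (z t))"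
      by (simp add: matrix_vector_mult_diff_distrib)
    then have "norm (A *v xa t - b) \<le> res t + norm (A *v (xa t - xd (y (Suc t)) (z t)))"
      unfolding res_def by (metis norm_triangle_ineq)
    also have "norm (A *v (xa t - xd (y (Suc t)) (z t))) \<le> onorm ((*v) A) * (p / m * \<Delta>z t)"
      using xd_lipschitz[of "y (Suc t)" "z (Suc t)" "z t"] onorm_A_nonneg
      by (intro order_trans[OF norm_A] mult_left_mono) (auto simp: xa_def \<Delta>z_def norm_minus_commute)
    also have "onorm ((*v) A) * (p / m * \<Delta>z t) \<le> onorm ((*v) A) * (p / m * total t)"
      using onorm_A_nonneg p_pos m_pos tot by (intro mult_left_mono) auto
    finally show ?thesis using tot(3)[of t] by (simp add: C1_def algebra_simps)
  qed
  have 2: "norm (xp t - xa t) \<le> \<sigma> * C1 * total t" for t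
    using \<sigma>[of "z (Suc t)" "y (Suc t)"] mult_left_mono[OF 1[of t] \<sigma>_nonneg] by (simp add: xp_def xa_def mult.assoc)
  define \<rho> where "\<rho> t = (L_K + 1 / c) * \<Delta>x t + p * \<Delta>z t" for t
  have \<rho>: "\<rho> t \<le> C2 * total t" "0 \<le> \<rho> t" for t
  proof -
    have "\<rho> t \<le> (L_K + 1 / c) * total t + p * total t"
      unfolding \<rho>_def using tot L_K_pos c_pos p_pos by (intro add_mono mult_left_mono) auto
    then show "\<rho> t \<le> C2 * total t" by (simp add: C2_def distrib_right)
    show "0 \<le> \<rho> t" unfolding \<rho>_def using nonneg L_K_pos c_pos p_pos by auto
  qed
  have 3: "norm (xa t - x (Suc t)) \<le> C2 / m * total t" for t
  proof -
    have "m * norm (x (Suc t) - xa t) \<le> \<rho> t"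
      using proj_step_residual(1)[of "x t" "z t" "y (Suc t)" "z (Suc t)"]
      by (simp add: \<rho>_def xa_def \<Delta>x_def \<Delta>z_def x_Suc[symmetric] norm_minus_commute)
    then have "m * norm (x (Suc t) - xa t) \<le> C2 * total t" using \<rho>(1) order_trans by blast
    then show ?thesis using m_pos by (simp add: field_simps norm_minus_commute)
  qed
  have 4: "norm (x (Suc t) - z (Suc t)) \<le> 1 / \<beta> * total t" for t
  proof -
    have "z t - z (Suc t) = (- \<beta>) *\<^sub>R (x (Suc t) - z t)" by (simp add: z_Suc)
    then have dz: "\<Delta>z t = \<beta> * norm (x (Suc t) - z t)" using \<beta> by (simp only: \<Delta>z_def norm_scaleR)
    have "x (Suc t) - z (Suc t) = (1 - \<beta>) *\<^sub>R (x (Suc t) - z t)" by (simp add: z_Suc algebra_simps)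
    then have "norm (x (Suc t) - z (Suc t)) = (1 - \<beta>) * norm (x (Suc t) - z t)" using \<beta> by simp
    also have "\<dots> \<le> norm (x (Suc t) - z t)" using \<beta> by (intro mult_left_le_one_le) auto
    also have "\<dots> = 1 / \<beta> * \<Delta>z t" using \<beta> by (simp add: dz)
    also have "\<dots> \<le> 1 / \<beta> * total t" using tot \<beta> by (intro mult_left_mono) auto
    finally show ?thesis .
  qed
  have 5: "K \<Gamma> (x (Suc t)) (z (Suc t)) (y (Suc t)) - d (y (Suc t)) (z (Suc t)) \<le> C2\<^sup>2 / m * (total t)\<^sup>2" for t
  proof -
    have "K \<Gamma> (x (Suc t)) (z (Suc t)) (y (Suc t)) - d (y (Suc t)) (z (Suc t)) \<le> (\<rho> t)\<^sup>2 / m"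
      using proj_step_residual(2)[of "x t" "z t" "y (Suc t)" "z (Suc t)"]
      by (simp add: \<rho>_def \<Delta>x_def \<Delta>z_def x_Suc[symmetric] norm_minus_commute)
    also have "\<dots> \<le> (C2 * total t)\<^sup>2 / m"
      using \<rho> m_pos by (intro divide_right_mono power_mono) auto
    finally show ?thesis by (simp add: power_mult_distrib)
  qed
  define C where "C = C1 + \<sigma> * C1 + C2 / m + 1 / \<beta> + C2\<^sup>2 / m"
  have le: "C1 * w \<le> C * w" "\<sigma> * C1 * w \<le> C * w" "C2 / m * w \<le> C * w" "1 / \<beta> * w \<le> C * w" "C2\<^sup>2 / m * w \<le> C * w"
    if "w \<ge> 0" for w
  proof -
    have "C1 \<le> C" "\<sigma> * C1 \<le> C" "C2 / m \<le> C" "1 / \<beta> \<le> C" "C2\<^sup>2 / m \<le> C"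
      using pos unfolding C_def by linarith+
    from this[THEN mult_right_mono, OF that] show "C1 * w \<le> C * w" "\<sigma> * C1 * w \<le> C * w"
      "C2 / m * w \<le> C * w" "1 / \<beta> * w \<le> C * w" "C2\<^sup>2 / m * w \<le> C * w" .
  qed
  have "C > 0" using pos unfolding C_def by linarith
  then show thesis
    by (rule that[OF _ order_trans[OF 1 le(1)[OF tot(4)]] order_trans[OF 2 le(2)[OF tot(4)]]
          order_trans[OF 3 le(3)[OF tot(4)]] order_trans[OF 4 le(4)[OF tot(4)]]
          order_trans[OF 5 le(5)[OF zero_le_power2]]])
qed

lemma limits:
  shows "(\<lambda>t. A *v xa t - b) \<longlonglongrightarrow> 0" "(\<lambda>t. xp t - x (Suc t)) \<longlonglongrightarrow> 0" "(\<lambda>t. xa t - x (Suc t)) \<longlonglongrightarrow> 0"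
    "(\<lambda>t. x t - z t) \<longlonglongrightarrow> 0" "(\<lambda>t. x (Suc t) - x t) \<longlonglongrightarrow> 0"
proof -
  obtain C where C: "C > 0" "\<And>t. norm (A *v xa t - b) \<le> C * total t" "\<And>t. norm (xp t - xa t) \<le> C * total t"
    "\<And>t. norm (xa t - x (Suc t)) \<le> C * total t" "\<And>t. norm (x (Suc t) - z (Suc t)) \<le> C * total t"
    using distances_le_total by metis
  have t0: "(\<lambda>t. C * total t) \<longlonglongrightarrow> 0" using tendsto_mult_right_zero[OF total_tendsto_0] .
  note null = Lim_null_comparison[OF always_eventually t0]
  show "(\<lambda>t. A *v xa t - b) \<longlonglongrightarrow> 0" and a: "(\<lambda>t. xa t - x (Suc t)) \<longlonglongrightarrow> 0"
    by (rule null, simp add: C)+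
  have "(\<lambda>t. xp t - xa t) \<longlonglongrightarrow> 0" by (rule null) (simp add: C)
  from tendsto_add[OF this a] show "(\<lambda>t. xp t - x (Suc t)) \<longlonglongrightarrow> 0" by simp
  have "(\<lambda>t. x (Suc t) - z (Suc t)) \<longlonglongrightarrow> 0" by (rule null) (simp add: C)
  then show "(\<lambda>t. x t - z t) \<longlonglongrightarrow> 0" by (rule LIMSEQ_imp_Suc)
  show "(\<lambda>t. x (Suc t) - x t) \<longlonglongrightarrow> 0"
    by (rule Lim_null_comparison[OF always_eventually total_tendsto_0])
      (use nonneg in \<open>auto simp: total_def \<Delta>x_def norm_minus_commute\<close>)
qed

lemma xa_normal: "box_normal l u (xa t) (na t)"
  unfolding xa_def na_def by (rule xK_normal[OF \<Gamma>_nonneg])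

lemma xa_in: "xa t \<in> cbox l u"
  unfolding xa_def by (rule xK_in[OF \<Gamma>_nonneg])

lemma xp_feasible: "xp t \<in> cbox l u" "A *v xp t = b"
  using xF_in[of "z (Suc t)"] by (auto simp: xp_def feasible_def)

lemma xa_stationary: "Q *v xa t + (r + p *\<^sub>R (xa t - z (Suc t))) + na t \<in> range (\<lambda>y. y v* A)"
proof -
  have "Q *v xa t + (r + p *\<^sub>R (xa t - z (Suc t))) + na t = (- (y (Suc t) + \<Gamma> *\<^sub>R (A *v xa t - b))) v* A"
    by (simp add: na_def gradK_eq_gradF gradF_def vector_matrix_mult_minus algebra_simps)
  then show ?thesis by blast
qed

text \<open>Normals at \<open>xp t\<close> need not be unique, so one is chosen; \<open>na\<close>,
  by contrast, is an explicit gradient.\<close>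

definition np :: "nat \<Rightarrow> real^'n" where
  "np t = (SOME n. box_normal l u (xp t) n \<and> gradF (z (Suc t)) (xp t) + n \<in> range (\<lambda>y. y v* A))"

lemma xp_normal: "box_normal l u (xp t) (np t)"
  and xp_stationary: "Q *v xp t + (r + p *\<^sub>R (xp t - z (Suc t))) + np t \<in> range (\<lambda>y. y v* A)"
proof -
  have "\<exists>n. box_normal l u (xp t) n \<and> gradF (z (Suc t)) (xp t) + n \<in> range (\<lambda>y. y v* A)"
    unfolding xp_def by (rule xF_multiplier[of "z (Suc t)"]) blast
  from someI_ex[OF this, folded np_def]
  show "box_normal l u (xp t) (np t)"
    "Q *v xp t + (r + p *\<^sub>R (xp t - z (Suc t))) + np t \<in> range (\<lambda>y. y v* A)"
    by (auto simp: gradF_def add.assoc)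
qed

text \<open>The proximal term vanishes along the run, so the perturbation
  \<open>r + p *\<^sub>R (w - z)\<close> tends to \<open>r\<close> for \<open>w = xp\<close> and for
  \<open>w = xa\<close>. Two successive extractions give limits, which agree because both sequences
  are asymptotic to \<open>x (Suc t)\<close>. The limiting normals may differ.\<close>

lemma common_kkt_limit:
  assumes "strict_mono (s :: nat \<Rightarrow> nat)"
  obtains s' :: "nat \<Rightarrow> nat" and xb nb nb' where "strict_mono s'"
    "(\<lambda>k. x (Suc (s (s' k)))) \<longlonglongrightarrow> xb" "(\<lambda>k. xp (s (s' k))) \<longlonglongrightarrow> xb" "(\<lambda>k. xa (s (s' k))) \<longlonglongrightarrow> xb"
    "(\<lambda>k. np (s (s' k))) \<longlonglongrightarrow> nb" "(\<lambda>k. na (s (s' k))) \<longlonglongrightarrow> nb'" "kkt xb nb" "kkt xb nb'"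
proof -
  have sub: "(\<lambda>k. v (\<tau> k)) \<longlonglongrightarrow> w" if "v \<longlonglongrightarrow> w" "strict_mono \<tau>" for v :: "nat \<Rightarrow> 'b::topological_space" and \<tau> w
    using LIMSEQ_subseq_LIMSEQ[OF that] by (simp add: o_def)
  have xz: "(\<lambda>t. x (Suc t) - z (Suc t)) \<longlonglongrightarrow> 0" using LIMSEQ_Suc[OF limits(4)] .
  have e: "(\<lambda>t. r + p *\<^sub>R (w t - z (Suc t))) \<longlonglongrightarrow> r" if "(\<lambda>t. w t - x (Suc t)) \<longlonglongrightarrow> 0" for w
    using tendsto_add[OF tendsto_const tendsto_scaleR[OF tendsto_const tendsto_add[OF that xz]], of r p] by simp
  obtain s1 xb nb where s1: "strict_mono s1" "((\<lambda>k. xp (s k)) \<circ> s1) \<longlonglongrightarrow> xb" "((\<lambda>k. np (s k)) \<circ> s1) \<longlonglongrightarrow> nb"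
    and nb: "xb \<in> cbox l u" "A *v xb = b" "box_normal l u xb nb" "Q *v xb + r + nb \<in> range (\<lambda>y. y v* A)"
    by (rule perturbed_kkt_limit[OF \<delta>_pos ball x0 matrix_vector_mul_bounded_linear, of "\<lambda>k. xp (s k)" "\<lambda>k. np (s k)" Q
        "\<lambda>k. r + p *\<^sub>R (xp (s k) - z (Suc (s k)))" r])
      (auto simp: xp_feasible xp_normal xp_stationary intro: sub[OF e[OF limits(2)] assms])
  define s2 where "s2 = s \<circ> s1"
  have s2: "strict_mono s2" unfolding s2_def by (intro strict_mono_o assms s1)
  obtain s3 xb' nb' where s3: "strict_mono s3" "((\<lambda>k. xa (s2 k)) \<circ> s3) \<longlonglongrightarrow> xb'" "((\<lambda>k. na (s2 k)) \<circ> s3) \<longlonglongrightarrow> nb'"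
    and nb': "xb' \<in> cbox l u" "A *v xb' = b" "box_normal l u xb' nb'" "Q *v xb' + r + nb' \<in> range (\<lambda>y. y v* A)"
    by (rule perturbed_kkt_limit[OF \<delta>_pos ball x0 matrix_vector_mul_bounded_linear, of "\<lambda>k. xa (s2 k)" "\<lambda>k. na (s2 k)" Q
        "\<lambda>k. r + p *\<^sub>R (xa (s2 k) - z (Suc (s2 k)))" r])
      (auto simp: xa_in xa_normal xa_stationary intro: sub[OF e[OF limits(3)] s2] sub[OF limits(1) s2])
  define \<tau> where "\<tau> k = s (s1 (s3 k))" for k
  have \<tau>: "strict_mono \<tau>" unfolding \<tau>_def using assms s1(1) s3(1) by (simp add: strict_mono_def)
  have xp: "(\<lambda>k. xp (\<tau> k)) \<longlonglongrightarrow> xb" "(\<lambda>k. np (\<tau> k)) \<longlonglongrightarrow> nb"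
    using sub[OF s1(2) s3(1)] sub[OF s1(3) s3(1)] by (simp_all add: \<tau>_def)
  have xa: "(\<lambda>k. xa (\<tau> k)) \<longlonglongrightarrow> xb'" "(\<lambda>k. na (\<tau> k)) \<longlonglongrightarrow> nb'"
    using s3 by (simp_all add: \<tau>_def s2_def o_def)
  have x: "(\<lambda>k. x (Suc (\<tau> k))) \<longlonglongrightarrow> xb"
    using tendsto_diff[OF xp(1) sub[OF limits(2) \<tau>]] by simp
  have "(\<lambda>k. x (Suc (\<tau> k))) \<longlonglongrightarrow> xb'"
    using tendsto_diff[OF xa(1) sub[OF limits(3) \<tau>]] by simp
  then have "xb' = xb" using x LIMSEQ_unique by blast
  then show thesis
    using that[of "s1 \<circ> s3" xb nb nb'] x xp xa nb nb' strict_mono_o[OF s1(1) s3(1)]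
    by (simp add: \<tau>_def kkt_def)
qed

lemma cluster_points_subset_Xstar: "cluster_points x \<subseteq> Xstar f A b l u"
proof
  fix w assume "w \<in> cluster_points x"
  then obtain s where s: "strict_mono s" "(x \<circ> s) \<longlonglongrightarrow> w" by (rule cluster_points_subseqE)
  obtain s' xb nb where s': "strict_mono s'" "(\<lambda>k. x (Suc (s (s' k)))) \<longlonglongrightarrow> xb" "kkt xb nb"
    using common_kkt_limit[OF s(1)] by metis
  have ss: "strict_mono (s \<circ> s')" by (intro strict_mono_o s s')
  have "(\<lambda>k. x (Suc (s (s' k))) - (x (Suc (s (s' k))) - x (s (s' k)))) \<longlonglongrightarrow> xb - 0"
    using LIMSEQ_subseq_LIMSEQ[OF limits(5) ss] s'(2) by (intro tendsto_diff) (auto simp: o_def)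
  moreover have "(\<lambda>k. x (s (s' k))) \<longlonglongrightarrow> w"
    using LIMSEQ_subseq_LIMSEQ[OF s(2) s'(1)] by (simp add: o_def)
  ultimately have "w = xb" using LIMSEQ_unique by auto
  then show "w \<in> Xstar f A b l u" using s'(3) Xstar_iff_kkt by blast
qed

text \<open>This justifies the definite description behind \<open>fstar\<close>. Existence: the
  connected set of cluster points lies in one component. Uniqueness: every admissible value is the
  limit of \<open>f (x t)\<close>.\<close>

lemma f_tendsto_fstar: "(\<lambda>t. f (x t)) \<longlonglongrightarrow> fstar f A b l u x z"
proof -
  let ?P = "\<lambda>v. \<exists>C\<in>components (Xstar f A b l u).
        (\<lambda>t. infdist (x t) C) \<longlonglongrightarrow> 0 \<and> (\<lambda>t. infdist (z t) C) \<longlonglongrightarrow> 0 \<and> (\<forall>w\<in>C. f w = v)"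
  have lim: "(\<lambda>t. f (x t)) \<longlonglongrightarrow> v" if P: "?P v" for v
  proof -
    obtain C where C: "C \<in> components (Xstar f A b l u)" "(\<lambda>t. infdist (x t) C) \<longlonglongrightarrow> 0" "\<forall>w\<in>C. f w = v"
      using P by blast
    have "C \<subseteq> cbox l u" "C \<noteq> {}"
      using in_components_subset[OF C(1)] in_components_nonempty[OF C(1)] Xstar_subset by auto
    then show ?thesis using C x_in by (intro tendsto_f_of_infdist) auto
  qed
  have bdd: "bounded (range x)" using x_in by (intro bounded_subset[OF bounded_cbox[of l u]]) auto
  have step: "(\<lambda>t. dist (x (Suc t)) (x t)) \<longlonglongrightarrow> 0"
    using tendsto_norm_zero[OF limits(5)] by (simp add: dist_norm)
  have "Xstar f A b l u \<noteq> {}"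
    using cluster_points_subset_Xstar infdist_cluster_points_tendsto_0(2)[OF bdd] by blast
  then obtain C where C: "C \<in> components (Xstar f A b l u)" "cluster_points x \<subseteq> C"
    using exists_component_superset[OF cluster_points_subset_Xstar _ connected_cluster_points[OF bdd step]]
    by blast
  have x0: "(\<lambda>t. infdist (x t) C) \<longlonglongrightarrow> 0"
  proof (rule tendsto_sandwich[OF _ _ tendsto_const infdist_cluster_points_tendsto_0(1)[OF bdd]])
    show "\<forall>\<^sub>F t in sequentially. infdist (x t) C \<le> infdist (x t) (cluster_points x)"
      using infdist_mono[OF C(2)] infdist_cluster_points_tendsto_0(2)[OF bdd] by (intro always_eventually) auto
  qed (simp add: infdist_nonneg)
  have z0: "(\<lambda>t. infdist (z t) C) \<longlonglongrightarrow> 0"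
  proof (rule tendsto_sandwich[OF _ _ tendsto_const])
    show "(\<lambda>t. infdist (x t) C + norm (x t - z t)) \<longlonglongrightarrow> 0"
      using tendsto_add[OF x0 tendsto_norm_zero[OF limits(4)]] by simp
    show "\<forall>\<^sub>F t in sequentially. infdist (z t) C \<le> infdist (x t) C + norm (x t - z t)"
      by (intro always_eventually allI) (metis dist_commute dist_norm infdist_triangle)
  qed (simp add: infdist_nonneg)
  \<comment> \<open>A continuous function with finite image is constant on a connected set.\<close>
  have "f constant_on C"
    using finite_subset[OF image_mono[OF in_components_subset[OF C(1)]] finite_f_image_Xstar]
    by (intro continuous_finite_range_constant continuous_f in_components_connected[OF C(1)])
  then obtain v where v: "\<forall>w\<in>C. f w = v" by (auto simp: constant_on_def)
  then have "?P v" using C(1) x0 z0 by blast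
  moreover have "v' = v" if "?P v'" for v' using lim[OF that] lim[OF \<open>?P v\<close>] LIMSEQ_unique by blast
  ultimately have "?P (fstar f A b l u x z)" unfolding fstar_def by (rule theI)
  then show ?thesis by (rule lim)
qed

text \<open>Along any subsequence both \<open>(xp, np)\<close> and \<open>(xa, na)\<close> accumulate at KKT pairs with the same point,
  whose active set is, by strict complementarity, eventually the active set of \<open>xp\<close> and \<open>xa\<close>.\<close>

lemma eventually_identified:
  "\<forall>\<^sub>F t in sequentially. na t \<bullet> (xp t - xa t) = 0 \<and>
     (\<exists>xb nb. kkt xb nb \<and> f xb = fstar f A b l u x z \<and>
       (\<forall>i. if nb $ i = 0 then np t $ i = 0 else np t $ i \<noteq> 0 \<and> xp t $ i = xb $ i))"
    (is "eventually ?P _")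
proof (rule ccontr)
  assume "\<not> eventually ?P sequentially"
  then have "infinite {t. \<not> ?P t}"
    by (simp only: not_eventually frequently_cofinite flip: cofinite_eq_sequentially) simp
  from infinite_enumerate[OF this]
  obtain s :: "nat \<Rightarrow> nat" where s: "strict_mono s" "\<forall>k. s k \<in> {t. \<not> ?P t}" by blast
  obtain s' xb nb nb' where s': "strict_mono s'"
    "(\<lambda>k. x (Suc (s (s' k)))) \<longlonglongrightarrow> xb" "(\<lambda>k. xp (s (s' k))) \<longlonglongrightarrow> xb" "(\<lambda>k. xa (s (s' k))) \<longlonglongrightarrow> xb"
    "(\<lambda>k. np (s (s' k))) \<longlonglongrightarrow> nb" "(\<lambda>k. na (s (s' k))) \<longlonglongrightarrow> nb'" "kkt xb nb" "kkt xb nb'"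
    by (rule common_kkt_limit[OF s(1)]) blast
  have "(\<lambda>k. f (x (Suc (s (s' k))))) \<longlonglongrightarrow> f xb"
    using continuous_on_tendsto_compose[OF continuous_f[of UNIV] s'(2)] by simp
  moreover have "(\<lambda>k. f (x (Suc (s (s' k))))) \<longlonglongrightarrow> fstar f A b l u x z"
    using LIMSEQ_subseq_LIMSEQ[OF LIMSEQ_Suc[OF f_tendsto_fstar] strict_mono_o[OF s(1) s'(1)]] by (simp add: o_def)
  ultimately have fxb: "f xb = fstar f A b l u x z" using LIMSEQ_unique by blast
  \<comment> \<open>Both normals belong to the same point \<open>xb\<close>, so by strict
    complementarity the support of \<open>nb'\<close> lies in that of \<open>nb\<close>. On it
    \<open>xp\<close> and \<open>xa\<close> both agree with \<open>xb\<close>; off it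
    \<open>na\<close> vanishes. Hence the inner product is zero.\<close>
  have same: "nb' $ i \<noteq> 0 \<Longrightarrow> nb $ i \<noteq> 0" for i
  proof (rule notI)
    assume "nb' $ i \<noteq> 0" "nb $ i = 0"
    moreover have "0 < nb' $ i \<longrightarrow> xb $ i = u $ i" "nb' $ i < 0 \<longrightarrow> xb $ i = l $ i"
      using s'(8) by (auto simp: kkt_def box_normal_def)
    ultimately show False using strict_kkt[OF sc s'(7), of i] by linarith
  qed
  have "\<forall>\<^sub>F k in sequentially. ?P (s (s' k))"
    using eventually_kkt_pattern[OF sc s'(7) xp_normal s'(3,5)]
      eventually_kkt_pattern[OF sc s'(8) xa_normal s'(4,6)]
  proof eventually_elim
    case (elim k)
    have "na (s (s' k)) $ i * (xp (s (s' k)) - xa (s (s' k))) $ i = 0" for i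
      using elim(1)[rule_format, of i] elim(2)[rule_format, of i] same[of i]
      by (cases "nb' $ i = 0") auto
    then have "na (s (s' k)) \<bullet> (xp (s (s' k)) - xa (s (s' k))) = 0"
      unfolding inner_vec_def by (intro sum.neutral) auto
    then show ?case using elim(1) fxb s'(7) by blast
  qed
  then obtain k where "?P (s (s' k))" using eventually_happens'[OF sequentially_bot] by blast
  then show False using s(2) by blast
qed

section \<open>Bounding the potential by the step lengths\<close>

lemma potential_eq:
  "potential f A b l u \<Gamma> p x y z t (z t) = \<phi> (x t) (y t) (z t) - fstar f A b l u x z"
  by (simp add: potential_def \<phi>_def)

lemma eventually_potential_le:
  obtains C where "C > 0"
    "\<forall>\<^sub>F t in sequentially. potential f A b l u \<Gamma> p x y z (Suc t) (z (Suc t)) \<le> C * (total t)\<^sup>2"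
proof -
  obtain C where C: "C > 0" "\<And>t. norm (A *v xa t - b) \<le> C * total t" "\<And>t. norm (xp t - xa t) \<le> C * total t"
    "\<And>t. norm (xa t - x (Suc t)) \<le> C * total t" "\<And>t. norm (x (Suc t) - z (Suc t)) \<le> C * total t"
    "\<And>t. K \<Gamma> (x (Suc t)) (z (Suc t)) (y (Suc t)) - d (y (Suc t)) (z (Suc t)) \<le> C * (total t)\<^sup>2"
    using distances_le_total by metis
  obtain B where B: "B \<ge> 0" "\<And>x n e xb nb. A *v x = b \<Longrightarrow> Q *v x + r - e + n \<in> range (\<lambda>y. y v* A) \<Longrightarrow> kkt xb nb \<Longrightarrow>
     (\<forall>i. if nb $ i = 0 then n $ i = 0 else n $ i \<noteq> 0 \<and> x $ i = xb $ i) \<Longrightarrow> f x - f xb \<le> B * (norm e)\<^sup>2"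
    using value_error_bound by blast
  \<comment> \<open>The three groups bound \<open>K - d\<close>, \<open>M - d\<close> and
    \<open>M - f*\<close>; \<open>3 * C\<close> comes from reaching \<open>z (Suc t)\<close> from
    \<open>xp t\<close> via \<open>xa t\<close> and \<open>x (Suc t)\<close>.\<close>
  define C' where "C' = C + (\<Gamma> / 2 * C\<^sup>2 + 1 / 2 * ((L + p) * C\<^sup>2)) + (B * p\<^sup>2 + p / 2) * (3 * C)\<^sup>2"
  have "C' > 0"
    unfolding C'_def using C(1) B(1) \<Gamma>_pos L_pos p_pos by (intro add_pos_nonneg) auto
  have sq: "w\<^sup>2 \<le> D\<^sup>2 * (total t)\<^sup>2" if "0 \<le> w" "w \<le> D * total t" for w D t
    using power_mono[OF that(2,1), of 2] by (simp add: power_mult_distrib)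
  have "\<forall>\<^sub>F t in sequentially. potential f A b l u \<Gamma> p x y z (Suc t) (z (Suc t)) \<le> C' * (total t)\<^sup>2"
    using eventually_identified
  proof eventually_elim
    case (elim t)
    define T where "T = (total t)\<^sup>2"
    obtain xb nb where xb: "kkt xb nb" "f xb = fstar f A b l u x z"
      "\<forall>i. if nb $ i = 0 then np t $ i = 0 else np t $ i \<noteq> 0 \<and> xp t $ i = xb $ i"
      using elim by blast
    have gap: "M (z (Suc t)) - d (y (Suc t)) (z (Suc t)) \<le> (\<Gamma> / 2 * C\<^sup>2 + 1 / 2 * ((L + p) * C\<^sup>2)) * T"
    proof -
      let ?D = "xp t - xa t"
      have "hessK 0 ?D \<bullet> ?D \<le> norm (hessK 0 ?D) * norm ?D" by (rule norm_cauchy_schwarz)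
      also have "\<dots> \<le> ((L + p) * norm ?D) * norm ?D" using hess0_norm by (intro mult_right_mono) auto
      also have "\<dots> = (L + p) * (norm ?D)\<^sup>2" by (simp add: power2_eq_square)
      also have "\<dots> \<le> (L + p) * (C\<^sup>2 * T)"
        unfolding T_def using L_pos p_pos C(3) by (intro mult_left_mono sq) auto
      finally have h: "hessK 0 ?D \<bullet> ?D \<le> (L + p) * (C\<^sup>2 * T)" .
      have e: "\<Gamma> / 2 * (norm (A *v xa t - b))\<^sup>2 \<le> \<Gamma> / 2 * (C\<^sup>2 * T)"
        unfolding T_def using \<Gamma>_pos C(2) by (intro mult_left_mono sq) auto
      have "M (z (Suc t)) - d (y (Suc t)) (z (Suc t))
          = \<Gamma> / 2 * (norm (A *v xa t - b))\<^sup>2 + 1 / 2 * (hessK 0 ?D \<bullet> ?D)"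
        using duality_gap_eq[of "z (Suc t)" "y (Suc t)"] elim
        by (simp add: xp_def[symmetric] xa_def[symmetric] na_def[symmetric])
      also have "\<dots> \<le> \<Gamma> / 2 * (C\<^sup>2 * T) + 1 / 2 * ((L + p) * (C\<^sup>2 * T))" using h e by linarith
      finally show ?thesis by (simp add: algebra_simps)
    qed
    have val: "M (z (Suc t)) - fstar f A b l u x z \<le> (B * p\<^sup>2 + p / 2) * (3 * C)\<^sup>2 * T"
    proof -
      let ?w = "xp t - z (Suc t)"
      have "norm ?w \<le> norm (xp t - xa t) + norm (xa t - x (Suc t)) + norm (x (Suc t) - z (Suc t))"
        using norm_triangle_ineq[of "xp t - xa t" "xa t - x (Suc t)"]
          norm_triangle_ineq[of "xp t - x (Suc t)" "x (Suc t) - z (Suc t)"] by simp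
      then have "norm ?w \<le> 3 * C * total t" using C(3,4,5)[of t] by linarith
      then have w: "(norm ?w)\<^sup>2 \<le> (3 * C)\<^sup>2 * T" unfolding T_def by (intro sq) auto
      \<comment> \<open>Stationarity of \<open>xp t\<close> for the proximal problem is stationarity
        for \<open>f\<close> with the proximal gradient as perturbation,
        \<open>e = - p *\<^sub>R (xp t - z (Suc t))\<close>.\<close>
      have "f (xp t) - f xb \<le> B * (norm (- p *\<^sub>R ?w))\<^sup>2"
        using xp_stationary[of t] by (intro B(2)[OF xp_feasible(2) _ xb(1,3)]) (simp add: add.assoc)
      also have "(norm (- p *\<^sub>R ?w))\<^sup>2 = p\<^sup>2 * (norm ?w)\<^sup>2" by (simp add: power_mult_distrib)
      finally have "M (z (Suc t)) - fstar f A b l u x z \<le> (B * p\<^sup>2 + p / 2) * (norm ?w)\<^sup>2"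
        by (simp add: prox_val_eq Fz_def xp_def[symmetric] xb(2) algebra_simps)
      also have "\<dots> \<le> (B * p\<^sup>2 + p / 2) * ((3 * C)\<^sup>2 * T)"
        using w B(1) p_pos by (intro mult_left_mono) auto
      finally show ?thesis by (simp add: mult.assoc)
    qed
    show ?case
      using gap val C(6)[of t] by (simp add: potential_def C'_def T_def[symmetric] distrib_right)
  qed
  then show thesis using that \<open>C' > 0\<close> by blast
qed

lemma linear_decrease:
  "\<exists>\<kappa>>0. \<exists>T>0. \<forall>t\<ge>T. potential f A b l u \<Gamma> p x y z t (z t)
       - potential f A b l u \<Gamma> p x y z (Suc t) (z (Suc t))
     \<ge> \<kappa> * potential f A b l u \<Gamma> p x y z (Suc t) (z (Suc t))"
proof -
  obtain C1 where C1: "C1 > 0" "\<And>t. (total t)\<^sup>2 \<le> C1 * dec t" by (rule total_le_dec) blast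
  obtain C2 T where C2: "C2 > 0"
    and T: "\<And>t. t \<ge> T \<Longrightarrow> potential f A b l u \<Gamma> p x y z (Suc t) (z (Suc t)) \<le> C2 * (total t)\<^sup>2"
    using eventually_potential_le unfolding eventually_sequentially by metis
  have "1 / (C2 * C1) * potential f A b l u \<Gamma> p x y z (Suc t) (z (Suc t))
      \<le> potential f A b l u \<Gamma> p x y z t (z t) - potential f A b l u \<Gamma> p x y z (Suc t) (z (Suc t))"
    if "t \<ge> Suc T" for t
  proof -
    have "potential f A b l u \<Gamma> p x y z (Suc t) (z (Suc t)) \<le> C2 * (C1 * dec t)"
      using that C2 by (intro order_trans[OF T mult_left_mono[OF C1(2)]]) auto
    then have "1 / (C2 * C1) * potential f A b l u \<Gamma> p x y z (Suc t) (z (Suc t)) \<le> dec t"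
      using C1(1) C2 by (simp add: field_simps)
    also have "\<dots> \<le> \<phi> (x t) (y t) (z t) - \<phi> (x (Suc t)) (y (Suc t)) (z (Suc t))" by (rule descent)
    finally show ?thesis by (simp add: potential_eq)
  qed
  \<comment> \<open>\<open>Suc T\<close> replaces \<open>T\<close> only to make the threshold
    positive.\<close>
  then show ?thesis using C1(1) C2 by (intro exI[of _ "1 / (C2 * C1)"] conjI exI[of _ "Suc T"]) auto
qed

end

theorem theorem4p9:
  fixes Q :: "real^'n^'n" and r l u :: "real^'n"
    and A :: "real^'n^'m" and b :: "real^'m"
    and f :: "real^'n \<Rightarrow> real"
    and L \<gamma> \<Gamma> p c L_K :: real
  assumes "transpose Q = Q"
    and "f = (\<lambda>x. 1 / 2 * (x \<bullet> (Q *v x)) + r \<bullet> x)"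
    and "\<And>i. l $ i < u $ i"
    and "0 \<in> rel_interior ((\<lambda>x. A *v x - b) ` cbox l u)"
    and "strict_complementarity f A b l u"
    and "L > 0" and "L-lipschitz_on (cbox l u) (grad f)"
    and "\<And>x x'. x \<in> cbox l u \<Longrightarrow> x' \<in> cbox l u \<Longrightarrow>
           (grad f x - grad f x') \<bullet> (x - x') \<ge> \<gamma> * (norm (x - x'))\<^sup>2"
    and "\<Gamma> > 0" and "p > 0" and "p > - \<gamma>"
    and "L_K = L + p + \<Gamma> * (onorm (\<lambda>x. A *v x))\<^sup>2"
    and "0 < c" and "c < 1 / L_K"
  shows "\<exists>\<alpha>\<^sub>0>0. \<forall>\<alpha>. 0 < \<alpha> \<and> \<alpha> < \<alpha>\<^sub>0 \<longrightarrow>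
    (\<forall>y\<^sub>0 :: real^'m. \<exists>\<beta>\<^sub>0>0. \<forall>\<beta>. 0 < \<beta> \<and> \<beta> < \<beta>\<^sub>0 \<and> \<beta> \<le> 1 \<longrightarrow>
      (\<forall>x y z. prox_ialm f A b l u \<Gamma> p c \<alpha> \<beta> x y z \<and> y 0 = y\<^sub>0 \<longrightarrow>
        (\<exists>\<kappa>>0. \<exists>t\<^sub>m\<^sub>a\<^sub>x>0. \<forall>t\<ge>t\<^sub>m\<^sub>a\<^sub>x.
          potential f A b l u \<Gamma> p x y z t (z t)
            - potential f A b l u \<Gamma> p x y z (Suc t) (z (Suc t))
          \<ge> \<kappa> * potential f A b l u \<Gamma> p x y z (Suc t) (z (Suc t)))))"
proof -
  have grad: "grad f w = Q *v w + r" for w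
    unfolding assms(2) by (rule grad_quadratic[OF assms(1)])
  obtain x0 \<delta> where \<delta>: "\<delta> > 0" "cball x0 \<delta> \<subseteq> cbox l u" "A *v x0 = b"
    using interior_feasible_point[OF assms(3,4)] by blast
  have Q: "norm (Q *v v) \<le> L * norm v" "\<gamma> * (norm v)\<^sup>2 \<le> (Q *v v) \<bullet> v" for v
  proof -
    \<comment> \<open>Scaling keeps \<open>x0 + s *\<^sub>R v\<close> in the ball for every
      \<open>v\<close>, and both inequalities are homogeneous in \<open>s\<close>, so the bounds on
      the box become bounds on \<open>Q\<close>. The summand 1 covers \<open>v = 0\<close>.\<close>
    define s where "s = \<delta> / (norm v + 1)"
    have s: "s > 0" "s * norm v \<le> \<delta>" using \<delta>(1) by (auto simp: s_def field_simps add_pos_nonneg)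
    have in_box: "x0 \<in> cbox l u" "x0 + s *\<^sub>R v \<in> cbox l u"
      using \<delta> s by (auto simp: subset_iff dist_norm)
    have diff: "grad f (x0 + s *\<^sub>R v) - grad f x0 = s *\<^sub>R (Q *v v)"
      by (simp add: grad matrix_vector_right_distrib matrix_vector_mult_scaleR)
    have "s * norm (Q *v v) \<le> s * (L * norm v)"
      using lipschitz_onD[OF assms(7) in_box(2,1)] s(1) by (simp add: dist_norm diff mult_ac)
    then show "norm (Q *v v) \<le> L * norm v" using s(1) by simp
    have "s\<^sup>2 * (\<gamma> * (norm v)\<^sup>2) \<le> s\<^sup>2 * ((Q *v v) \<bullet> v)"
      using assms(8)[OF in_box(2,1)] s(1) unfolding diff
      by (simp add: power_mult_distrib power2_eq_square[of s] mult_ac)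
    then show "\<gamma> * (norm v)\<^sup>2 \<le> (Q *v v) \<bullet> v" using s(1) by simp
  qed
  interpret P: prox_alm Q r l u x0 A b L \<gamma> p \<delta> \<Gamma> c L_K
    by unfold_locales (use assms \<delta> Q in auto)
  have f: "f = P.f" unfolding P.f_eq by (rule assms(2))
  obtain \<sigma> where \<sigma>: "\<sigma> \<ge> 0"
    "\<And>v w. norm (P.xF w - P.xd v w) \<le> \<sigma> * norm (A *v P.xd v w - b)"
    using P.dual_error_bound P.\<Gamma>_nonneg by metis
  define a where "a = (onorm ((*v) A) * P.\<sigma>\<^sub>1)\<^sup>2"
  have a: "a \<ge> 0" by (simp add: a_def)
  \<comment> \<open>Solves the \<alpha> condition of \<open>sufficient_descent\<close>;
    \<open>a + 1\<close> keeps the quotient meaningful for \<open>a = 0\<close>.\<close>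
  define \<alpha>\<^sub>0 where "\<alpha>\<^sub>0 = 1 / (4 * c * (a + 1))"
  have "\<alpha>\<^sub>0 > 0" using a \<open>0 < c\<close> by (simp add: \<alpha>\<^sub>0_def)
  show ?thesis
  proof (rule exI[of _ \<alpha>\<^sub>0], intro conjI allI impI \<open>\<alpha>\<^sub>0 > 0\<close>, elim conjE)
    fix \<alpha> y\<^sub>0 assume \<alpha>: "0 < \<alpha>" "\<alpha> < \<alpha>\<^sub>0"
    have \<alpha>_small: "\<alpha> * a \<le> 1 / (4 * c)"
    proof -
      have "\<alpha> * (a + 1) \<le> \<alpha>\<^sub>0 * (a + 1)" using \<alpha> a by (intro mult_right_mono) auto
      also have "\<dots> = 1 / (4 * c)" using a by (simp add: \<alpha>\<^sub>0_def)
      finally show ?thesis using \<alpha>(1) by (simp add: distrib_left)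
    qed
    \<comment> \<open>The left side of the \<beta> condition. It depends on \<alpha> through the
      Young weight, and \<sigma> is uniform in the dual variable.\<close>
    define e where "e = 2 * p * (p / (\<gamma> + p)) + 2 * p\<^sup>2 * \<sigma>\<^sup>2 / \<alpha>"
    have e: "e \<ge> 0" using P.p_pos P.m_pos \<alpha>(1) by (simp add: e_def)
    define \<beta>\<^sub>0 where "\<beta>\<^sub>0 = p / (4 * (e + 1))"
    have "\<beta>\<^sub>0 > 0" using e P.p_pos by (simp add: \<beta>\<^sub>0_def)
    show "\<exists>\<beta>\<^sub>0>0. \<forall>\<beta>. 0 < \<beta> \<and> \<beta> < \<beta>\<^sub>0 \<and> \<beta> \<le> 1 \<longrightarrow>
      (\<forall>x y z. prox_ialm f A b l u \<Gamma> p c \<alpha> \<beta> x y z \<and> y 0 = y\<^sub>0 \<longrightarrow>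
        (\<exists>\<kappa>>0. \<exists>t\<^sub>m\<^sub>a\<^sub>x>0. \<forall>t\<ge>t\<^sub>m\<^sub>a\<^sub>x.
          potential f A b l u \<Gamma> p x y z t (z t)
            - potential f A b l u \<Gamma> p x y z (Suc t) (z (Suc t))
          \<ge> \<kappa> * potential f A b l u \<Gamma> p x y z (Suc t) (z (Suc t))))"
    proof (rule exI[of _ \<beta>\<^sub>0], intro conjI allI impI \<open>\<beta>\<^sub>0 > 0\<close>, elim conjE)
      fix \<beta> x y z
      assume \<beta>: "0 < \<beta>" "\<beta> < \<beta>\<^sub>0" "\<beta> \<le> 1" and run: "prox_ialm f A b l u \<Gamma> p c \<alpha> \<beta> x y z"
      have "e \<le> p / (4 * \<beta>)"
      proof -
        have "\<beta> * (4 * (e + 1)) \<le> p" using \<beta>(2) e by (simp add: \<beta>\<^sub>0_def pos_less_divide_eq)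
        then have "e * (4 * \<beta>) \<le> p" using \<beta>(1) by (simp add: algebra_simps)
        then show ?thesis using \<beta>(1) by (simp add: pos_le_divide_eq)
      qed
      then interpret R: prox_alm_run Q r l u x0 A b L \<gamma> p \<delta> \<Gamma> c L_K \<alpha> \<beta> \<sigma> x z y
        using \<alpha>(1) \<beta> \<sigma> \<alpha>_small run assms(5) unfolding f a_def e_def by unfold_locales auto
      show "\<exists>\<kappa>>0. \<exists>t\<^sub>m\<^sub>a\<^sub>x>0. \<forall>t\<ge>t\<^sub>m\<^sub>a\<^sub>x.
          potential f A b l u \<Gamma> p x y z t (z t)
            - potential f A b l u \<Gamma> p x y z (Suc t) (z (Suc t))
          \<ge> \<kappa> * potential f A b l u \<Gamma> p x y z (Suc t) (z (Suc t))"
        unfolding f by (rule R.linear_decrease)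
    qed
  qed
qed

end
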